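(* It is provable in $\mathbf{ZF}$ that $\mathbf{CMC}$ implies that, for every topological space $\mathbf{X}$, the following conditions are satisfied: (i) if $\mathbf{X}$ is completely regular and every zero-set in $\mathbf{X}$ is open, then $\mathbf{X}$ is a $P$-space; (ii) if $\mathbf{X}$ is a zero-dimensional space such that every member of $\mathcal{CO}_{\delta}(\mathbf{X})$ is open in $\mathbf{X}$, then $\mathbf{X}$ is a $P$-space; (iii) if $\mathbf{X}$ is completely regular and $C(\mathbf{X},\mathbb{R}_{disc})=C(\mathbf{X})$, then $\mathbf{X}$ is a $P$-space; (iv) if $\mathbf{X}$ is zero-dimensional, then $\mathbf{X}$ is a $P$-space if and only if $U_{\aleph_0}(\mathbf{X})=C(\mathbf{X},\mathbb{R}_{disc})=C(\mathbf{X})$.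
   Context: The base theory is $\mathbf{ZF}$ (no Axiom of Choice). A set is countable if it is equipotent to a subset of $\omega$, and denumerable if it is infinite and countable. $\mathbf{CMC}$: every denumerable family of non-empty sets has a multiple choice function, i.e. a function assigning to each member (index) a non-empty finite subset of it. A topological space is a $P$-space if all its $G_\delta$-sets are open. $C(\mathbf{X})$ is the set of continuous functions from $\mathbf{X}$ to $\mathbb{R}$ with its natural topology; $C(\mathbf{X},\mathbb{R}_{disc})$ is the set of functions continuous into $\mathbb{R}$ with the discrete topology. A zero-set is a set $f^{-1}[\{0\}]$ with $f\in C(\mathbf{X})$. $\mathbf{X}$ is completely regular if complements of zero-sets form a base, and zero-dimensional if the clopen sets form a base. $\mathcal{CO}_\delta(\mathbf{X})$ is the family of all intersections of non-empty countable families of clopen sets of $\mathbf{X}$. $U_{\aleph_0}(\mathbf{X})$ is the set of all $f\in C(\mathbf{X})$ such that for each $\varepsilon>0$ there is a countable cover $\mathcal{A}$ of $X$ by clopen sets with $\sup\{|f(x)-f(y)|:x,y\in A\}\le\varepsilon$ for all $A\in\mathcal{A}$. *)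

theory Defs
  imports Main
begin

text \<open>
  The theorem is a provability claim about \<open>ZF\<close> without choice, whereas HOL itself has a choice
  operator. Therefore first-order logic over the signature \<open>{\<in>, =}\<close>, a proof calculus for it and
  the axioms of \<open>ZF\<close> are embedded deeply, and the claim is that one particular first-order
  sentence is derivable from \<open>ZF\<close>.
\<close>

section \<open>First-order logic of set theory\<close>

text \<open>Variables are de Bruijn indices; the only terms are variables.\<close>

datatype fm =
    Mem nat nat
  | Eq nat nat
  | Bot
  | Imp fm fm
  | All fm

primrec ren :: "(nat \<Rightarrow> nat) \<Rightarrow> fm \<Rightarrow> fm" where
  "ren r (Mem i j) = Mem (r i) (r j)"
| "ren r (Eq i j) = Eq (r i) (r j)"
| "ren r Bot = Bot"
| "ren r (Imp p q) = Imp (ren r p) (ren r q)"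
| "ren r (All p) = All (ren (case_nat 0 (\<lambda>j. Suc (r j))) p)"

text \<open>\<open>bounded k p\<close>: all free indices of \<open>p\<close> are below \<open>k\<close>; \<open>bounded 0\<close> characterizes sentences.\<close>

primrec bounded :: "nat \<Rightarrow> fm \<Rightarrow> bool" where
  "bounded k (Mem i j) \<longleftrightarrow> i < k \<and> j < k"
| "bounded k (Eq i j) \<longleftrightarrow> i < k \<and> j < k"
| "bounded k Bot \<longleftrightarrow> True"
| "bounded k (Imp p q) \<longleftrightarrow> bounded k p \<and> bounded k q"
| "bounded k (All p) \<longleftrightarrow> bounded (Suc k) p"

text \<open>
  Classical natural deduction with equality. \<open>ren (case_nat t id) p\<close> substitutes the variable \<open>t\<close>
  for the index 0 in \<open>p\<close>; in \<open>AllI\<close> the shift of the hypotheses is the eigenvariable condition.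
\<close>

inductive deriv :: "fm set \<Rightarrow> fm \<Rightarrow> bool" (infix \<open>\<turnstile>\<close> 50) where
  Assm: "p \<in> \<Gamma> \<Longrightarrow> \<Gamma> \<turnstile> p"
| ImpI: "insert p \<Gamma> \<turnstile> q \<Longrightarrow> \<Gamma> \<turnstile> Imp p q"
| ImpE: "\<Gamma> \<turnstile> Imp p q \<Longrightarrow> \<Gamma> \<turnstile> p \<Longrightarrow> \<Gamma> \<turnstile> q"
| RAA: "insert (Imp p Bot) \<Gamma> \<turnstile> Bot \<Longrightarrow> \<Gamma> \<turnstile> p"
| AllI: "ren Suc ` \<Gamma> \<turnstile> p \<Longrightarrow> \<Gamma> \<turnstile> All p"
| AllE: "\<Gamma> \<turnstile> All p \<Longrightarrow> \<Gamma> \<turnstile> ren (case_nat t id) p"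
| EqRefl: "\<Gamma> \<turnstile> Eq t t"
| EqSubst: "\<Gamma> \<turnstile> Eq s t \<Longrightarrow> \<Gamma> \<turnstile> ren (case_nat s id) p \<Longrightarrow> \<Gamma> \<turnstile> ren (case_nat t id) p"


section \<open>Writing formulas with named variables\<close>

text \<open>
  To write formulas legibly, a formula is given as a function of the number \<open>n\<close> of quantifiers in
  whose scope it stands, and variables are referred to by level, that is, by the number of
  quantifiers enclosing their own quantifier. Level \<open>x\<close> at depth \<open>n\<close> is the index \<open>n - Suc x\<close>.
  A binder passes the level of the variable it introduces to its body. The actual formula
  denoted by an expression without free variables is its value at depth 0.
\<close>

type_synonym lfm = "nat \<Rightarrow> fm"

definition mem :: "nat \<Rightarrow> nat \<Rightarrow> lfm" (infix \<open>\<^bold>\<in>\<close> 70) where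
  "x \<^bold>\<in> y = (\<lambda>n. Mem (n - Suc x) (n - Suc y))"

definition eql :: "nat \<Rightarrow> nat \<Rightarrow> lfm" (infix \<open>\<^bold>=\<close> 70) where
  "x \<^bold>= y = (\<lambda>n. Eq (n - Suc x) (n - Suc y))"

definition imp :: "lfm \<Rightarrow> lfm \<Rightarrow> lfm" (infixr \<open>\<^bold>\<longrightarrow>\<close> 55) where
  "p \<^bold>\<longrightarrow> q = (\<lambda>n. Imp (p n) (q n))"

definition neg :: "lfm \<Rightarrow> lfm" (\<open>\<^bold>\<not> _\<close> [65] 65) where
  "\<^bold>\<not> p = (\<lambda>n. Imp (p n) Bot)"

definition dis :: "lfm \<Rightarrow> lfm \<Rightarrow> lfm" (infixr \<open>\<^bold>\<or>\<close> 58) where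
  "p \<^bold>\<or> q = (\<^bold>\<not> p \<^bold>\<longrightarrow> q)"

definition con :: "lfm \<Rightarrow> lfm \<Rightarrow> lfm" (infixr \<open>\<^bold>\<and>\<close> 60) where
  "p \<^bold>\<and> q = (\<^bold>\<not> (p \<^bold>\<longrightarrow> \<^bold>\<not> q))"

definition iff :: "lfm \<Rightarrow> lfm \<Rightarrow> lfm" (infixr \<open>\<^bold>\<longleftrightarrow>\<close> 53) where
  "p \<^bold>\<longleftrightarrow> q = ((p \<^bold>\<longrightarrow> q) \<^bold>\<and> (q \<^bold>\<longrightarrow> p))"

definition all :: "(nat \<Rightarrow> lfm) \<Rightarrow> lfm" (binder \<open>\<^bold>\<forall>\<close> 50) where
  "all F = (\<lambda>n. All (F n (Suc n)))"

definition exi :: "(nat \<Rightarrow> lfm) \<Rightarrow> lfm" (binder \<open>\<^bold>\<exists>\<close> 50) where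
  "(\<^bold>\<exists>x. F x) = (\<^bold>\<not> (\<^bold>\<forall>x. \<^bold>\<not> F x))"

text \<open>
  \<open>inst p xs\<close>: the formula \<open>p\<close> with its first free indices replaced by the variables \<open>xs\<close>; the
  remaining ones are parameters and become the outermost variables, of levels 0, 1, \<dots>
\<close>

definition inst :: "fm \<Rightarrow> nat list \<Rightarrow> lfm" where
  "inst p xs = (\<lambda>n. ren (\<lambda>i. n - Suc (if i < length xs then xs ! i else i - length xs)) p)"


section \<open>Basic set theory\<close>

definition fsub :: "nat \<Rightarrow> nat \<Rightarrow> lfm" (infix \<open>\<^bold>\<subseteq>\<close> 70) where
  "x \<^bold>\<subseteq> y = (\<^bold>\<forall>z. z \<^bold>\<in> x \<^bold>\<longrightarrow> z \<^bold>\<in> y)"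

definition fempty :: "nat \<Rightarrow> lfm" where
  "fempty x = (\<^bold>\<not> (\<^bold>\<exists>z. z \<^bold>\<in> x))"

definition fupair :: "nat \<Rightarrow> nat \<Rightarrow> nat \<Rightarrow> lfm" where
  "fupair p x y = (\<^bold>\<forall>z. z \<^bold>\<in> p \<^bold>\<longleftrightarrow> z \<^bold>= x \<^bold>\<or> z \<^bold>= y)"

text \<open>Kuratowski pairs\<close>
definition fpair :: "nat \<Rightarrow> nat \<Rightarrow> nat \<Rightarrow> lfm" where
  "fpair p x y = (\<^bold>\<forall>z. z \<^bold>\<in> p \<^bold>\<longleftrightarrow> fupair z x x \<^bold>\<or> fupair z x y)"

text \<open>\<open>frel f x y\<close>: \<open>(x, y) \<in> f\<close>; for a function \<open>f\<close> this says \<open>f(x) = y\<close>\<close>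
definition frel :: "nat \<Rightarrow> nat \<Rightarrow> nat \<Rightarrow> lfm" where
  "frel f x y = (\<^bold>\<exists>p. fpair p x y \<^bold>\<and> p \<^bold>\<in> f)"

text \<open>\<open>P\<close> is the product of \<open>A\<close> and \<open>B\<close>\<close>
definition fprod :: "nat \<Rightarrow> nat \<Rightarrow> nat \<Rightarrow> lfm" where
  "fprod P A B = (\<^bold>\<forall>p. p \<^bold>\<in> P \<^bold>\<longleftrightarrow> (\<^bold>\<exists>x. \<^bold>\<exists>y. x \<^bold>\<in> A \<^bold>\<and> y \<^bold>\<in> B \<^bold>\<and> fpair p x y))"

text \<open>\<open>f\<close> is a relation between \<open>A\<close> and \<open>B\<close>, a function from \<open>A\<close> to \<open>B\<close>, a bijection\<close>
definition frelation :: "nat \<Rightarrow> nat \<Rightarrow> nat \<Rightarrow> lfm" where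
  "frelation f A B = (\<^bold>\<forall>p. p \<^bold>\<in> f \<^bold>\<longrightarrow> (\<^bold>\<exists>x. \<^bold>\<exists>y. x \<^bold>\<in> A \<^bold>\<and> y \<^bold>\<in> B \<^bold>\<and> fpair p x y))"

definition ffun :: "nat \<Rightarrow> nat \<Rightarrow> nat \<Rightarrow> lfm" where
  "ffun f A B = (frelation f A B \<^bold>\<and>
     (\<^bold>\<forall>x. x \<^bold>\<in> A \<^bold>\<longrightarrow> (\<^bold>\<exists>y. frel f x y \<^bold>\<and> (\<^bold>\<forall>z. frel f x z \<^bold>\<longrightarrow> z \<^bold>= y))))"

definition fbij :: "nat \<Rightarrow> nat \<Rightarrow> nat \<Rightarrow> lfm" where
  "fbij f A B = (ffun f A B \<^bold>\<and>
     (\<^bold>\<forall>y. y \<^bold>\<in> B \<^bold>\<longrightarrow> (\<^bold>\<exists>x. frel f x y \<^bold>\<and> (\<^bold>\<forall>z. frel f z y \<^bold>\<longrightarrow> z \<^bold>= x))))"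

definition fsuc :: "nat \<Rightarrow> nat \<Rightarrow> lfm" where
  "fsuc y x = (\<^bold>\<forall>z. z \<^bold>\<in> y \<^bold>\<longleftrightarrow> z \<^bold>\<in> x \<^bold>\<or> z \<^bold>= x)"

definition finductive :: "nat \<Rightarrow> lfm" where
  "finductive w = ((\<^bold>\<exists>e. fempty e \<^bold>\<and> e \<^bold>\<in> w) \<^bold>\<and>
     (\<^bold>\<forall>x. x \<^bold>\<in> w \<^bold>\<longrightarrow> (\<^bold>\<exists>y. fsuc y x \<^bold>\<and> y \<^bold>\<in> w)))"

definition fomega :: "nat \<Rightarrow> lfm" where
  "fomega w = (finductive w \<^bold>\<and> (\<^bold>\<forall>v. finductive v \<^bold>\<longrightarrow> w \<^bold>\<subseteq> v))"

definition ffinite :: "nat \<Rightarrow> lfm" where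
  "ffinite A = (\<^bold>\<exists>w. \<^bold>\<exists>k. \<^bold>\<exists>f. fomega w \<^bold>\<and> k \<^bold>\<in> w \<^bold>\<and> fbij f A k)"

definition fcountable :: "nat \<Rightarrow> lfm" where
  "fcountable A = (\<^bold>\<exists>w. \<^bold>\<exists>S. \<^bold>\<exists>f. fomega w \<^bold>\<and> S \<^bold>\<subseteq> w \<^bold>\<and> fbij f A S)"

definition fdenumerable :: "nat \<Rightarrow> lfm" where
  "fdenumerable A = (\<^bold>\<not> ffinite A \<^bold>\<and> fcountable A)"


section \<open>The axioms of ZF\<close>

text \<open>
  The schemas range over all formulas \<open>p\<close> with \<open>k\<close> parameters, and an instance is universally
  closed over these by \<open>All ^^ k\<close>. In \<open>Separation\<close> the index 0 of \<open>p\<close> is the element, in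
  \<open>Replacement\<close> the indices 0 and 1 are the argument and the value.
\<close>

inductive_set ZF :: "fm set" where
  Extensionality: "(\<^bold>\<forall>x. \<^bold>\<forall>y. (\<^bold>\<forall>z. z \<^bold>\<in> x \<^bold>\<longleftrightarrow> z \<^bold>\<in> y) \<^bold>\<longrightarrow> x \<^bold>= y) 0 \<in> ZF"
| Foundation: "(\<^bold>\<forall>x. (\<^bold>\<exists>y. y \<^bold>\<in> x) \<^bold>\<longrightarrow> (\<^bold>\<exists>y. y \<^bold>\<in> x \<^bold>\<and> \<^bold>\<not> (\<^bold>\<exists>z. z \<^bold>\<in> x \<^bold>\<and> z \<^bold>\<in> y))) 0 \<in> ZF"
| Pairing: "(\<^bold>\<forall>x. \<^bold>\<forall>y. \<^bold>\<exists>p. fupair p x y) 0 \<in> ZF"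
| Union: "(\<^bold>\<forall>x. \<^bold>\<exists>u. \<^bold>\<forall>z. z \<^bold>\<in> u \<^bold>\<longleftrightarrow> (\<^bold>\<exists>y. y \<^bold>\<in> x \<^bold>\<and> z \<^bold>\<in> y)) 0 \<in> ZF"
| Power: "(\<^bold>\<forall>x. \<^bold>\<exists>u. \<^bold>\<forall>z. z \<^bold>\<in> u \<^bold>\<longleftrightarrow> z \<^bold>\<subseteq> x) 0 \<in> ZF"
| Infinity: "(\<^bold>\<exists>w. finductive w) 0 \<in> ZF"
| Separation: "bounded (Suc k) p \<Longrightarrow>
    (All ^^ k) ((\<^bold>\<forall>a. \<^bold>\<exists>b. \<^bold>\<forall>x. x \<^bold>\<in> b \<^bold>\<longleftrightarrow> x \<^bold>\<in> a \<^bold>\<and> inst p [x]) k) \<in> ZF"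
| Replacement: "bounded (Suc (Suc k)) p \<Longrightarrow>
    (All ^^ k) (((\<^bold>\<forall>x. \<^bold>\<forall>y. \<^bold>\<forall>z. inst p [x, y] \<^bold>\<and> inst p [x, z] \<^bold>\<longrightarrow> y \<^bold>= z) \<^bold>\<longrightarrow>
      (\<^bold>\<forall>a. \<^bold>\<exists>b. \<^bold>\<forall>y. y \<^bold>\<in> b \<^bold>\<longleftrightarrow> (\<^bold>\<exists>x. x \<^bold>\<in> a \<^bold>\<and> inst p [x, y]))) k) \<in> ZF"


section \<open>Countable multiple choice\<close>

definition CMC :: lfm where
  "CMC = (\<^bold>\<forall>A. fdenumerable A \<^bold>\<and> (\<^bold>\<forall>x. x \<^bold>\<in> A \<^bold>\<longrightarrow> \<^bold>\<not> fempty x) \<^bold>\<longrightarrow>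
     (\<^bold>\<exists>f. \<^bold>\<exists>B. ffun f A B \<^bold>\<and>
        (\<^bold>\<forall>x. \<^bold>\<forall>y. x \<^bold>\<in> A \<^bold>\<and> frel f x y \<^bold>\<longrightarrow> \<^bold>\<not> fempty y \<^bold>\<and> y \<^bold>\<subseteq> x \<^bold>\<and> ffinite y)))"


section \<open>The real numbers\<close>

text \<open>
  The real field is a complete ordered field, which is unique up to isomorphism, with its order
  topology. Its carrier, its operations and its strict order are given by four set variables;
  statements about the reals are made for every such structure.
\<close>

datatype real_vars = Real_Vars (car: nat) (addn: nat) (muln: nat) (lessn: nat)

definition fop :: "nat \<Rightarrow> nat \<Rightarrow> nat \<Rightarrow> nat \<Rightarrow> lfm" where
  "fop f x y z = (\<^bold>\<exists>p. fpair p x y \<^bold>\<and> frel f p z)"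

abbreviation fadd :: "real_vars \<Rightarrow> nat \<Rightarrow> nat \<Rightarrow> nat \<Rightarrow> lfm" where
  "fadd \<R> \<equiv> fop (addn \<R>)"

abbreviation fmul :: "real_vars \<Rightarrow> nat \<Rightarrow> nat \<Rightarrow> nat \<Rightarrow> lfm" where
  "fmul \<R> \<equiv> fop (muln \<R>)"

abbreviation fless :: "real_vars \<Rightarrow> nat \<Rightarrow> nat \<Rightarrow> lfm" where
  "fless \<R> \<equiv> frel (lessn \<R>)"

definition fle :: "real_vars \<Rightarrow> nat \<Rightarrow> nat \<Rightarrow> lfm" where
  "fle \<R> x y = (fless \<R> x y \<^bold>\<or> x \<^bold>= y)"

definition fneutral :: "nat \<Rightarrow> nat \<Rightarrow> nat \<Rightarrow> lfm" where
  "fneutral f A e = (e \<^bold>\<in> A \<^bold>\<and> (\<^bold>\<forall>x. x \<^bold>\<in> A \<^bold>\<longrightarrow> fop f e x x))"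

abbreviation fzero :: "real_vars \<Rightarrow> nat \<Rightarrow> lfm" where
  "fzero \<R> \<equiv> fneutral (addn \<R>) (car \<R>)"

abbreviation fone :: "real_vars \<Rightarrow> nat \<Rightarrow> lfm" where
  "fone \<R> \<equiv> fneutral (muln \<R>) (car \<R>)"

definition fbinop :: "nat \<Rightarrow> nat \<Rightarrow> lfm" where
  "fbinop f A = (\<^bold>\<exists>P. fprod P A A \<^bold>\<and> ffun f P A)"

text \<open>an associative and commutative binary operation with a neutral element\<close>
definition fcomm_monoid :: "nat \<Rightarrow> nat \<Rightarrow> lfm" where
  "fcomm_monoid f A = (fbinop f A \<^bold>\<and>
     (\<^bold>\<forall>x. \<^bold>\<forall>y. \<^bold>\<forall>z. \<^bold>\<forall>s. \<^bold>\<forall>t. \<^bold>\<forall>u. \<^bold>\<forall>v. x \<^bold>\<in> A \<^bold>\<and> y \<^bold>\<in> A \<^bold>\<and> z \<^bold>\<in> A \<^bold>\<and>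
        fop f x y s \<^bold>\<and> fop f s z u \<^bold>\<and> fop f y z t \<^bold>\<and> fop f x t v \<^bold>\<longrightarrow> u \<^bold>= v) \<^bold>\<and>
     (\<^bold>\<forall>x. \<^bold>\<forall>y. \<^bold>\<forall>s. x \<^bold>\<in> A \<^bold>\<and> y \<^bold>\<in> A \<^bold>\<and> fop f x y s \<^bold>\<longrightarrow> fop f y x s) \<^bold>\<and>
     (\<^bold>\<exists>e. fneutral f A e))"

definition ffield :: "real_vars \<Rightarrow> lfm" where
  "ffield \<R> = (fcomm_monoid (addn \<R>) (car \<R>) \<^bold>\<and> fcomm_monoid (muln \<R>) (car \<R>) \<^bold>\<and>
     (\<^bold>\<forall>x. \<^bold>\<forall>y. \<^bold>\<forall>z. \<^bold>\<forall>s. \<^bold>\<forall>t. \<^bold>\<forall>u. \<^bold>\<forall>v. x \<^bold>\<in> car \<R> \<^bold>\<and> y \<^bold>\<in> car \<R> \<^bold>\<and> z \<^bold>\<in> car \<R> \<^bold>\<and>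
        fadd \<R> y z s \<^bold>\<and> fmul \<R> x s t \<^bold>\<and> fmul \<R> x y u \<^bold>\<and> fmul \<R> x z v \<^bold>\<longrightarrow> fadd \<R> u v t) \<^bold>\<and>
     (\<^bold>\<forall>x. x \<^bold>\<in> car \<R> \<^bold>\<longrightarrow> (\<^bold>\<exists>y. \<^bold>\<exists>c. y \<^bold>\<in> car \<R> \<^bold>\<and> fzero \<R> c \<^bold>\<and> fadd \<R> x y c)) \<^bold>\<and>
     (\<^bold>\<forall>x. x \<^bold>\<in> car \<R> \<^bold>\<and> \<^bold>\<not> fzero \<R> x \<^bold>\<longrightarrow> (\<^bold>\<exists>y. \<^bold>\<exists>i. y \<^bold>\<in> car \<R> \<^bold>\<and> fone \<R> i \<^bold>\<and> fmul \<R> x y i)) \<^bold>\<and>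
     \<^bold>\<not> (\<^bold>\<exists>c. fzero \<R> c \<^bold>\<and> fone \<R> c))"

definition fordered_field :: "real_vars \<Rightarrow> lfm" where
  "fordered_field \<R> = (ffield \<R> \<^bold>\<and> frelation (lessn \<R>) (car \<R>) (car \<R>) \<^bold>\<and>
     (\<^bold>\<forall>x. x \<^bold>\<in> car \<R> \<^bold>\<longrightarrow> \<^bold>\<not> fless \<R> x x) \<^bold>\<and>
     (\<^bold>\<forall>x. \<^bold>\<forall>y. \<^bold>\<forall>z. fless \<R> x y \<^bold>\<and> fless \<R> y z \<^bold>\<longrightarrow> fless \<R> x z) \<^bold>\<and>
     (\<^bold>\<forall>x. \<^bold>\<forall>y. x \<^bold>\<in> car \<R> \<^bold>\<and> y \<^bold>\<in> car \<R> \<^bold>\<longrightarrow> fless \<R> x y \<^bold>\<or> x \<^bold>= y \<^bold>\<or> fless \<R> y x) \<^bold>\<and>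
     (\<^bold>\<forall>x. \<^bold>\<forall>y. \<^bold>\<forall>z. \<^bold>\<forall>s. \<^bold>\<forall>t. z \<^bold>\<in> car \<R> \<^bold>\<and> fless \<R> x y \<^bold>\<and> fadd \<R> x z s \<^bold>\<and> fadd \<R> y z t
        \<^bold>\<longrightarrow> fless \<R> s t) \<^bold>\<and>
     (\<^bold>\<forall>x. \<^bold>\<forall>y. \<^bold>\<forall>c. \<^bold>\<forall>s. fzero \<R> c \<^bold>\<and> fless \<R> c x \<^bold>\<and> fless \<R> c y \<^bold>\<and> fmul \<R> x y s
        \<^bold>\<longrightarrow> fless \<R> c s))"

definition fupper_bound :: "real_vars \<Rightarrow> nat \<Rightarrow> nat \<Rightarrow> lfm" where
  "fupper_bound \<R> S b = (b \<^bold>\<in> car \<R> \<^bold>\<and> (\<^bold>\<forall>x. x \<^bold>\<in> S \<^bold>\<longrightarrow> fle \<R> x b))"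

definition fcomplete_ordered_field :: "real_vars \<Rightarrow> lfm" where
  "fcomplete_ordered_field \<R> = (fordered_field \<R> \<^bold>\<and>
     (\<^bold>\<forall>S. S \<^bold>\<subseteq> car \<R> \<^bold>\<and> \<^bold>\<not> fempty S \<^bold>\<and> (\<^bold>\<exists>b. fupper_bound \<R> S b) \<^bold>\<longrightarrow>
        (\<^bold>\<exists>s. fupper_bound \<R> S s \<^bold>\<and> (\<^bold>\<forall>b. fupper_bound \<R> S b \<^bold>\<longrightarrow> fle \<R> s b))))"

definition for_reals :: "(real_vars \<Rightarrow> lfm) \<Rightarrow> lfm" (binder \<open>\<^bold>\<forall>\<^sub>R\<close> 50) where
  "(\<^bold>\<forall>\<^sub>R \<R>. F \<R>) = (\<^bold>\<forall>R. \<^bold>\<forall>a. \<^bold>\<forall>m. \<^bold>\<forall>l.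
     fcomplete_ordered_field (Real_Vars R a m l) \<^bold>\<longrightarrow> F (Real_Vars R a m l))"

text \<open>\<open>d = \<bar>x - y\<bar>\<close>, where \<open>w = x - y\<close>\<close>
definition fabsdiff :: "real_vars \<Rightarrow> nat \<Rightarrow> nat \<Rightarrow> nat \<Rightarrow> lfm" where
  "fabsdiff \<R> x y d = (\<^bold>\<exists>w. \<^bold>\<exists>c. w \<^bold>\<in> car \<R> \<^bold>\<and> d \<^bold>\<in> car \<R> \<^bold>\<and> fadd \<R> w y x \<^bold>\<and> fzero \<R> c \<^bold>\<and>
     (fle \<R> c w \<^bold>\<and> d \<^bold>= w \<^bold>\<or> fless \<R> w c \<^bold>\<and> fadd \<R> w d c))"

text \<open>open sets of the order topology, and of the discrete topology, on the reals\<close>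
definition fopen :: "real_vars \<Rightarrow> nat \<Rightarrow> lfm" where
  "fopen \<R> V = (V \<^bold>\<subseteq> car \<R> \<^bold>\<and> (\<^bold>\<forall>x. x \<^bold>\<in> V \<^bold>\<longrightarrow>
     (\<^bold>\<exists>a. \<^bold>\<exists>b. fless \<R> a x \<^bold>\<and> fless \<R> x b \<^bold>\<and>
        (\<^bold>\<forall>y. fless \<R> a y \<^bold>\<and> fless \<R> y b \<^bold>\<longrightarrow> y \<^bold>\<in> V))))"

definition fopen_disc :: "real_vars \<Rightarrow> nat \<Rightarrow> lfm" where
  "fopen_disc \<R> V = (V \<^bold>\<subseteq> car \<R>)"


section \<open>Topology\<close>

text \<open>Here \<open>X\<close> is the underlying set of a space and \<open>T\<close> its family of open sets.\<close>

definition ftopology :: "nat \<Rightarrow> nat \<Rightarrow> lfm" where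
  "ftopology X T = ((\<^bold>\<forall>U. U \<^bold>\<in> T \<^bold>\<longrightarrow> U \<^bold>\<subseteq> X) \<^bold>\<and> X \<^bold>\<in> T \<^bold>\<and> (\<^bold>\<forall>e. fempty e \<^bold>\<longrightarrow> e \<^bold>\<in> T) \<^bold>\<and>
     (\<^bold>\<forall>S. \<^bold>\<forall>U. S \<^bold>\<subseteq> T \<^bold>\<and> (\<^bold>\<forall>x. x \<^bold>\<in> U \<^bold>\<longleftrightarrow> (\<^bold>\<exists>V. V \<^bold>\<in> S \<^bold>\<and> x \<^bold>\<in> V)) \<^bold>\<longrightarrow> U \<^bold>\<in> T) \<^bold>\<and>
     (\<^bold>\<forall>U. \<^bold>\<forall>V. \<^bold>\<forall>W. U \<^bold>\<in> T \<^bold>\<and> V \<^bold>\<in> T \<^bold>\<and> (\<^bold>\<forall>x. x \<^bold>\<in> W \<^bold>\<longleftrightarrow> x \<^bold>\<in> U \<^bold>\<and> x \<^bold>\<in> V) \<^bold>\<longrightarrow> W \<^bold>\<in> T))"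

definition fcompl :: "nat \<Rightarrow> nat \<Rightarrow> nat \<Rightarrow> lfm" where
  "fcompl X A B = (B \<^bold>\<subseteq> X \<^bold>\<and> (\<^bold>\<forall>x. x \<^bold>\<in> A \<^bold>\<longleftrightarrow> x \<^bold>\<in> X \<^bold>\<and> \<^bold>\<not> x \<^bold>\<in> B))"

definition fclopen :: "nat \<Rightarrow> nat \<Rightarrow> nat \<Rightarrow> lfm" where
  "fclopen X T A = (A \<^bold>\<in> T \<^bold>\<and> (\<^bold>\<exists>B. fcompl X B A \<^bold>\<and> B \<^bold>\<in> T))"

text \<open>the sets satisfying \<open>\<B>\<close> form a base of the topology\<close>
definition fbase :: "nat \<Rightarrow> (nat \<Rightarrow> lfm) \<Rightarrow> lfm" where
  "fbase T \<B> = ((\<^bold>\<forall>B. \<B> B \<^bold>\<longrightarrow> B \<^bold>\<in> T) \<^bold>\<and>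
     (\<^bold>\<forall>U. \<^bold>\<forall>x. U \<^bold>\<in> T \<^bold>\<and> x \<^bold>\<in> U \<^bold>\<longrightarrow> (\<^bold>\<exists>B. \<B> B \<^bold>\<and> x \<^bold>\<in> B \<^bold>\<and> B \<^bold>\<subseteq> U)))"

text \<open>\<open>G\<close> is the intersection of a non-empty countable family of sets satisfying \<open>\<S>\<close>\<close>
definition fcountable_inter :: "(nat \<Rightarrow> lfm) \<Rightarrow> nat \<Rightarrow> lfm" where
  "fcountable_inter \<S> G = (\<^bold>\<exists>F. fcountable F \<^bold>\<and> \<^bold>\<not> fempty F \<^bold>\<and> (\<^bold>\<forall>A. A \<^bold>\<in> F \<^bold>\<longrightarrow> \<S> A) \<^bold>\<and>
     (\<^bold>\<forall>x. x \<^bold>\<in> G \<^bold>\<longleftrightarrow> (\<^bold>\<forall>A. A \<^bold>\<in> F \<^bold>\<longrightarrow> x \<^bold>\<in> A)))"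

definition fG_delta :: "nat \<Rightarrow> nat \<Rightarrow> lfm" where
  "fG_delta T G = fcountable_inter (\<lambda>U. U \<^bold>\<in> T) G"

definition fCO_delta :: "nat \<Rightarrow> nat \<Rightarrow> nat \<Rightarrow> lfm" where
  "fCO_delta X T G = fcountable_inter (fclopen X T) G"

definition fP_space :: "nat \<Rightarrow> lfm" where
  "fP_space T = (\<^bold>\<forall>G. fG_delta T G \<^bold>\<longrightarrow> G \<^bold>\<in> T)"

definition fzero_dimensional :: "nat \<Rightarrow> nat \<Rightarrow> lfm" where
  "fzero_dimensional X T = fbase T (fclopen X T)"

text \<open>\<open>f\<close> is continuous into the reals topologized by the sets satisfying \<open>\<O>\<close>\<close>
definition fcontinuous :: "nat \<Rightarrow> nat \<Rightarrow> real_vars \<Rightarrow> (nat \<Rightarrow> lfm) \<Rightarrow> nat \<Rightarrow> lfm" where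
  "fcontinuous X T \<R> \<O> f = (ffun f X (car \<R>) \<^bold>\<and>
     (\<^bold>\<forall>V. \<^bold>\<forall>U. \<O> V \<^bold>\<and> (\<^bold>\<forall>x. x \<^bold>\<in> U \<^bold>\<longleftrightarrow> x \<^bold>\<in> X \<^bold>\<and> (\<^bold>\<exists>y. y \<^bold>\<in> V \<^bold>\<and> frel f x y)) \<^bold>\<longrightarrow> U \<^bold>\<in> T))"

text \<open>\<open>fC X T \<R>\<close> and \<open>fC_disc X T \<R>\<close> are \<open>C(X)\<close> and \<open>C(X, \<real>\<^sub>d\<^sub>i\<^sub>s\<^sub>c)\<close>, \<open>fU X T \<R>\<close> is \<open>U\<^sub>\<aleph>\<^sub>0(X)\<close>.\<close>

definition fC :: "nat \<Rightarrow> nat \<Rightarrow> real_vars \<Rightarrow> nat \<Rightarrow> lfm" where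
  "fC X T \<R> f = fcontinuous X T \<R> (fopen \<R>) f"

definition fC_disc :: "nat \<Rightarrow> nat \<Rightarrow> real_vars \<Rightarrow> nat \<Rightarrow> lfm" where
  "fC_disc X T \<R> f = fcontinuous X T \<R> (fopen_disc \<R>) f"

text \<open>\<open>sup {\<bar>f(x) - f(y)\<bar> : x, y \<in> A} \<le> \<epsilon>\<close> means that \<open>\<epsilon>\<close> is an upper bound; \<open>A\<close> may be empty.\<close>
definition fU :: "nat \<Rightarrow> nat \<Rightarrow> real_vars \<Rightarrow> nat \<Rightarrow> lfm" where
  "fU X T \<R> f = (fC X T \<R> f \<^bold>\<and>
     (\<^bold>\<forall>\<epsilon>. \<^bold>\<forall>c. fzero \<R> c \<^bold>\<and> fless \<R> c \<epsilon> \<^bold>\<longrightarrow>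
        (\<^bold>\<exists>\<A>. fcountable \<A> \<^bold>\<and> (\<^bold>\<forall>A. A \<^bold>\<in> \<A> \<^bold>\<longrightarrow> fclopen X T A) \<^bold>\<and>
           (\<^bold>\<forall>x. x \<^bold>\<in> X \<^bold>\<longrightarrow> (\<^bold>\<exists>A. A \<^bold>\<in> \<A> \<^bold>\<and> x \<^bold>\<in> A)) \<^bold>\<and>
           (\<^bold>\<forall>A. A \<^bold>\<in> \<A> \<^bold>\<longrightarrow>
              (\<^bold>\<forall>x. \<^bold>\<forall>y. \<^bold>\<forall>u. \<^bold>\<forall>v. \<^bold>\<forall>d. x \<^bold>\<in> A \<^bold>\<and> y \<^bold>\<in> A \<^bold>\<and> frel f x u \<^bold>\<and> frel f y v \<^bold>\<and>
                 fabsdiff \<R> u v d \<^bold>\<longrightarrow> fle \<R> d \<epsilon>)))))"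

definition fzero_set :: "nat \<Rightarrow> nat \<Rightarrow> real_vars \<Rightarrow> nat \<Rightarrow> lfm" where
  "fzero_set X T \<R> Z = (\<^bold>\<exists>f. fC X T \<R> f \<^bold>\<and>
     (\<^bold>\<forall>x. x \<^bold>\<in> Z \<^bold>\<longleftrightarrow> x \<^bold>\<in> X \<^bold>\<and> (\<^bold>\<exists>c. fzero \<R> c \<^bold>\<and> frel f x c)))"

definition fcompletely_regular :: "nat \<Rightarrow> nat \<Rightarrow> real_vars \<Rightarrow> lfm" where
  "fcompletely_regular X T \<R> = fbase T (\<lambda>B. \<^bold>\<exists>Z. fzero_set X T \<R> Z \<^bold>\<and> fcompl X B Z)"

text \<open>equality of the sets of all \<open>f\<close> satisfying \<open>\<F>\<close> and \<open>\<G>\<close>\<close>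
definition fsame :: "(nat \<Rightarrow> lfm) \<Rightarrow> (nat \<Rightarrow> lfm) \<Rightarrow> lfm" where
  "fsame \<F> \<G> = (\<^bold>\<forall>f. \<F> f \<^bold>\<longleftrightarrow> \<G> f)"

end

theory Submission
  imports Defs "HOL-Library.Countable_Set"
begin

text \<open>
  By completeness of the calculus it suffices that the sentence holds in every countable model of
  \<open>ZF\<close>. In a model one can argue as usual, with separation for definable predicates as the only
  source of sets.

  Let \<open>x\<close> lie in the intersection \<open>G\<close> of countably many open sets \<open>A\<close> of a zero-dimensional space.
  \<open>CMC\<close> yields for every \<open>A\<close> a non-empty finite set of clopen neighbourhoods of \<open>x\<close> inside \<open>A\<close>;
  their intersections form a countable family of clopen sets whose intersection lies between \<open>x\<close>
  and \<open>G\<close>. So the space is a \<open>P\<close>-space once its \<open>CO\<^sub>\<delta>\<close>-sets are open. Such a set is a zero-set: map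
  every point that leaves the sequence of clopen sets for the first time at stage \<open>n\<close> to \<open>h n\<close>, where
  \<open>h\<close> decreases to 0, and all other points to 0. Conversely, in a \<open>P\<close>-space the fibres of continuous
  real-valued functions are open, being \<open>G\<^sub>\<delta>\<close>-sets.
\<close>

text \<open>The obstacle is that HOL objects are not sets of the model. A set exists there only if a
  formula with parameters cuts it out, so a HOL function or predicate becomes a set only after a
  proof that it is definable; the \<open>D\<close> and \<open>T\<close> facts give these proofs.
  HOL's own choice may be used to reason about the model, as it adds no sets to it. Inside the model
  \<open>CMC\<close> is the only source of choice and is used once. Finite sets of neighbourhoods
  serve as well as single ones because clopen sets are closed under finite intersections.
  \<open>CMC\<close> covers infinite families only, so finite ones are treated directly. Elsewhere
  canonical objects replace choice: all open subsets instead of a chosen one, the least index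
  instead of some index. All four clauses obtain the P-space property from the same implication. In
  (i) and (iii) open zero-sets turn the given base into a clopen one. In (iv) a function continuous
  into the discrete reals lies in U because all its preimages are clopen, and the intervals of
  length eps at the multiples of eps give the countable cover.\<close>

instance fm :: countable by countable_datatype

section \<open>Satisfaction, renaming and free indices of formulas\<close>

primrec sat :: "('a \<Rightarrow> 'a \<Rightarrow> bool) \<Rightarrow> ('a \<Rightarrow> 'a \<Rightarrow> bool) \<Rightarrow> (nat \<Rightarrow> 'a) \<Rightarrow> fm \<Rightarrow> bool" where
  "sat E Q e (Mem i j) \<longleftrightarrow> E (e i) (e j)"
| "sat E Q e (Eq i j) \<longleftrightarrow> Q (e i) (e j)"
| "sat E Q e Bot \<longleftrightarrow> False"
| "sat E Q e (Imp p q) \<longleftrightarrow> (sat E Q e p \<longrightarrow> sat E Q e q)"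
| "sat E Q e (All p) \<longleftrightarrow> (\<forall>a. sat E Q (case_nat a e) p)"

abbreviation lift :: "(nat \<Rightarrow> nat) \<Rightarrow> nat \<Rightarrow> nat" where
  "lift r \<equiv> case_nat 0 (\<lambda>j. Suc (r j))"

lemma case_nat_lift: "(\<lambda>i. case_nat a e (lift r i)) = case_nat a (\<lambda>i. e (r i))"
  by (auto simp: fun_eq_iff split: nat.split)

lemma sat_ren: "sat E Q e (ren r p) = sat E Q (\<lambda>i. e (r i)) p"
  by (induction p arbitrary: e r) (auto simp: case_nat_lift)

lemma ren_ren: "ren r (ren s p) = ren (\<lambda>i. r (s i)) p"
proof (induction p arbitrary: r s)
  case (All p)
  have "(\<lambda>i. lift r (lift s i)) = lift (\<lambda>i. r (s i))"
    by (auto simp: fun_eq_iff split: nat.split)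
  then show ?case by (simp add: All)
qed auto

lemma ren_cong: "bounded k p \<Longrightarrow> (\<And>i. i < k \<Longrightarrow> r i = s i) \<Longrightarrow> ren r p = ren s p"
proof (induction p arbitrary: k r s)
  case (All p)
  have "lift r i = lift s i" if "i < Suc k" for i
    using All.prems(2) that by (cases i) auto
  moreover have "bounded (Suc k) p" using All.prems(1) by simp
  ultimately have "ren (lift r) p = ren (lift s) p" by (rule All.IH[rotated])
  then show ?case by simp
next
  case (Imp p q)
  then show ?case by (metis bounded.simps(4) ren.simps(4))
qed auto

lemma sat_cong:
  "bounded k p \<Longrightarrow> (\<And>i. i < k \<Longrightarrow> e i = e' i) \<Longrightarrow> sat E Q e p = sat E Q e' p"
proof (induction p arbitrary: k e e')
  case (All p)
  have "sat E Q (case_nat a e) p = sat E Q (case_nat a e') p" for a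
    using All.prems by (intro All.IH[of "Suc k"]) (auto split: nat.split)
  then show ?case by simp
next
  case (Imp p q)
  then show ?case by (metis bounded.simps(4) sat.simps(4))
qed auto

lemma ren_id: "ren (\<lambda>i. i) p = p"
proof (induction p)
  case (All p)
  have "lift (\<lambda>i. i) = (\<lambda>i. i)" by (auto simp: fun_eq_iff split: nat.split)
  with All show ?case by simp
qed auto

lemma ren_sentence: "bounded 0 p \<Longrightarrow> ren r p = p"
  using ren_cong[of 0 p r "\<lambda>i. i"] by (simp add: ren_id)

lemma bounded_mono: "bounded k p \<Longrightarrow> k \<le> l \<Longrightarrow> bounded l p"
  by (induction p arbitrary: k l) auto

lemma ex_bounded: "\<exists>k. bounded k p"
proof (induction p)
  case (Imp p q)
  then obtain k l where "bounded k p" "bounded l q" by blast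
  then have "bounded (max k l) (Imp p q)" by (auto elim: bounded_mono)
  then show ?case ..
next
  case (All p)
  then obtain k where "bounded k p" by blast
  then have "bounded k (All p)" by (auto elim: bounded_mono)
  then show ?case ..
next
  case (Mem i j)
  show ?case by (rule exI[of _ "Suc (max i j)"]) auto
next
  case (Eq i j)
  show ?case by (rule exI[of _ "Suc (max i j)"]) auto
qed simp

lemma ex_bounded_finite: "finite F \<Longrightarrow> \<exists>k. \<forall>p\<in>F. bounded k p"
proof (induction F rule: finite_induct)
  case (insert p F)
  then obtain k where k: "\<forall>p\<in>F. bounded k p" by blast
  obtain l where "bounded l p" using ex_bounded by blast
  with k have "\<forall>q\<in>insert p F. bounded (max k l) q"
    by (metis bounded_mono insert_iff max.cobounded1 max.cobounded2)
  then show ?case ..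
qed simp

lemma bounded_ren: "bounded k p \<Longrightarrow> (\<And>i. i < k \<Longrightarrow> r i < l) \<Longrightarrow> bounded l (ren r p)"
proof (induction p arbitrary: k l r)
  case (All p)
  then have "bounded (Suc l) (ren (lift r) p)"
    by (intro All.IH[of "Suc k"]) (auto split: nat.split)
  then show ?case by simp
qed auto

subsection \<open>Completeness\<close>

lemma weaken: "\<Gamma> \<turnstile> p \<Longrightarrow> \<Gamma> \<subseteq> \<Delta> \<Longrightarrow> \<Delta> \<turnstile> p"
proof (induction arbitrary: \<Delta> rule: deriv.induct)
  case (Assm p \<Gamma>) then show ?case by (auto intro: deriv.Assm)
next
  case (ImpI p \<Gamma> q) then show ?case by (metis deriv.ImpI insert_mono)
next
  case (ImpE \<Gamma> p q) then show ?case by (metis deriv.ImpE)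
next
  case (RAA p \<Gamma>) then show ?case by (metis deriv.RAA insert_mono)
next
  case (AllI \<Gamma> p) then show ?case by (metis deriv.AllI image_mono)
next
  case (AllE \<Gamma> p t) then show ?case by (metis deriv.AllE)
next
  case (EqRefl \<Gamma> t) then show ?case by (metis deriv.EqRefl)
next
  case (EqSubst \<Gamma> s t p) then show ?case by (metis deriv.EqSubst)
qed

text \<open>Reduces consistency of the union of a chain of sets to consistency of its
  stages.\<close>

lemma finite_premises: "\<Gamma> \<turnstile> p \<Longrightarrow> \<exists>F. finite F \<and> F \<subseteq> \<Gamma> \<and> F \<turnstile> p"
proof (induction rule: deriv.induct)
  case (Assm p \<Gamma>)
  then show ?case by (intro exI[of _ "{p}"]) (auto intro: deriv.Assm)
next
  case (ImpI p \<Gamma> q)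
  then obtain F where F: "finite F" "F \<subseteq> insert p \<Gamma>" "F \<turnstile> q" by blast
  have "F - {p} \<turnstile> Imp p q" by (rule deriv.ImpI[OF weaken[OF F(3)]]) auto
  with F show ?case by (intro exI[of _ "F - {p}"]) auto
next
  case (ImpE \<Gamma> p q)
  then obtain F G where "finite F" "F \<subseteq> \<Gamma>" "F \<turnstile> Imp p q" "finite G" "G \<subseteq> \<Gamma>" "G \<turnstile> p" by blast
  moreover from this have "F \<union> G \<turnstile> q"
    by (metis deriv.ImpE weaken sup_ge1 sup_ge2)
  ultimately show ?case by (intro exI[of _ "F \<union> G"]) auto
next
  case (RAA p \<Gamma>)
  then obtain F where F: "finite F" "F \<subseteq> insert (Imp p Bot) \<Gamma>" "F \<turnstile> Bot" by blast
  have "F - {Imp p Bot} \<turnstile> p" by (rule deriv.RAA[OF weaken[OF F(3)]]) auto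
  with F show ?case by (intro exI[of _ "F - {Imp p Bot}"]) auto
next
  case (AllI \<Gamma> p)
  then obtain F where "finite F" "F \<subseteq> ren Suc ` \<Gamma>" "F \<turnstile> p" by blast
  then obtain G where "finite G" "G \<subseteq> \<Gamma>" "ren Suc ` G \<turnstile> p" by (metis finite_subset_image)
  then show ?case by (blast intro: deriv.AllI)
next
  case (EqSubst \<Gamma> s t p)
  then obtain F G where "finite F" "F \<subseteq> \<Gamma>" "F \<turnstile> Eq s t"
    "finite G" "G \<subseteq> \<Gamma>" "G \<turnstile> ren (case_nat s id) p" by blast
  moreover from this have "F \<union> G \<turnstile> ren (case_nat t id) p"
    by (metis deriv.EqSubst weaken sup_ge1 sup_ge2)
  ultimately show ?case by (intro exI[of _ "F \<union> G"]) auto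
qed (blast intro: deriv.intros)+

lemma ren_subst: "ren r (ren (case_nat t id) p) = ren (case_nat (r t) id) (ren (lift r) p)"
proof -
  have "(\<lambda>i. r (case_nat t id i)) = (\<lambda>i. case_nat (r t) id (lift r i))"
    by (auto simp: fun_eq_iff split: nat.split)
  then show ?thesis by (simp add: ren_ren)
qed

text \<open>Derivations survive arbitrary renamings, injective or not: under a quantifier the
  renaming is lifted, and lifting commutes with the shift of the hypotheses. This allows a change of
  eigenvariable.\<close>

lemma ren_deriv: "\<Gamma> \<turnstile> p \<Longrightarrow> ren r ` \<Gamma> \<turnstile> ren r p"
proof (induction arbitrary: r rule: deriv.induct)
  case (ImpI p \<Gamma> q)
  then show ?case using deriv.ImpI by (metis image_insert ren.simps(4))
next
  case (ImpE \<Gamma> p q)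
  then show ?case using deriv.ImpE by (metis ren.simps(4))
next
  case (RAA p \<Gamma>)
  then show ?case using deriv.RAA by (metis image_insert ren.simps(3,4))
next
  case (AllI \<Gamma> p)
  have "ren (lift r) ` ren Suc ` \<Gamma> = ren Suc ` ren r ` \<Gamma>"
    by (simp add: image_image ren_ren)
  with AllI.IH[of "lift r"] show ?case by (auto intro: deriv.AllI)
next
  case (AllE \<Gamma> p t)
  have "ren r ` \<Gamma> \<turnstile> All (ren (lift r) p)" using AllE.IH[of r] by simp
  from deriv.AllE[OF this] show ?case by (simp only: ren_subst)
next
  case (EqSubst \<Gamma> s t p)
  have "ren r ` \<Gamma> \<turnstile> Eq (r s) (r t)" using EqSubst.IH(1)[of r] by simp
  from deriv.EqSubst[OF this] EqSubst.IH(2)[of r] show ?case by (simp only: ren_subst)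
qed (auto intro: deriv.intros)

abbreviation consistent :: "fm set \<Rightarrow> bool" where
  "consistent \<Gamma> \<equiv> \<not> \<Gamma> \<turnstile> Bot"

text \<open>\<open>AllI\<close> generalizes index 0 over shifted hypotheses, while a Henkin witness
  is some large index \<open>t\<close>. The renaming \<open>r\<close> that sends \<open>t\<close> to
  0 and shifts all else bridges the two: on the hypotheses it is the shift, and on \<open>p\<close>
  it undoes the substitution of \<open>t\<close>.\<close>

lemma generalize_fresh:
  assumes "\<Gamma> \<turnstile> ren (case_nat t id) p"
    and fresh: "\<And>q. q \<in> insert (All p) \<Gamma> \<Longrightarrow> bounded t q"
  shows "\<Gamma> \<turnstile> All p"
proof -
  define r where "r = (\<lambda>i. if i = t then 0 else Suc i)"
  have "ren r q = ren Suc q" if "q \<in> \<Gamma>" for q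
    using fresh[of q] that by (intro ren_cong[of t]) (auto simp: r_def)
  then have \<Gamma>: "ren r ` \<Gamma> = ren Suc ` \<Gamma>" by (auto simp: image_iff)
  have "bounded (Suc t) p" using fresh[of "All p"] by simp
  then have "ren (\<lambda>i. r (case_nat t id i)) p = ren (\<lambda>i. i) p"
    by (rule ren_cong) (auto simp: r_def split: nat.split)
  then have p: "ren r (ren (case_nat t id) p) = p" by (simp add: ren_ren ren_id)
  show ?thesis using ren_deriv[OF assms(1), of r] unfolding \<Gamma> p by (rule deriv.AllI)
qed

text \<open>One stage of the Henkin construction. Only finitely many formulas \<open>F\<close> have
  been added to the sentences in \<open>\<Gamma>\<close>, so a fresh variable is always left to
  witness a negated universal formula.\<close>

lemma henkin_step:
  assumes \<Gamma>: "\<And>s. s \<in> \<Gamma> \<Longrightarrow> bounded 0 s" and "finite F" and con: "consistent (\<Gamma> \<union> F)"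
  shows "\<exists>G. finite G \<and> consistent (\<Gamma> \<union> G) \<and> F \<subseteq> G \<and>
    (consistent (insert p (\<Gamma> \<union> F)) \<longrightarrow> p \<in> G \<and>
      (\<forall>q. p = Imp (All q) Bot \<longrightarrow> (\<exists>t. Imp (ren (case_nat t id) q) Bot \<in> G)))"
proof (cases "consistent (insert p (\<Gamma> \<union> F))")
  case False
  with assms(2,3) show ?thesis by (intro exI[of _ F]) simp
next
  case con': True
  show ?thesis
  proof (cases "\<exists>q. p = Imp (All q) Bot")
    case False
    with \<open>finite F\<close> con' show ?thesis by (intro exI[of _ "insert p F"]) auto
  next
    case True
    then obtain q where p: "p = Imp (All q) Bot" by blast
    obtain t where t: "\<forall>s\<in>insert p F. bounded t s"
      using ex_bounded_finite[of "insert p F"] \<open>finite F\<close> by blast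
    let ?w = "Imp (ren (case_nat t id) q) Bot"
    have "consistent (\<Gamma> \<union> insert ?w (insert p F))"
    proof
      assume "\<Gamma> \<union> insert ?w (insert p F) \<turnstile> Bot"
      then have "insert ?w (\<Gamma> \<union> insert p F) \<turnstile> Bot" by (rule weaken) auto
      then have "\<Gamma> \<union> insert p F \<turnstile> ren (case_nat t id) q" by (rule deriv.RAA)
      then have "\<Gamma> \<union> insert p F \<turnstile> All q"
        using t bounded_mono[OF \<Gamma>] by (intro generalize_fresh) (auto simp: p)
      moreover have "\<Gamma> \<union> insert p F \<turnstile> Imp (All q) Bot" by (rule deriv.Assm) (simp add: p)
      ultimately have "\<Gamma> \<union> insert p F \<turnstile> Bot" by (rule deriv.ImpE[rotated])
      with con' show False by simp
    qed
    with \<open>finite F\<close> p show ?thesis by (intro exI[of _ "insert ?w (insert p F)"]) auto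
  qed
qed

text \<open>Formulas are countable, so stage \<open>n\<close> can treat the formula with code
  \<open>n\<close>. A witness is added together with its formula, which makes the union both maximal
  consistent and Henkin.\<close>

lemma henkin_extension:
  assumes \<Gamma>: "\<And>s. s \<in> \<Gamma> \<Longrightarrow> bounded 0 s" and con: "consistent \<Gamma>"
  obtains H where "\<Gamma> \<subseteq> H" "consistent H" "\<And>p. H \<turnstile> p \<Longrightarrow> p \<in> H"
    "\<And>p. p \<notin> H \<Longrightarrow> Imp p Bot \<in> H"
    "\<And>q. Imp (All q) Bot \<in> H \<Longrightarrow> \<exists>t. Imp (ren (case_nat t id) q) Bot \<in> H"
proof -
  define P where "P F \<longleftrightarrow> finite F \<and> consistent (\<Gamma> \<union> F)" for F
  define R where "R n F G \<longleftrightarrow> F \<subseteq> G \<and> (let p = from_nat n in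
    (consistent (insert p (\<Gamma> \<union> F)) \<longrightarrow> p \<in> G \<and>
      (\<forall>q. p = Imp (All q) Bot \<longrightarrow> (\<exists>t. Imp (ren (case_nat t id) q) Bot \<in> G))))"
    for n :: nat and F G
  have "\<exists>F. \<forall>n. P (F n) \<and> R n (F n) (F (Suc n))"
  proof (rule dependent_nat_choice)
    show "\<exists>F. P F" using con by (intro exI[of _ "{}"]) (simp add: P_def)
    show "\<exists>G. P G \<and> R n F G" if "P F" for F n
      using henkin_step[OF \<Gamma>, where F = F and p = "from_nat n"] that by (auto simp: P_def R_def Let_def)
  qed
  then obtain F where P: "\<And>n. P (F n)" and R: "\<And>n. R n (F n) (F (Suc n))" by blast
  define H where "H = \<Gamma> \<union> (\<Union>n. F n)"
  have "F n \<subseteq> F (Suc n)" for n using R[of n] by (simp add: R_def)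
  then have mono: "F m \<subseteq> F n" if "m \<le> n" for m n
    using that by (rule lift_Suc_mono_le)
  have conH: "consistent H"
  proof
    assume "H \<turnstile> Bot"
    then obtain G where G: "finite G" "G \<subseteq> H" "G \<turnstile> Bot" using finite_premises by blast
    have "\<exists>n. G \<subseteq> \<Gamma> \<union> F n" using G(1,2)
    proof (induction G rule: finite_induct)
      case (insert x G)
      then obtain n where n: "G \<subseteq> \<Gamma> \<union> F n" by auto
      from insert obtain m where "x \<in> \<Gamma> \<union> F m" by (auto simp: H_def)
      with n mono[of n "max n m"] mono[of m "max n m"]
      have "insert x G \<subseteq> \<Gamma> \<union> F (max n m)" by auto
      then show ?case ..
    qed simp
    then obtain n where "G \<subseteq> \<Gamma> \<union> F n" ..
    with G(3) have "\<Gamma> \<union> F n \<turnstile> Bot" by (rule weaken)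
    with P[of n] show False by (simp add: P_def)
  qed
  \<comment> \<open>Stage \<open>to_nat p\<close> decides about \<open>p\<close>; whatever is
    consistent with all of \<open>H\<close> is consistent with that stage.\<close>
  have stage: "p \<in> H \<and> (\<forall>q. p = Imp (All q) Bot \<longrightarrow> (\<exists>t. Imp (ren (case_nat t id) q) Bot \<in> H))"
    if "consistent (insert p (\<Gamma> \<union> F (to_nat p)))" for p
    using R[of "to_nat p"] that unfolding R_def Let_def H_def from_nat_to_nat by blast
  have sub: "insert p (\<Gamma> \<union> F n) \<subseteq> insert p H" for p n by (auto simp: H_def)
  show thesis
  proof (rule that)
    show "\<Gamma> \<subseteq> H" by (auto simp: H_def)
    show "consistent H" by (rule conH)
    show "p \<in> H" if "H \<turnstile> p" for p
    proof (rule ccontr)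
      assume "p \<notin> H"
      with stage have "insert p (\<Gamma> \<union> F (to_nat p)) \<turnstile> Bot" by blast
      then have "insert p H \<turnstile> Bot" using sub by (rule weaken)
      then have "H \<turnstile> Imp p Bot" by (rule deriv.ImpI)
      with that conH show False by (metis deriv.ImpE)
    qed
    then show "Imp p Bot \<in> H" if "p \<notin> H" for p
      using stage[of p] that weaken[OF _ sub] deriv.ImpI by blast
    show "\<exists>t. Imp (ren (case_nat t id) q) Bot \<in> H" if "Imp (All q) Bot \<in> H" for q
    proof -
      have "consistent (insert (Imp (All q) Bot) (\<Gamma> \<union> F n))" for n
        using conH weaken[OF _ sub] that by (metis insert_absorb)
      then show ?thesis using stage by blast
    qed
  qed
qed

text \<open>Moves from a structure in which equality is only a congruence to one in which it is
  identity.\<close>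

lemma sat_quotient:
  assumes "surj c" "\<And>a b. E a b = E' (c a) (c b)" "\<And>a b. Q a b = (c a = c b)"
  shows "sat E Q e p = sat E' (=) (\<lambda>i. c (e i)) p"
proof (induction p arbitrary: e)
  case (All p)
  have *: "(\<lambda>i. c (case_nat a e i)) = case_nat (c a) (\<lambda>i. c (e i))" for a
    by (auto simp: fun_eq_iff split: nat.split)
  show ?case unfolding sat.simps All * by (metis \<open>surj c\<close> surj_def)
qed (auto simp: assms)

text \<open>
  The domain of the countable model is the type \<open>nat\<close> rather than a set, so the quotient of the
  term model by provable equality has to be infinite; this is what \<open>inf\<close> asks for.
\<close>

theorem completeness:
  assumes \<Gamma>: "\<And>s. s \<in> \<Gamma> \<Longrightarrow> bounded 0 s" and p: "bounded 0 p"
    and inf: "\<And>E Q :: nat \<Rightarrow> nat \<Rightarrow> bool. equivp Q \<Longrightarrow>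
      (\<And>a b c d. Q a b \<Longrightarrow> Q c d \<Longrightarrow> E a c \<Longrightarrow> E b d) \<Longrightarrow>
      (\<And>s e. s \<in> \<Gamma> \<Longrightarrow> sat E Q e s) \<Longrightarrow> infinite (range Q)"
    and valid: "\<And>(E :: nat \<Rightarrow> nat \<Rightarrow> bool) e. (\<And>s e. s \<in> \<Gamma> \<Longrightarrow> sat E (=) e s) \<Longrightarrow> sat E (=) e p"
  shows "\<Gamma> \<turnstile> p"
proof (rule ccontr)
  assume np: "\<not> \<Gamma> \<turnstile> p"
  then have "consistent (insert (Imp p Bot) \<Gamma>)" by (metis deriv.RAA)
  moreover have "bounded 0 s" if "s \<in> insert (Imp p Bot) \<Gamma>" for s using \<Gamma> p that by auto
  ultimately obtain H where H: "insert (Imp p Bot) \<Gamma> \<subseteq> H" "consistent H"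
    and closed: "\<And>p. H \<turnstile> p \<Longrightarrow> p \<in> H" and compl: "\<And>p. p \<notin> H \<Longrightarrow> Imp p Bot \<in> H"
    and wit: "\<And>q. Imp (All q) Bot \<in> H \<Longrightarrow> \<exists>t. Imp (ren (case_nat t id) q) Bot \<in> H"
    using henkin_extension[of "insert (Imp p Bot) \<Gamma>"] by blast
  have Bot: "Bot \<notin> H" using H(2) deriv.Assm by blast
  have mp: "q \<in> H" if "Imp p q \<in> H" "p \<in> H" for p q
    using that by (metis closed deriv.ImpE deriv.Assm)
  have Imp: "Imp p q \<in> H \<longleftrightarrow> (p \<in> H \<longrightarrow> q \<in> H)" for p q
  proof
    assume *: "p \<in> H \<longrightarrow> q \<in> H"
    have "insert p H \<turnstile> q"
    proof (cases "p \<in> H")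
      case True with * show ?thesis by (auto intro: deriv.Assm)
    next
      case False
      then have "insert p H \<turnstile> Bot" using compl[of p] by (metis deriv.ImpE deriv.Assm insertI1 insertI2)
      then have "insert (Imp q Bot) (insert p H) \<turnstile> Bot" by (rule weaken) auto
      then show ?thesis by (rule deriv.RAA)
    qed
    then show "Imp p q \<in> H" by (rule closed[OF deriv.ImpI])
  qed (auto dest: mp)
  have All: "All p \<in> H \<longleftrightarrow> (\<forall>t. ren (case_nat t id) p \<in> H)" for p
    using wit[of p] compl[of "All p"] Bot Imp by (metis closed deriv.AllE deriv.Assm)
  define E where "E i j \<longleftrightarrow> Mem i j \<in> H" for i j
  define Q where "Q i j \<longleftrightarrow> Eq i j \<in> H" for i j
  \<comment> \<open>The elements of the term model are variables, so an assignment is itself a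
    renaming and truth under \<open>e\<close> is membership of the renamed formula.\<close>
  have truth: "sat E Q e q \<longleftrightarrow> ren e q \<in> H" for e q
  proof (induction q arbitrary: e)
    case (All q)
    have "ren (case_nat a id) (ren (lift e) q) = ren (case_nat a e) q" for a
      by (simp add: ren_ren case_nat_lift)
    with All show ?case by (simp add: \<open>\<And>p. All p \<in> H \<longleftrightarrow> _ p\<close>)
  qed (auto simp: E_def Q_def Imp Bot)
  have refl: "Q i i" for i unfolding Q_def by (intro closed deriv.EqRefl)
  have subst: "ren (case_nat t id) q \<in> H" if "Q s t" "ren (case_nat s id) q \<in> H" for s t q
    using that unfolding Q_def by (metis closed deriv.EqSubst deriv.Assm)
  \<comment> \<open>In the templates given to \<open>subst\<close>, index 0 marks the place of
    substitution, so a fixed variable \<open>s\<close> is written \<open>Suc s\<close>.\<close>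
  have sym: "Q t s" if "Q s t" for s t
    using subst[OF that, of "Eq 0 (Suc s)"] refl by (simp add: Q_def)
  have trans: "Q s u" if "Q s t" "Q t u" for s t u
    using subst[OF that(2), of "Eq (Suc s) 0"] that by (simp add: Q_def)
  have equiv: "equivp Q" by (intro equivpI reflpI sympI transpI) (auto intro: refl sym trans)
  have cong: "E b d" if "Q a b" "Q c d" "E a c" for a b c d
    using subst[OF that(1), of "Mem 0 (Suc c)"] subst[OF that(2), of "Mem (Suc b) 0"] that(3)
    by (simp add: E_def)
  have model: "sat E Q e s" if "s \<in> H" "bounded 0 s" for s e
    using that by (simp add: truth ren_sentence)
  define c where "c i = to_nat_on (range Q) (Q i)" for i
  have infQ: "infinite (range Q)"
  proof (rule inf[of Q E])
    show "sat E Q e s" if "s \<in> \<Gamma>" for s e using that H(1) model \<Gamma> by blast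
  qed (use equiv cong in blast)+
  have bij: "bij_betw (to_nat_on (range Q)) (range Q) UNIV"
    using infQ by (intro to_nat_on_infinite) auto
  have "surj c"
    using bij_betw_imp_surj_on[OF bij] by (simp add: c_def[abs_def] image_image)
  have c: "Q i j = (c i = c j)" for i j
  proof -
    have "Q i j = (Q i = Q j)" using equiv by (simp add: equivp_def)
    also have "\<dots> = (c i = c j)"
      using inj_on_eq_iff[OF bij_betw_imp_inj_on[OF bij]] by (simp add: c_def)
    finally show ?thesis .
  qed
  define E' where "E' a b = E (inv c a) (inv c b)" for a b
  have inv: "Q i (inv c (c i))" for i using \<open>surj c\<close> by (simp add: c surj_f_inv_f)
  have E': "E a b = E' (c a) (c b)" for a b
    unfolding E'_def using cong[OF inv inv] cong[OF sym[OF inv] sym[OF inv]] by blast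
  have sat: "sat E' (=) e q = sat E Q (\<lambda>i. inv c (e i)) q" for e q
    using sat_quotient[where c = c and E = E and Q = Q, OF \<open>surj c\<close> E' c,
        of "\<lambda>i. inv c (e i)" q] \<open>surj c\<close>
    by (simp add: surj_f_inv_f)
  have "sat E' (=) e s" if "s \<in> \<Gamma>" for s e
    using H(1) that \<Gamma> model by (auto simp: sat)
  then have "sat E' (=) (\<lambda>_. 0) p" by (rule valid)
  moreover have "sat E Q (\<lambda>i. inv c 0) (Imp p Bot)"
    using H(1) p by (intro model) auto
  ultimately show False by (simp add: sat)
qed

subsection \<open>Definability in a structure\<close>

text \<open>Reads an assignment by levels instead of indices. Entering a quantifier leaves the
  values at the old levels unchanged, so formulas written with levels can be evaluated by
  rewriting.\<close>

definition lv :: "(nat \<Rightarrow> 'a) \<Rightarrow> nat \<Rightarrow> nat \<Rightarrow> 'a" where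
  "lv e n x = e (n - Suc x)"

lemma lv_Suc [simp]: "lv (case_nat a e) (Suc n) n = a"
  by (simp add: lv_def)

lemma lv_less [simp]: "x < n \<Longrightarrow> lv (case_nat a e) (Suc n) x = lv e n x"
  by (simp add: lv_def flip: Suc_diff_Suc)

lemma sat_connectives [simp]:
  "sat E Q e ((x \<^bold>\<in> y) n) \<longleftrightarrow> E (lv e n x) (lv e n y)"
  "sat E Q e ((x \<^bold>= y) n) \<longleftrightarrow> Q (lv e n x) (lv e n y)"
  "sat E Q e ((p \<^bold>\<longrightarrow> q) n) \<longleftrightarrow> (sat E Q e (p n) \<longrightarrow> sat E Q e (q n))"
  "sat E Q e ((\<^bold>\<not> p) n) \<longleftrightarrow> \<not> sat E Q e (p n)"
  "sat E Q e ((p \<^bold>\<and> q) n) \<longleftrightarrow> sat E Q e (p n) \<and> sat E Q e (q n)"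
  "sat E Q e ((p \<^bold>\<or> q) n) \<longleftrightarrow> sat E Q e (p n) \<or> sat E Q e (q n)"
  "sat E Q e ((p \<^bold>\<longleftrightarrow> q) n) \<longleftrightarrow> (sat E Q e (p n) \<longleftrightarrow> sat E Q e (q n))"
  "sat E Q e ((\<^bold>\<forall>x. F x) n) \<longleftrightarrow> (\<forall>a. sat E Q (case_nat a e) (F n (Suc n)))"
  "sat E Q e ((\<^bold>\<exists>x. F x) n) \<longleftrightarrow> (\<exists>a. sat E Q (case_nat a e) (F n (Suc n)))"
  by (auto simp: mem_def eql_def imp_def neg_def dis_def con_def iff_def all_def exi_def lv_def)

lemma sat_inst:
  "sat E Q e (inst p xs n) \<longleftrightarrow>
    sat E Q (\<lambda>i. lv e n (if i < length xs then xs ! i else i - length xs)) p"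
  by (simp add: inst_def sat_ren lv_def)

lemma sat_All_funpow:
  assumes "\<And>e. sat E Q e ((All ^^ k) p)"
  shows "sat E Q e p"
  using assms
proof (induction k arbitrary: p e)
  case (Suc k)
  have "sat E Q e ((All ^^ k) (All p))" for e
    using Suc.prems[of e] by (simp add: funpow_swap1)
  then have "sat E Q e (All p)" for e by (rule Suc.IH)
  then have "sat E Q (case_nat (e 0) (\<lambda>i. e (Suc i))) p" by (metis sat.simps(5))
  moreover have "case_nat (e 0) (\<lambda>i. e (Suc i)) = e" by (auto simp: fun_eq_iff split: nat.split)
  ultimately show ?case by simp
qed simp

section \<open>Definable predicates and definable terms\<close>

locale membership =
  fixes E :: "'a \<Rightarrow> 'a \<Rightarrow> bool" (infix \<open>\<epsilon>\<close> 50)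
begin

text \<open>\<open>D P\<close>: the predicate \<open>P\<close> of finitely many elements (the relevant entries of an assignment) is
  first-order definable, where a variable stands for an entry or for a parameter. Likewise
  \<open>T t\<close> says that the graph of \<open>t\<close> is definable.\<close>

definition D :: "((nat \<Rightarrow> 'a) \<Rightarrow> bool) \<Rightarrow> bool" where
  "D P \<longleftrightarrow> (\<exists>p a. \<forall>e. P e = sat E (=) (\<lambda>i. case_sum e id (a i)) p)"

definition T :: "((nat \<Rightarrow> 'a) \<Rightarrow> 'a) \<Rightarrow> bool" where
  "T t \<longleftrightarrow> D (\<lambda>e. e 0 = t (\<lambda>i. e (Suc i)))"

lemma D_const: "D (\<lambda>e. b)"
  unfolding D_def by (rule exI[of _ "if b then Imp Bot Bot else Bot"]) simp

lemma D_imp: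
  assumes "D P" "D Q" shows "D (\<lambda>e. P e \<longrightarrow> Q e)"
proof -
  obtain p a q b where pq: "\<And>e. P e = sat E (=) (\<lambda>i. case_sum e id (a i)) p"
    "\<And>e. Q e = sat E (=) (\<lambda>i. case_sum e id (b i)) q"
    using assms unfolding D_def by blast
  \<comment> \<open>The two lists of parameters are interleaved: \<open>p\<close> reads the even
    variables and \<open>q\<close> the odd ones.\<close>
  define c where "c i = (if even i then a (i div 2) else b (i div 2))" for i
  have "(P e \<longrightarrow> Q e) = sat E (=) (\<lambda>i. case_sum e id (c i))
      (Imp (ren (\<lambda>i. 2 * i) p) (ren (\<lambda>i. 2 * i + 1) q))" for e
    unfolding pq by (simp add: sat_ren c_def)
  then show ?thesis unfolding D_def by blast
qed

lemma D_not: "D P \<Longrightarrow> D (\<lambda>e. \<not> P e)"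
  using D_imp[OF _ D_const[of False]] by simp

lemma D_conj: "D P \<Longrightarrow> D Q \<Longrightarrow> D (\<lambda>e. P e \<and> Q e)"
  using D_not[OF D_imp[OF _ D_not[of Q]], of P] by simp

lemma D_disj: "D P \<Longrightarrow> D Q \<Longrightarrow> D (\<lambda>e. P e \<or> Q e)"
  using D_imp[OF D_not[of P], of Q] by (simp add: disj_imp)

lemma D_iff: "D P \<Longrightarrow> D Q \<Longrightarrow> D (\<lambda>e. P e \<longleftrightarrow> Q e)"
  using D_conj[OF D_imp[of P Q] D_imp[of Q P]] by (simp add: iff_conv_conj_imp)

lemma D_all:
  assumes "D (\<lambda>e. P (\<lambda>i. e (Suc i)) (e 0))" shows "D (\<lambda>e. \<forall>y. P e y)"
proof -
  obtain p a where p: "\<And>e. P (\<lambda>i. e (Suc i)) (e 0) = sat E (=) (\<lambda>i. case_sum e id (a i)) p"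
    using assms unfolding D_def by blast
  \<comment> \<open>Several variables of \<open>p\<close> may stand for entry 0. \<open>r\<close>
    redirects all of them to the bound variable; for the others \<open>b\<close> records the entry,
    lowered by one, or the parameter.\<close>
  define b where "b i = (case a i of Inl 0 \<Rightarrow> Inl 0 | Inl (Suc j) \<Rightarrow> Inl j | Inr c \<Rightarrow> Inr c)" for i
  define r where "r i = (if a i = Inl 0 then 0 else Suc i)" for i
  have *: "case_nat y (\<lambda>i. case_sum e id (b i)) (r i) = case_sum (case_nat y e) id (a i)" for y e i
    by (auto simp: b_def r_def split: sum.split nat.split)
  have "(\<forall>y. P e y) = sat E (=) (\<lambda>i. case_sum e id (b i)) (All (ren r p))" for e
    using p[of "case_nat _ e"] by (simp add: sat_ren *)
  then show ?thesis unfolding D_def by blast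
qed

lemma D_ex: "D (\<lambda>e. P (\<lambda>i. e (Suc i)) (e 0)) \<Longrightarrow> D (\<lambda>e. \<exists>y. P e y)"
  using D_not[OF D_all[of "\<lambda>e y. \<not> P e y"]] D_not by simp

lemma D_reindex:
  assumes "D P" shows "D (\<lambda>e. P (\<lambda>i. e (r i)))"
proof -
  obtain p a where p: "\<And>e. P e = sat E (=) (\<lambda>i. case_sum e id (a i)) p"
    using assms unfolding D_def by blast
  have *: "case_sum (\<lambda>i. e (r i)) id (a i) = case_sum e id (map_sum r id (a i))" for e :: "nat \<Rightarrow> 'a" and i
    by (auto split: sum.split)
  have "\<forall>e. P (\<lambda>i. e (r i)) = sat E (=) (\<lambda>i. case_sum e id (map_sum r id (a i))) p"
    unfolding p * by simp
  then show ?thesis unfolding D_def by (intro exI)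
qed

lemma T_reindex:
  assumes "T t" shows "T (\<lambda>e. t (\<lambda>i. e (r i)))"
  using D_reindex[OF assms[unfolded T_def], of "case_nat 0 (\<lambda>i. Suc (r i))"] by (simp add: T_def)

lemma D_atom: "D (\<lambda>e. e i \<epsilon> e j)" "D (\<lambda>e. e i = e j)" "D (\<lambda>e. e i = c)"
proof -
  have "(e i \<epsilon> e j) = sat E (=) (\<lambda>i. case_sum e id (Inl i)) (Mem i j)"
    "(e i = e j) = sat E (=) (\<lambda>i. case_sum e id (Inl i)) (Eq i j)" for e
    by auto
  then show "D (\<lambda>e. e i \<epsilon> e j)" "D (\<lambda>e. e i = e j)" unfolding D_def by blast+
  have "(e i = c) = sat E (=) (\<lambda>k. case_sum e id (case_nat (Inl i) (\<lambda>_. Inr c) k)) (Eq 0 1)" for e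
    by auto
  then show "D (\<lambda>e. e i = c)" unfolding D_def by blast
qed

lemma T_const: "T (\<lambda>e. c)"
  unfolding T_def by (rule D_atom)

lemma T_var: "T (\<lambda>e. e i)"
  unfolding T_def by (rule D_atom)

lemma D_subst:
  assumes "D (\<lambda>e. P (\<lambda>i. e (Suc i)) (e 0))" "T t"
  shows "D (\<lambda>e. P e (t e))"
proof -
  have "D (\<lambda>e. \<exists>y. y = t e \<and> P e y)"
    using assms unfolding T_def by (intro D_ex D_conj)
  then show ?thesis by simp
qed

lemma D_subst1: "D (\<lambda>e. P (e 0)) \<Longrightarrow> T t \<Longrightarrow> D (\<lambda>e. P (t e))"
  by (rule D_subst[of "\<lambda>_. P"])

lemma D_subst2:
  assumes "D (\<lambda>e. P (e 0) (e 1))" "T s" "T t"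
  shows "D (\<lambda>e. P (s e) (t e))"
proof (rule D_subst[OF _ assms(3)])
  show "D (\<lambda>e. P (s (\<lambda>i. e (Suc i))) (e 0))"
  proof (rule D_subst[of "\<lambda>e y. P y (e 0)"])
    show "D (\<lambda>e. P (e 0) (e (Suc 0)))" using assms(1) by simp
  qed (rule T_reindex[OF assms(2)])
qed

lemma D_subst3:
  assumes "D (\<lambda>e. P (e 0) (e 1) (e 2))" "T s" "T t" "T u"
  shows "D (\<lambda>e. P (s e) (t e) (u e))"
proof (rule D_subst[OF _ assms(4)])
  show "D (\<lambda>e. P (s (\<lambda>i. e (Suc i))) (t (\<lambda>i. e (Suc i))) (e 0))"
  proof (rule D_subst[of "\<lambda>e y. P (s (\<lambda>i. e (Suc i))) y (e 0)"])
    show "D (\<lambda>e. P (s (\<lambda>i. e (Suc (Suc i)))) (e 0) (e (Suc 0)))"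
    proof (rule D_subst[of "\<lambda>e y. P y (e 0) (e (Suc 0))"])
      show "D (\<lambda>e. P (e 0) (e (Suc 0)) (e (Suc (Suc 0))))"
        using assms(1) by (simp add: numeral_2_eq_2)
    qed (rule T_reindex[OF assms(2)])
  qed (rule T_reindex[OF assms(3)])
qed

lemma T_subst1:
  assumes "D (\<lambda>e. e 0 = f (e 1))" "T s" shows "T (\<lambda>e. f (s e))"
  unfolding T_def
  by (rule D_subst2[of "\<lambda>x y. x = f y", OF assms(1) T_var T_reindex[OF assms(2)]])

lemma T_subst2:
  assumes "D (\<lambda>e. e 0 = f (e 1) (e 2))" "T s" "T t" shows "T (\<lambda>e. f (s e) (t e))"
  unfolding T_def
  by (rule D_subst3[of "\<lambda>x y z. x = f y z", OF assms(1) T_var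
      T_reindex[OF assms(2)] T_reindex[OF assms(3)]])

lemma T_comp1: "T (\<lambda>e. f (e 0)) \<Longrightarrow> T s \<Longrightarrow> T (\<lambda>e. f (s e))"
  by (rule T_subst1) (simp_all add: T_def)

lemma T_if:
  assumes "D P" "T s" "T t" shows "T (\<lambda>e. if P e then s e else t e)"
proof -
  have "D (\<lambda>e. P (\<lambda>i. e (Suc i)) \<and> e 0 = s (\<lambda>i. e (Suc i)) \<or>
      \<not> P (\<lambda>i. e (Suc i)) \<and> e 0 = t (\<lambda>i. e (Suc i)))"
    by (intro D_disj D_conj D_not D_reindex[OF assms(1)] assms(2,3)[unfolded T_def])
  moreover have "(\<lambda>e. P (\<lambda>i. e (Suc i)) \<and> e 0 = s (\<lambda>i. e (Suc i)) \<or>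
      \<not> P (\<lambda>i. e (Suc i)) \<and> e 0 = t (\<lambda>i. e (Suc i))) =
      (\<lambda>e. e 0 = (if P (\<lambda>i. e (Suc i)) then s (\<lambda>i. e (Suc i)) else t (\<lambda>i. e (Suc i))))"
    by auto
  ultimately show ?thesis by (simp add: T_def)
qed

lemma D_mem: "T s \<Longrightarrow> T t \<Longrightarrow> D (\<lambda>e. s e \<epsilon> t e)"
  using D_subst2[of "(\<epsilon>)"] D_atom(1) by blast

lemma D_eq: "T s \<Longrightarrow> T t \<Longrightarrow> D (\<lambda>e. s e = t e)"
  using D_subst2[of "(=)"] D_atom(2) by blast

text \<open>Unlike \<open>THE\<close>, this has a known value where there is no unique witness, and so preserves
  definability.\<close>

definition the1 :: "('a \<Rightarrow> bool) \<Rightarrow> 'a" where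
  "the1 P = (if \<exists>!y. P y then THE y. P y else undefined)"

lemma the1_equality: "P y \<Longrightarrow> (\<And>z. P z \<Longrightarrow> z = y) \<Longrightarrow> the1 P = y"
  unfolding the1_def by (metis the_equality)

lemma T_the1:
  assumes "D (\<lambda>e. P (\<lambda>i. e (Suc i)) (e 0))" shows "T (\<lambda>e. the1 (P e))"
proof -
  \<comment> \<open>Both cases are first-order in \<open>Q\<close>; the default value
    \<open>undefined\<close> enters as a parameter.\<close>
  have *: "(u = the1 Q) \<longleftrightarrow> (Q u \<and> (\<forall>v. Q v \<longrightarrow> v = u)) \<or>
      \<not> (\<exists>y. Q y \<and> (\<forall>v. Q v \<longrightarrow> v = y)) \<and> u = undefined" for u :: 'a and Q
  proof (cases "\<exists>!y. Q y")
    case True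
    then obtain y where y: "Q y" "\<And>z. Q z \<Longrightarrow> z = y" by blast
    then have "the1 Q = y" by (rule the1_equality)
    with y show ?thesis by blast
  next
    case False
    then show ?thesis unfolding the1_def by auto
  qed
  have 1: "D (\<lambda>e. P (\<lambda>i. e (r i)) (e k))" for r k
    using D_reindex[OF assms, of "case_nat k r"] by simp
  have "D (\<lambda>e. e 0 = the1 (P (\<lambda>i. e (Suc i))))"
    unfolding * by (intro D_disj D_conj D_not D_ex D_all D_imp 1 D_atom)
  then show ?thesis by (simp add: T_def)
qed

text \<open>Rules for \<open>intro\<close>: they reduce a definability goal along the syntax of the
  HOL expression.\<close>

lemmas dfn = D_const T_const T_var D_not D_imp D_conj D_disj D_iff D_all D_ex D_mem D_eq T_the1

section \<open>Set-theoretic constructions as definable terms\<close>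

definition Sep :: "'a \<Rightarrow> ('a \<Rightarrow> bool) \<Rightarrow> 'a" where
  "Sep a P = the1 (\<lambda>b. \<forall>x. x \<epsilon> b \<longleftrightarrow> x \<epsilon> a \<and> P x)"

lemma T_Sep:
  assumes "T a" "D (\<lambda>e. P (\<lambda>i. e (Suc i)) (e 0))"
  shows "T (\<lambda>e. Sep (a e) (P e))"
proof -
  have 1: "D (\<lambda>e. P (\<lambda>i. e (r i)) (e k))" for r k
    using D_reindex[OF assms(2), of "case_nat k r"] by simp
  show ?thesis
    unfolding Sep_def by (intro dfn 1 T_reindex[OF assms(1)])
qed

text \<open>As values of \<open>the1\<close> these are total in every structure. Their definability
  is thus independent of the axioms, which are used only to show that they have the intended
  elements.\<close>

definition emp :: 'a where "emp = the1 (\<lambda>e. \<forall>z. \<not> z \<epsilon> e)"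
definition up :: "'a \<Rightarrow> 'a \<Rightarrow> 'a" where "up x y = the1 (\<lambda>p. \<forall>z. z \<epsilon> p \<longleftrightarrow> z = x \<or> z = y)"
definition pr :: "'a \<Rightarrow> 'a \<Rightarrow> 'a" where "pr x y = up (up x x) (up x y)"
definition Uni :: "'a \<Rightarrow> 'a" where "Uni x = the1 (\<lambda>u. \<forall>z. z \<epsilon> u \<longleftrightarrow> (\<exists>y. y \<epsilon> x \<and> z \<epsilon> y))"
definition Pw :: "'a \<Rightarrow> 'a" where "Pw x = the1 (\<lambda>u. \<forall>z. z \<epsilon> u \<longleftrightarrow> (\<forall>y. y \<epsilon> z \<longrightarrow> y \<epsilon> x))"
definition sc :: "'a \<Rightarrow> 'a" where "sc x = Uni (up x (up x x))"
definition cross :: "'a \<Rightarrow> 'a \<Rightarrow> 'a" where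
  "cross A B = Sep (Pw (Pw (Uni (up A B)))) (\<lambda>p. \<exists>x y. x \<epsilon> A \<and> y \<epsilon> B \<and> p = pr x y)"
definition app :: "'a \<Rightarrow> 'a \<Rightarrow> 'a" where "app f x = the1 (\<lambda>y. pr x y \<epsilon> f)"
text \<open>Turns a HOL function into a function of the model. The result is the intended graph once
  \<open>g\<close> is definable and maps \<open>A\<close> into \<open>B\<close>.\<close>

definition Lam :: "'a \<Rightarrow> 'a \<Rightarrow> ('a \<Rightarrow> 'a) \<Rightarrow> 'a" where
  "Lam A B g = Sep (cross A B) (\<lambda>p. \<exists>x. p = pr x (g x))"

lemma T_up: "T s \<Longrightarrow> T t \<Longrightarrow> T (\<lambda>e. up (s e) (t e))"
  by (rule T_subst2) (unfold up_def, intro dfn)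
lemma T_pr: "T s \<Longrightarrow> T t \<Longrightarrow> T (\<lambda>e. pr (s e) (t e))"
  unfolding pr_def by (intro T_up)
lemma T_Uni: "T s \<Longrightarrow> T (\<lambda>e. Uni (s e))"
  by (rule T_subst1) (unfold Uni_def, intro dfn)
lemma T_Pw: "T s \<Longrightarrow> T (\<lambda>e. Pw (s e))"
  by (rule T_subst1) (unfold Pw_def, intro dfn)
lemma T_sc: "T s \<Longrightarrow> T (\<lambda>e. sc (s e))"
  unfolding sc_def by (intro T_up T_Uni)
lemma T_cross: "T s \<Longrightarrow> T t \<Longrightarrow> T (\<lambda>e. cross (s e) (t e))"
  by (rule T_subst2) (unfold cross_def, intro dfn T_Sep T_Pw T_up T_Uni T_pr)
lemma T_app: "T s \<Longrightarrow> T t \<Longrightarrow> T (\<lambda>e. app (s e) (t e))"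
  by (rule T_subst2) (unfold app_def, intro dfn T_pr)

lemmas dfns = dfn T_Sep T_up T_pr T_Uni T_Pw T_sc T_cross T_app

abbreviation sub :: "'a \<Rightarrow> 'a \<Rightarrow> bool" where
  "sub x y \<equiv> \<forall>z. z \<epsilon> x \<longrightarrow> z \<epsilon> y"

definition indv :: "'a \<Rightarrow> bool" where
  "indv w \<longleftrightarrow> emp \<epsilon> w \<and> (\<forall>x. x \<epsilon> w \<longrightarrow> sc x \<epsilon> w)"

definition isfun :: "'a \<Rightarrow> 'a \<Rightarrow> 'a \<Rightarrow> bool" where
  "isfun f A B \<longleftrightarrow> (\<forall>p. p \<epsilon> f \<longrightarrow> (\<exists>x y. x \<epsilon> A \<and> y \<epsilon> B \<and> p = pr x y)) \<and>
    (\<forall>x. x \<epsilon> A \<longrightarrow> (\<exists>y. pr x y \<epsilon> f \<and> (\<forall>z. pr x z \<epsilon> f \<longrightarrow> z = y)))"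

definition bij :: "'a \<Rightarrow> 'a \<Rightarrow> 'a \<Rightarrow> bool" where
  "bij f A B \<longleftrightarrow> isfun f A B \<and>
    (\<forall>y. y \<epsilon> B \<longrightarrow> (\<exists>x. pr x y \<epsilon> f \<and> (\<forall>z. pr z y \<epsilon> f \<longrightarrow> z = x)))"

end

subsection \<open>Models of ZF\<close>

locale zf_model = membership +
  assumes ZF: "s \<in> ZF \<Longrightarrow> sat E (=) e s"
begin

lemma ext: "(\<And>z. z \<epsilon> x \<longleftrightarrow> z \<epsilon> y) \<Longrightarrow> x = y"
  using ZF[OF ZF.Extensionality] by simp

lemma foundation: "y \<epsilon> x \<Longrightarrow> \<exists>y. y \<epsilon> x \<and> (\<forall>z. z \<epsilon> x \<longrightarrow> \<not> z \<epsilon> y)"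
  using ZF[OF ZF.Foundation] by simp blast

text \<open>Carries the schema over from formulas to definable HOL predicates. The work lies in
  bringing the defining formula into the shape of an instance: index 0 for the element, all other
  indices for parameters.\<close>

lemma separation:
  assumes "D (\<lambda>e. P (e 0))"
  shows "\<exists>b. \<forall>x. x \<epsilon> b \<longleftrightarrow> x \<epsilon> a \<and> P x"
proof -
  obtain p v where "\<forall>e :: nat \<Rightarrow> 'a. P (e 0) = sat E (=) (\<lambda>i. case_sum e id (v i)) p"
    using assms unfolding D_def by blast
  then have p: "P (e 0) = sat E (=) (\<lambda>i. case_sum e id (v i)) p" for e ..
  \<comment> \<open>\<open>P\<close> looks at entry 0 only, so all other entries are fixed as
    \<open>undefined\<close> and join the parameters; \<open>r\<close> merges the variables that
    stand for entry 0.\<close>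
  define b where "b i = (case v i of Inl j \<Rightarrow> undefined | Inr c \<Rightarrow> c)" for i
  define r where "r i = (if v i = Inl 0 then 0 else Suc i)" for i
  define q where "q = ren r p"
  have q: "P x = sat E (=) (case_nat x b) q" for x
  proof -
    have "(\<lambda>i. case_nat x b (r i)) = (\<lambda>i. case_sum (case_nat x (\<lambda>_. undefined)) id (v i))"
      by (auto simp: r_def b_def fun_eq_iff split: sum.split nat.split)
    with p[of "case_nat x (\<lambda>_. undefined)"] show ?thesis by (simp add: q_def sat_ren)
  qed
  obtain k where k: "bounded k q" using ex_bounded by blast
  then have k: "bounded (Suc k) q" by (rule bounded_mono) simp
  \<comment> \<open>Parameter \<open>j\<close> is the variable of level \<open>j\<close>, hence of
    index \<open>k - Suc j\<close> below the quantifiers of the axiom: the list is reversed. The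
    quantified \<open>a\<close>, \<open>b\<close>, \<open>x\<close> get the levels \<open>k\<close>,
    \<open>Suc k\<close>, \<open>Suc (Suc k)\<close>.\<close>
  define e where "e j = b (k - Suc j)" for j
  have *: "sat E (=) (\<lambda>i. lv (case_nat x (case_nat y (case_nat a e))) (Suc (Suc (Suc k)))
        (if i < length [Suc (Suc k)] then [Suc (Suc k)] ! i else i - length [Suc (Suc k)])) q =
      sat E (=) (case_nat x b) q" for x y a
  proof (rule sat_cong[OF k])
    fix i assume i: "i < Suc k"
    show "lv (case_nat x (case_nat y (case_nat a e))) (Suc (Suc (Suc k)))
        (if i < length [Suc (Suc k)] then [Suc (Suc k)] ! i else i - length [Suc (Suc k)]) =
      case_nat x b i"
    proof (cases i)
      case (Suc j)
      with i have "j < k" by simp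
      then show ?thesis by (simp add: Suc lv_def[of e] e_def)
    qed simp
  qed
  from sat_All_funpow[OF ZF[OF ZF.Separation[OF k]], of e]
  show ?thesis unfolding sat_connectives sat_inst q * by simp
qed


lemma the1_set:
  assumes "\<exists>b. \<forall>x. x \<epsilon> b \<longleftrightarrow> P x"
  shows "x \<epsilon> the1 (\<lambda>b. \<forall>x. x \<epsilon> b \<longleftrightarrow> P x) \<longleftrightarrow> P x"
proof -
  obtain b where b: "\<forall>x. x \<epsilon> b \<longleftrightarrow> P x" using assms ..
  have "the1 (\<lambda>b. \<forall>x. x \<epsilon> b \<longleftrightarrow> P x) = b"
    by (rule the1_equality) (use b in \<open>auto intro: ext\<close>)
  with b show ?thesis by simp
qed

lemma Sep_iff: "D (\<lambda>e. P (e 0)) \<Longrightarrow> x \<epsilon> Sep a P \<longleftrightarrow> x \<epsilon> a \<and> P x"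
  unfolding Sep_def by (rule the1_set[OF separation])

lemma up_iff [simp]: "z \<epsilon> up x y \<longleftrightarrow> z = x \<or> z = y"
  unfolding up_def by (rule the1_set) (use ZF[OF ZF.Pairing] in \<open>simp add: fupair_def\<close>)

lemma Uni_iff [simp]: "z \<epsilon> Uni x \<longleftrightarrow> (\<exists>y. y \<epsilon> x \<and> z \<epsilon> y)"
  unfolding Uni_def by (rule the1_set) (use ZF[OF ZF.Union] in simp)

lemma Pw_iff [simp]: "z \<epsilon> Pw x \<longleftrightarrow> sub z x"
  unfolding Pw_def by (rule the1_set) (use ZF[OF ZF.Power] in \<open>simp add: fsub_def\<close>)

lemma emp_iff [simp]: "\<not> z \<epsilon> emp"
proof -
  have "\<exists>b. \<forall>x. x \<epsilon> b \<longleftrightarrow> False" using separation[OF D_const[of False]] by simp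
  from the1_set[OF this] show ?thesis by (simp add: emp_def)
qed

lemma sc_iff [simp]: "z \<epsilon> sc x \<longleftrightarrow> z \<epsilon> x \<or> z = x"
  unfolding sc_def by auto

lemma up_eq: "up x y = up u v \<longleftrightarrow> x = u \<and> y = v \<or> x = v \<and> y = u"
proof
  assume "up x y = up u v"
  then have "z = x \<or> z = y \<longleftrightarrow> z = u \<or> z = v" for z using up_iff[of z x y] by simp
  then show "x = u \<and> y = v \<or> x = v \<and> y = u" by metis
qed (auto intro: ext)

lemma pr_eq [simp]: "pr x y = pr u v \<longleftrightarrow> x = u \<and> y = v"
  unfolding pr_def up_eq by auto

lemma cross_iff [simp]: "p \<epsilon> cross A B \<longleftrightarrow> (\<exists>x y. x \<epsilon> A \<and> y \<epsilon> B \<and> p = pr x y)"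
proof -
  have "pr x y \<epsilon> Pw (Pw (Uni (up A B)))" if "x \<epsilon> A" "y \<epsilon> B" for x y
    using that by (auto simp: pr_def)
  moreover have "p \<epsilon> cross A B \<longleftrightarrow>
      p \<epsilon> Pw (Pw (Uni (up A B))) \<and> (\<exists>x y. x \<epsilon> A \<and> y \<epsilon> B \<and> p = pr x y)"
    unfolding cross_def by (rule Sep_iff) (intro dfns)
  ultimately show ?thesis by blast
qed

lemma app_eq: "isfun f A B \<Longrightarrow> pr x y \<epsilon> f \<longleftrightarrow> x \<epsilon> A \<and> app f x = y"
proof
  assume f: "isfun f A B" and xy: "pr x y \<epsilon> f"
  then have x: "x \<epsilon> A" unfolding isfun_def by fastforce
  then obtain z where "pr x z \<epsilon> f" "\<forall>y. pr x y \<epsilon> f \<longrightarrow> y = z" using f unfolding isfun_def by blast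
  with xy have "app f x = y" unfolding app_def by (intro the1_equality) blast+
  with x show "x \<epsilon> A \<and> app f x = y" ..
next
  assume f: "isfun f A B" and xy: "x \<epsilon> A \<and> app f x = y"
  then obtain z where z: "pr x z \<epsilon> f" "\<forall>y. pr x y \<epsilon> f \<longrightarrow> y = z" unfolding isfun_def by blast
  have "app f x = z" unfolding app_def by (rule the1_equality) (use z in blast)+
  with z(1) xy show "pr x y \<epsilon> f" by simp
qed

lemma app_in: "isfun f A B \<Longrightarrow> x \<epsilon> A \<Longrightarrow> app f x \<epsilon> B"
  using app_eq[of f A B x "app f x"] unfolding isfun_def by fastforce

lemma isfun_Lam:
  assumes g: "T (\<lambda>e. g (e 0))" and "\<And>x. x \<epsilon> A \<Longrightarrow> g x \<epsilon> B"
  shows "isfun (Lam A B g) A B" "\<And>x. x \<epsilon> A \<Longrightarrow> app (Lam A B g) x = g x"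
proof -
  have "p \<epsilon> Lam A B g \<longleftrightarrow> p \<epsilon> cross A B \<and> (\<exists>x. p = pr x (g x))" for p
    unfolding Lam_def by (rule Sep_iff) (intro dfns T_comp1[OF g])
  then have *: "p \<epsilon> Lam A B g \<longleftrightarrow> (\<exists>x. x \<epsilon> A \<and> p = pr x (g x))" for p
    using assms(2) by auto
  then show 1: "isfun (Lam A B g) A B" using assms(2) unfolding isfun_def by auto
  show "app (Lam A B g) x = g x" if "x \<epsilon> A" for x
    using app_eq[OF 1, of x "g x"] that * by auto
qed

lemma bij_iff:
  "bij f A B \<longleftrightarrow> isfun f A B \<and> (\<forall>x y. x \<epsilon> A \<and> y \<epsilon> A \<and> app f x = app f y \<longrightarrow> x = y) \<and>
    (\<forall>y. y \<epsilon> B \<longrightarrow> (\<exists>x. x \<epsilon> A \<and> app f x = y))"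
proof (cases "isfun f A B")
  case True
  have "(\<forall>y. y \<epsilon> B \<longrightarrow> (\<exists>x. (x \<epsilon> A \<and> app f x = y) \<and> (\<forall>z. z \<epsilon> A \<and> app f z = y \<longrightarrow> z = x))) \<longleftrightarrow>
      (\<forall>x y. x \<epsilon> A \<and> y \<epsilon> A \<and> app f x = app f y \<longrightarrow> x = y) \<and>
      (\<forall>y. y \<epsilon> B \<longrightarrow> (\<exists>x. x \<epsilon> A \<and> app f x = y))" (is "?L \<longleftrightarrow> ?I \<and> ?S")
  proof
    assume L: ?L
    have "x = y" if xy: "x \<epsilon> A" "y \<epsilon> A" "app f x = app f y" for x y
    proof -
      from L app_in[OF True xy(1)] obtain u where "\<And>z. z \<epsilon> A \<Longrightarrow> app f z = app f x \<Longrightarrow> z = u"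
        by blast
      from this[of x] this[of y] xy show ?thesis by simp
    qed
    with L show "?I \<and> ?S" by blast
  qed blast
  then show ?thesis unfolding bij_def app_eq[OF True] using True by blast
qed (simp add: bij_def)

subsection \<open>Natural numbers\<close>

definition om :: 'a where "om = the1 (\<lambda>w. indv w \<and> (\<forall>v. indv v \<longrightarrow> sub w v))"

lemma D_indv: "T t \<Longrightarrow> D (\<lambda>e. indv (t e))"
  by (rule D_subst1) (unfold indv_def, intro dfns)

lemma fsuc_iff: "(\<forall>z. z \<epsilon> y \<longleftrightarrow> z \<epsilon> x \<or> z = x) \<longleftrightarrow> y = sc x"
  by (auto intro: ext)

lemma fempty_iff: "(\<forall>z. \<not> z \<epsilon> x) \<longleftrightarrow> x = emp"
  by (auto intro: ext)

lemma om: "indv om" "indv v \<Longrightarrow> sub om v"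
proof -
  obtain w where w: "indv w" using ZF[OF ZF.Infinity]
    by (auto simp: finductive_def fempty_def fsuc_def fsuc_iff fempty_iff indv_def)
  define u where "u = Sep w (\<lambda>n. \<forall>v. indv v \<longrightarrow> n \<epsilon> v)"
  have u_iff: "n \<epsilon> u \<longleftrightarrow> n \<epsilon> w \<and> (\<forall>v. indv v \<longrightarrow> n \<epsilon> v)" for n
    unfolding u_def by (rule Sep_iff) (intro dfns D_indv)
  have u: "indv u \<and> (\<forall>v. indv v \<longrightarrow> sub u v)"
    using w unfolding indv_def u_iff by blast
  have "w = u" if "indv w \<and> (\<forall>v. indv v \<longrightarrow> sub w v)" for w
    by (rule ext) (use that u in blast)
  with u have "om = u" unfolding om_def
    by (rule the1_equality[where P = "\<lambda>w. indv w \<and> (\<forall>v. indv v \<longrightarrow> sub w v)"])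
  with u show "indv om" "indv v \<Longrightarrow> sub om v" by auto
qed

lemma om_unique: "indv w \<Longrightarrow> (\<And>v. indv v \<Longrightarrow> sub w v) \<Longrightarrow> w = om"
  by (rule ext) (use om in blast)

lemma emp_om [simp]: "emp \<epsilon> om" and sc_om [simp]: "n \<epsilon> om \<Longrightarrow> sc n \<epsilon> om"
  using om(1) by (auto simp: indv_def)

text \<open>Restricted to definable \<open>P\<close>: the model may contain nonstandard natural
  numbers, and the set of all \<open>n\<close> with \<open>P n\<close> must belong to the
  model.\<close>

lemma om_induct [consumes 1, case_names dfn emp sc]:
  assumes n: "n \<epsilon> om" and P: "D (\<lambda>e. P (e 0))" "P emp" "\<And>n. n \<epsilon> om \<Longrightarrow> P n \<Longrightarrow> P (sc n)"
  shows "P n"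
proof -
  have "indv (Sep om P)" unfolding indv_def Sep_iff[OF P(1)] using P by auto
  from om(2)[OF this] n show ?thesis by (simp add: Sep_iff[OF P(1)])
qed

lemma mem_asym: "x \<epsilon> y \<Longrightarrow> \<not> y \<epsilon> x"
  using foundation[of x "up x y"] by auto

lemma mem_irrefl [simp]: "\<not> x \<epsilon> x"
  using mem_asym by blast

lemma sc_eq [simp]: "sc m = sc n \<longleftrightarrow> m = n"
proof
  assume "sc m = sc n"
  then have "z \<epsilon> m \<or> z = m \<longleftrightarrow> z \<epsilon> n \<or> z = n" for z using sc_iff[of z m] by simp
  then show "m = n" using mem_asym by blast
qed simp

lemma sc_emp [simp]: "sc n \<noteq> emp" "emp \<noteq> sc n"
  using sc_iff[of n n] emp_iff by metis+

lemma om_mem: "n \<epsilon> om \<Longrightarrow> m \<epsilon> n \<Longrightarrow> m \<epsilon> om"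
proof -
  assume "n \<epsilon> om"
  then have "\<forall>m. m \<epsilon> n \<longrightarrow> m \<epsilon> om"
    by (induction rule: om_induct) (intro dfns, auto)
  then show "m \<epsilon> n \<Longrightarrow> m \<epsilon> om" by blast
qed

lemma om_linear:
  assumes "m \<epsilon> om" "n \<epsilon> om" shows "m \<epsilon> n \<or> m = n \<or> n \<epsilon> m"
proof -
  have emp: "emp \<epsilon> n \<or> emp = n" if "n \<epsilon> om" for n
    using that by (induction rule: om_induct) (intro dfns, auto)
  \<comment> \<open>In the induction on \<open>m\<close> below, this takes \<open>m\<close> in
    \<open>n\<close> to \<open>sc m\<close> in \<open>n\<close> or \<open>sc m = n\<close>.\<close>
  have sc: "\<forall>m. m \<epsilon> n \<longrightarrow> sc m \<epsilon> sc n" if "n \<epsilon> om" for n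
    using that by (induction rule: om_induct) (intro dfns T_sc, auto)
  have "\<forall>n. n \<epsilon> om \<longrightarrow> m \<epsilon> n \<or> m = n \<or> n \<epsilon> m"
    using assms(1)
  proof (induction rule: om_induct)
    case (sc m)
    then show ?case using \<open>\<And>n. n \<epsilon> om \<Longrightarrow> \<forall>m. m \<epsilon> n \<longrightarrow> sc m \<epsilon> sc n\<close> by (metis sc_iff)
  qed (intro dfns, use emp in auto)
  with assms(2) show ?thesis by blast
qed

definition lst :: "('a \<Rightarrow> bool) \<Rightarrow> 'a" where
  "lst P = the1 (\<lambda>n. n \<epsilon> om \<and> P n \<and> (\<forall>m. m \<epsilon> n \<longrightarrow> \<not> P m))"

lemma lst_eq: "n \<epsilon> om \<Longrightarrow> P n \<Longrightarrow> (\<And>m. m \<epsilon> n \<Longrightarrow> \<not> P m) \<Longrightarrow> lst P = n"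
  unfolding lst_def by (rule the1_equality) (use om_linear in blast)+

text \<open>The order of \<open>om\<close> is membership, so foundation, applied to the set of all
  solutions, yields a least one.\<close>

lemma ex_least:
  assumes P: "D (\<lambda>e. P (e 0))" and "n \<epsilon> om" "P n"
  shows "\<exists>n. n \<epsilon> om \<and> P n \<and> (\<forall>m. m \<epsilon> n \<longrightarrow> \<not> P m)"
  using foundation[of n "Sep om P"] assms(2,3) om_mem unfolding Sep_iff[OF P] by blast

lemma lst:
  assumes "D (\<lambda>e. P (e 0))" "n \<epsilon> om" "P n"
  shows "lst P \<epsilon> om" "P (lst P)" "\<And>m. m \<epsilon> lst P \<Longrightarrow> \<not> P m"
proof -
  obtain k where k: "k \<epsilon> om" "P k" "\<forall>m. m \<epsilon> k \<longrightarrow> \<not> P m" using ex_least[OF assms] by blast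
  then have "lst P = k" by (intro lst_eq) auto
  with k show "lst P \<epsilon> om" "P (lst P)" "\<And>m. m \<epsilon> lst P \<Longrightarrow> \<not> P m" by auto
qed

text \<open>The graph is the least relation that contains the initial pair and is closed under the
  step. A pair that is neither initial nor the result of a step could be removed without harm to
  closure (\<open>minimal\<close>), so by induction every \<open>n\<close> has exactly one
  value.\<close>

lemma recursion:
  assumes a: "a \<epsilon> A" and s: "\<And>x. x \<epsilon> A \<Longrightarrow> s x \<epsilon> A" and Ts: "T (\<lambda>e. s (e 0))"
  obtains h where "isfun h om A" "app h emp = a" "\<And>n. n \<epsilon> om \<Longrightarrow> app h (sc n) = s (app h n)"
proof -
  define C where "C S \<longleftrightarrow> pr emp a \<epsilon> S \<and> (\<forall>n x. pr n x \<epsilon> S \<longrightarrow> pr (sc n) (s x) \<epsilon> S)" for S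
  have DC: "T t \<Longrightarrow> D (\<lambda>e. C (t e))" for t
    by (rule D_subst1) (unfold C_def, intro dfns T_comp1[OF Ts])
  define h where "h = Sep (cross om A) (\<lambda>p. \<forall>S. C S \<longrightarrow> p \<epsilon> S)"
  have h: "p \<epsilon> h \<longleftrightarrow> p \<epsilon> cross om A \<and> (\<forall>S. C S \<longrightarrow> p \<epsilon> S)" for p
    unfolding h_def by (rule Sep_iff) (intro dfns DC)
  have h0: "pr emp a \<epsilon> h" using a by (simp add: h C_def)
  have hsc: "pr (sc n) (s x) \<epsilon> h" if "pr n x \<epsilon> h" for n x
    using that s by (auto simp: h C_def)
  have minimal: "q \<noteq> p" if "q \<epsilon> h" "p \<noteq> pr emp a"
    and nsc: "\<And>n x. pr n x \<epsilon> h \<Longrightarrow> p \<noteq> pr (sc n) (s x)" for p q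
  proof
    assume "q = p"
    define S where "S = Sep h (\<lambda>q. q \<noteq> p)"
    have S: "q \<epsilon> S \<longleftrightarrow> q \<epsilon> h \<and> q \<noteq> p" for q
      unfolding S_def by (rule Sep_iff) (intro dfns)
    have "C S" unfolding C_def S using h0 hsc that(2) nsc by auto
    with \<open>q \<epsilon> h\<close> have "q \<epsilon> S" by (simp add: h)
    with \<open>q = p\<close> show False by (simp add: S)
  qed
  have unique: "\<exists>x. pr n x \<epsilon> h \<and> (\<forall>y. pr n y \<epsilon> h \<longrightarrow> y = x)" if "n \<epsilon> om" for n
    using that
  proof (induction rule: om_induct)
    case emp
    have "y = a" if "pr emp y \<epsilon> h" for y
      using minimal[OF that, of "pr emp y"] by auto
    with h0 show ?case by blast
  next
    case (sc n)
    then obtain x where x: "pr n x \<epsilon> h" "\<And>y. pr n y \<epsilon> h \<Longrightarrow> y = x" by blast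
    have "y = s x" if "pr (sc n) y \<epsilon> h" for y
      using minimal[OF that, of "pr (sc n) y"] x(2) by auto
    with hsc[OF x(1)] show ?case by blast
  qed (intro dfns)
  have func: "isfun h om A" unfolding isfun_def using unique by (auto simp: h)
  show thesis
  proof (rule that[OF func])
    show "app h emp = a" using h0 app_eq[OF func] by blast
    show "app h (sc n) = s (app h n)" if "n \<epsilon> om" for n
      using hsc that app_eq[OF func] by blast
  qed
qed

subsection \<open>Finite and countable sets\<close>

definition cnt :: "'a \<Rightarrow> bool" where "cnt A \<longleftrightarrow> (\<exists>S f. sub S om \<and> bij f A S)"
definition fin :: "'a \<Rightarrow> bool" where "fin A \<longleftrightarrow> (\<exists>k f. k \<epsilon> om \<and> bij f A k)"

text \<open>A partial map of \<open>om\<close> onto \<open>A\<close> makes \<open>A\<close>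
  countable without choice: each element is sent to the least number related to it, and
  functionality of \<open>r\<close> makes this injective.\<close>

lemma cntI:
  assumes r: "D (\<lambda>e. r (e 0) (e 1))"
    and ex: "\<And>y. y \<epsilon> A \<Longrightarrow> \<exists>n. n \<epsilon> om \<and> r n y"
    and func: "\<And>n y z. n \<epsilon> om \<Longrightarrow> y \<epsilon> A \<Longrightarrow> z \<epsilon> A \<Longrightarrow> r n y \<Longrightarrow> r n z \<Longrightarrow> y = z"
  shows "cnt A"
proof -
  define g where "g y = lst (\<lambda>n. r n y)" for y
  have Dr: "D (\<lambda>e. r (e 0) y)" for y
    by (rule D_subst2[OF r]) (intro dfns)+
  have g: "g y \<epsilon> om \<and> r (g y) y" if "y \<epsilon> A" for y
    using ex[OF that] lst[OF Dr] unfolding g_def by blast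
  have Tg: "T (\<lambda>e. g (e 0))" unfolding g_def lst_def by (intro dfns D_subst2[OF r])
  define S where "S = Sep om (\<lambda>n. \<exists>y. y \<epsilon> A \<and> n = g y)"
  have S: "n \<epsilon> S \<longleftrightarrow> n \<epsilon> om \<and> (\<exists>y. y \<epsilon> A \<and> n = g y)" for n
    unfolding S_def by (rule Sep_iff) (intro dfns T_comp1[OF Tg])
  have "isfun (Lam A S g) A S" and app: "\<And>x. x \<epsilon> A \<Longrightarrow> app (Lam A S g) x = g x"
    using isfun_Lam[OF Tg, of A S] S g by blast+
  then have "bij (Lam A S g) A S"
    unfolding bij_iff using func g S by (metis (no_types, lifting))
  then show ?thesis unfolding cnt_def using S by blast
qed

lemma cnt_image:
  assumes F: "cnt F" and g: "T (\<lambda>e. g (e 0))" and ex: "\<And>y. y \<epsilon> K \<Longrightarrow> \<exists>A. A \<epsilon> F \<and> y = g A"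
  shows "cnt K"
proof -
  obtain S f where "sub S om" and f: "bij f F S" using F unfolding cnt_def by blast
  then have func: "isfun f F S" and inj: "\<And>x y. x \<epsilon> F \<Longrightarrow> y \<epsilon> F \<Longrightarrow> app f x = app f y \<Longrightarrow> x = y"
    unfolding bij_iff by blast+
  show ?thesis
  proof (rule cntI[of "\<lambda>n y. \<exists>A. A \<epsilon> F \<and> app f A = n \<and> y = g A"])
    show "\<exists>n. n \<epsilon> om \<and> (\<exists>A. A \<epsilon> F \<and> app f A = n \<and> y = g A)" if "y \<epsilon> K" for y
      using ex[OF that] app_in[OF func] \<open>sub S om\<close> by blast
  qed (intro dfns T_comp1[OF g], use inj in blast)
qed

lemma cnt_image_om:
  assumes g: "T (\<lambda>e. g (e 0))" and ex: "\<And>y. y \<epsilon> K \<Longrightarrow> \<exists>n. n \<epsilon> om \<and> y = g n"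
  shows "cnt K"
  by (rule cntI[of "\<lambda>n y. y = g n"]) (use ex in \<open>auto intro!: dfns T_comp1[OF g]\<close>)

subsection \<open>Topology\<close>

definition istop :: "'a \<Rightarrow> 'a \<Rightarrow> bool" where
  "istop X \<tau> \<longleftrightarrow> (\<forall>U. U \<epsilon> \<tau> \<longrightarrow> sub U X) \<and> X \<epsilon> \<tau> \<and> emp \<epsilon> \<tau> \<and>
    (\<forall>S. sub S \<tau> \<longrightarrow> Uni S \<epsilon> \<tau>) \<and> (\<forall>U V. U \<epsilon> \<tau> \<longrightarrow> V \<epsilon> \<tau> \<longrightarrow> Sep U (\<lambda>x. x \<epsilon> V) \<epsilon> \<tau>)"

definition clopen :: "'a \<Rightarrow> 'a \<Rightarrow> 'a \<Rightarrow> bool" where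
  "clopen X \<tau> A \<longleftrightarrow> A \<epsilon> \<tau> \<and> sub A X \<and> Sep X (\<lambda>x. \<not> x \<epsilon> A) \<epsilon> \<tau>"

definition cinter :: "('a \<Rightarrow> bool) \<Rightarrow> 'a \<Rightarrow> bool" where
  "cinter P G \<longleftrightarrow> (\<exists>F. cnt F \<and> F \<noteq> emp \<and> (\<forall>A. A \<epsilon> F \<longrightarrow> P A) \<and>
    (\<forall>x. x \<epsilon> G \<longleftrightarrow> (\<forall>A. A \<epsilon> F \<longrightarrow> x \<epsilon> A)))"

definition base :: "'a \<Rightarrow> ('a \<Rightarrow> bool) \<Rightarrow> bool" where
  "base \<tau> P \<longleftrightarrow> (\<forall>B. P B \<longrightarrow> B \<epsilon> \<tau>) \<and>
    (\<forall>U x. U \<epsilon> \<tau> \<and> x \<epsilon> U \<longrightarrow> (\<exists>B. P B \<and> x \<epsilon> B \<and> sub B U))"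

definition P_space :: "'a \<Rightarrow> bool" where
  "P_space \<tau> \<longleftrightarrow> (\<forall>G. cinter (\<lambda>U. U \<epsilon> \<tau>) G \<longrightarrow> G \<epsilon> \<tau>)"

definition cmc :: bool where
  "cmc \<longleftrightarrow> (\<forall>A. \<not> fin A \<and> cnt A \<and> (\<forall>x. x \<epsilon> A \<longrightarrow> x \<noteq> emp) \<longrightarrow>
    (\<exists>f B. isfun f A B \<and>
      (\<forall>x y. x \<epsilon> A \<and> pr x y \<epsilon> f \<longrightarrow> y \<noteq> emp \<and> sub y x \<and> fin y)))"

lemma D_clopen: "T s \<Longrightarrow> D (\<lambda>e. clopen X \<tau> (s e))"
  by (rule D_subst1) (unfold clopen_def, intro dfns)

lemma not_emp: "x \<noteq> emp \<longleftrightarrow> (\<exists>y. y \<epsilon> x)"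
  using fempty_iff[of x] by auto

end

locale space = zf_model +
  fixes X \<tau> :: 'a
  assumes top: "istop X \<tau>"
begin

lemma open_sub: "U \<epsilon> \<tau> \<Longrightarrow> x \<epsilon> U \<Longrightarrow> x \<epsilon> X"
  using top unfolding istop_def by blast

lemma X_open: "X \<epsilon> \<tau>"
  using top unfolding istop_def by blast

lemma Sep_X: "Sep X (\<lambda>x. x \<epsilon> U) = U" if "U \<epsilon> \<tau>"
  by (rule ext, subst Sep_iff) (use open_sub[OF that] in \<open>auto intro: dfns\<close>)

text \<open>\<open>G\<close> is the union of all its open subsets; no neighbourhood has to be chosen
  for each point.\<close>

lemma openI:
  assumes "\<And>x. x \<epsilon> G \<Longrightarrow> \<exists>V. V \<epsilon> \<tau> \<and> x \<epsilon> V \<and> sub V G"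
  shows "G \<epsilon> \<tau>"
proof -
  define S where "S = Sep \<tau> (\<lambda>V. sub V G)"
  have S: "V \<epsilon> S \<longleftrightarrow> V \<epsilon> \<tau> \<and> sub V G" for V
    unfolding S_def by (rule Sep_iff) (intro dfns)
  have "Uni S = G" by (rule ext) (use assms in \<open>auto simp: S\<close>)
  moreover have "Uni S \<epsilon> \<tau>" using top S unfolding istop_def by blast
  ultimately show ?thesis by simp
qed

lemma open_Int:
  assumes "D (\<lambda>e. P (e 0))" "D (\<lambda>e. Q (e 0))" "Sep X P \<epsilon> \<tau>" "Sep X Q \<epsilon> \<tau>"
  shows "Sep X (\<lambda>x. P x \<and> Q x) \<epsilon> \<tau>"
proof -
  have "x \<epsilon> Sep (Sep X P) (\<lambda>x. x \<epsilon> Sep X Q) \<longleftrightarrow> x \<epsilon> Sep X (\<lambda>x. P x \<and> Q x)" for x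
  proof -
    have "x \<epsilon> Sep (Sep X P) (\<lambda>x. x \<epsilon> Sep X Q) \<longleftrightarrow> x \<epsilon> Sep X P \<and> x \<epsilon> Sep X Q"
      by (rule Sep_iff) (intro dfns)
    then show ?thesis using assms(1,2) by (auto simp: Sep_iff D_conj)
  qed
  then have "Sep (Sep X P) (\<lambda>x. x \<epsilon> Sep X Q) = Sep X (\<lambda>x. P x \<and> Q x)" by (rule ext)
  with top assms(3,4) show ?thesis unfolding istop_def by metis
qed

text \<open>Finiteness is that of the model, where \<open>n\<close> may be nonstandard. The
  induction therefore runs inside the model, and openness of the intersection must be shown to be
  definable in \<open>n\<close>.\<close>

lemma nat_inter:
  assumes P: "D (\<lambda>e. P (e 0) (e 1))" and op: "\<And>m. m \<epsilon> om \<Longrightarrow> Sep X (P m) \<epsilon> \<tau>" and n: "n \<epsilon> om"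
  shows "Sep X (\<lambda>y. \<forall>m. m \<epsilon> n \<longrightarrow> P m y) \<epsilon> \<tau>"
  using n
proof (induction rule: om_induct)
  case dfn
  show ?case by (intro dfns D_subst2[OF P])
next
  case emp
  have "Sep X (\<lambda>y. \<forall>m. m \<epsilon> emp \<longrightarrow> P m y) = X"
    by (rule ext, subst Sep_iff) (auto intro: dfns)
  with X_open show ?case by simp
next
  case (sc n)
  have "Sep X (\<lambda>y. (\<forall>m. m \<epsilon> n \<longrightarrow> P m y) \<and> P n y) \<epsilon> \<tau>"
    by (rule open_Int[OF _ _ sc.IH op[OF sc.hyps]]) (intro dfns D_subst2[OF P])+
  moreover have "(\<lambda>y. \<forall>m. m \<epsilon> sc n \<longrightarrow> P m y) = (\<lambda>y. (\<forall>m. m \<epsilon> n \<longrightarrow> P m y) \<and> P n y)"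
    by auto
  ultimately show ?case by simp
qed

lemma finite_inter:
  assumes P: "D (\<lambda>e. P (e 0) (e 1))" and "fin K" and op: "\<And>B. B \<epsilon> K \<Longrightarrow> Sep X (P B) \<epsilon> \<tau>"
  shows "Sep X (\<lambda>y. \<forall>B. B \<epsilon> K \<longrightarrow> P B y) \<epsilon> \<tau>"
proof -
  obtain k f where k: "k \<epsilon> om" and f: "bij f K k" using \<open>fin K\<close> unfolding fin_def by blast
  then have func: "isfun f K k" and inj: "\<And>x y. x \<epsilon> K \<Longrightarrow> y \<epsilon> K \<Longrightarrow> app f x = app f y \<Longrightarrow> x = y"
    unfolding bij_iff by blast+
  \<comment> \<open>\<open>Q m\<close> is \<open>P B\<close> for the member \<open>B\<close> with
    number \<open>m\<close>, and holds vacuously at numbers outside the range of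
    \<open>f\<close>.\<close>
  define Q where "Q m y \<longleftrightarrow> (\<forall>B. B \<epsilon> K \<and> app f B = m \<longrightarrow> P B y)" for m y
  have "Sep X (\<lambda>y. \<forall>m. m \<epsilon> k \<longrightarrow> Q m y) \<epsilon> \<tau>"
  proof (rule nat_inter[OF _ _ k])
    show "D (\<lambda>e. Q (e 0) (e 1))" unfolding Q_def by (intro dfns D_subst2[OF P])
    show "Sep X (Q m) \<epsilon> \<tau>" for m
    proof (cases "\<exists>B. B \<epsilon> K \<and> app f B = m")
      case True
      then obtain B where B: "B \<epsilon> K" "app f B = m" by blast
      then have "Q m = P B" unfolding Q_def using inj by blast
      with op[OF B(1)] show ?thesis by simp
    next
      case False
      have "Sep X (\<lambda>_. True) = X" by (rule ext, subst Sep_iff) (auto intro: dfns)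
      moreover have "Q m = (\<lambda>_. True)" using False unfolding Q_def by blast
      ultimately show ?thesis using X_open by simp
    qed
  qed
  moreover have "(\<lambda>y. \<forall>m. m \<epsilon> k \<longrightarrow> Q m y) = (\<lambda>y. \<forall>B. B \<epsilon> K \<longrightarrow> P B y)"
    unfolding Q_def using app_in[OF func] by blast
  ultimately show ?thesis by simp
qed

lemma compl_iff: "x \<epsilon> Sep X (\<lambda>x. \<not> x \<epsilon> A) \<longleftrightarrow> x \<epsilon> X \<and> \<not> x \<epsilon> A"
  by (rule Sep_iff) (intro dfns)

lemma clopen_Un:
  assumes "clopen X \<tau> A" "clopen X \<tau> B" shows "clopen X \<tau> (Uni (up A B))"
proof -
  have "Uni (up A B) \<epsilon> \<tau>" by (rule openI) (use assms in \<open>auto simp: clopen_def\<close>)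
  moreover have "Sep X (\<lambda>x. \<not> x \<epsilon> A \<and> \<not> x \<epsilon> B) \<epsilon> \<tau>"
    by (rule open_Int, (intro dfns)+) (use assms in \<open>auto simp: clopen_def\<close>)
  moreover have "(\<lambda>x. \<not> x \<epsilon> A \<and> \<not> x \<epsilon> B) = (\<lambda>x. \<not> x \<epsilon> Uni (up A B))" by auto
  ultimately show ?thesis using assms by (auto simp: clopen_def)
qed

lemma clopen_finite_inter:
  assumes "fin K" "\<And>C. C \<epsilon> K \<Longrightarrow> clopen X \<tau> C"
  shows "clopen X \<tau> (Sep X (\<lambda>y. \<forall>C. C \<epsilon> K \<longrightarrow> y \<epsilon> C))"
proof -
  let ?W = "Sep X (\<lambda>y. \<forall>C. C \<epsilon> K \<longrightarrow> y \<epsilon> C)"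
  have W: "y \<epsilon> ?W \<longleftrightarrow> y \<epsilon> X \<and> (\<forall>C. C \<epsilon> K \<longrightarrow> y \<epsilon> C)" for y
    by (rule Sep_iff) (intro dfns)
  have "?W \<epsilon> \<tau>"
    by (rule finite_inter[OF _ assms(1)], intro dfns) (use assms(2) Sep_X in \<open>auto simp: clopen_def\<close>)
  moreover have "Sep X (\<lambda>x. \<not> x \<epsilon> ?W) \<epsilon> \<tau>"
  proof (rule openI)
    fix x assume "x \<epsilon> Sep X (\<lambda>x. \<not> x \<epsilon> ?W)"
    then have "x \<epsilon> X \<and> \<not> x \<epsilon> ?W" unfolding compl_iff .
    then obtain C where C: "x \<epsilon> X" "C \<epsilon> K" "\<not> x \<epsilon> C" unfolding W by blast
    show "\<exists>V. V \<epsilon> \<tau> \<and> x \<epsilon> V \<and> sub V (Sep X (\<lambda>x. \<not> x \<epsilon> ?W))"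
      unfolding compl_iff by (rule exI[of _ "Sep X (\<lambda>x. \<not> x \<epsilon> C)"])
        (use C assms(2) in \<open>auto simp: clopen_def compl_iff W\<close>)
  qed
  ultimately show ?thesis unfolding clopen_def using W by blast
qed

theorem P_space_if_CO_delta_open:
  assumes cmc and base: "base \<tau> (clopen X \<tau>)"
    and CO: "\<And>G. cinter (clopen X \<tau>) G \<Longrightarrow> G \<epsilon> \<tau>"
  shows "P_space \<tau>"
  unfolding P_space_def
proof (intro allI impI)
  fix G assume "cinter (\<lambda>U. U \<epsilon> \<tau>) G"
  then obtain F where F: "cnt F" "F \<noteq> emp" "\<And>A. A \<epsilon> F \<Longrightarrow> A \<epsilon> \<tau>"
    and G: "\<And>x. x \<epsilon> G \<longleftrightarrow> (\<forall>A. A \<epsilon> F \<longrightarrow> x \<epsilon> A)" unfolding cinter_def by blast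
  have GX: "x \<epsilon> X" if "x \<epsilon> G" for x using that F(2,3) G open_sub unfolding not_emp by blast
  show "G \<epsilon> \<tau>"
  proof (rule openI)
    fix x assume x: "x \<epsilon> G"
    \<comment> \<open>All clopen neighbourhoods of \<open>x\<close> inside \<open>A\<close> are
      taken, so that \<open>B\<close> is definable; selection is left to \<open>cmc\<close>.\<close>
    define B where "B A = Sep \<tau> (\<lambda>C. clopen X \<tau> C \<and> x \<epsilon> C \<and> sub C A)" for A
    have TB: "T (\<lambda>e. B (e 0))" unfolding B_def by (intro dfns D_clopen)
    have B: "C \<epsilon> B A \<longleftrightarrow> clopen X \<tau> C \<and> x \<epsilon> C \<and> sub C A" for C A
    proof -
      have "C \<epsilon> B A \<longleftrightarrow> C \<epsilon> \<tau> \<and> clopen X \<tau> C \<and> x \<epsilon> C \<and> sub C A"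
        unfolding B_def by (rule Sep_iff) (intro dfns D_clopen)
      then show ?thesis by (auto simp: clopen_def)
    qed
    have B_ne: "B A \<noteq> emp" if "A \<epsilon> F" for A
      using base F(3)[OF that] x that unfolding not_emp B base_def G by blast
    \<comment> \<open>\<open>A\<close> can be recovered from \<open>B A\<close>, which serves the
      case of finite \<open>K\<close>. A clopen set around a point \<open>y\<close> of
      \<open>A\<close> need not contain \<open>x\<close>; joining it to a member of
      \<open>B A\<close> gives a member of \<open>B A\<close> that contains
      \<open>y\<close>.\<close>
    have Uni_B: "Uni (B A) = A" if A: "A \<epsilon> F" for A
    proof (rule ext)
      fix y
      have "y \<epsilon> Uni (B A)" if y: "y \<epsilon> A"
      proof -
        obtain C where C: "clopen X \<tau> C" "y \<epsilon> C" "sub C A"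
          using base F(3)[OF A] y unfolding base_def by blast
        obtain C' where C': "C' \<epsilon> B A" using B_ne[OF A] unfolding not_emp by blast
        with C have "Uni (up C C') \<epsilon> B A" unfolding B by (auto intro: clopen_Un)
        moreover have "y \<epsilon> Uni (up C C')" using C(2) by auto
        ultimately show ?thesis by (subst Uni_iff) blast
      qed
      then show "y \<epsilon> Uni (B A) \<longleftrightarrow> y \<epsilon> A" by (auto simp: B)
    qed
    define K where "K = Sep (Pw \<tau>) (\<lambda>b. \<exists>A. A \<epsilon> F \<and> b = B A)"
    have K: "b \<epsilon> K \<longleftrightarrow> (\<exists>A. A \<epsilon> F \<and> b = B A)" for b
    proof -
      have "b \<epsilon> K \<longleftrightarrow> b \<epsilon> Pw \<tau> \<and> (\<exists>A. A \<epsilon> F \<and> b = B A)"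
        unfolding K_def by (rule Sep_iff) (intro dfns T_comp1[OF TB])
      then show ?thesis by (auto simp: B clopen_def)
    qed
    have cntK: "cnt K" by (rule cnt_image[OF F(1) TB]) (use K in blast)
    show "\<exists>V. V \<epsilon> \<tau> \<and> x \<epsilon> V \<and> sub V G"
    proof (cases "fin K")
      \<comment> \<open>\<open>cmc\<close> says nothing about a finite family. Here \<open>G\<close>
        is itself a finite intersection of open sets, namely of the unions of the members of
        \<open>K\<close>.\<close>
      case True
      have "Sep X (\<lambda>y. \<forall>b. b \<epsilon> K \<longrightarrow> y \<epsilon> Uni b) \<epsilon> \<tau>"
        by (rule finite_inter[OF _ True], intro dfns)
          (use Sep_X F(3) in \<open>auto simp: K Uni_B simp del: Uni_iff\<close>)
      moreover have "y \<epsilon> Sep X (\<lambda>y. \<forall>b. b \<epsilon> K \<longrightarrow> y \<epsilon> Uni b) \<longleftrightarrow>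
          y \<epsilon> X \<and> (\<forall>b. b \<epsilon> K \<longrightarrow> y \<epsilon> Uni b)" for y
        by (rule Sep_iff) (intro dfns)
      then have "Sep X (\<lambda>y. \<forall>b. b \<epsilon> K \<longrightarrow> y \<epsilon> Uni b) = G"
        by (intro ext) (use GX G in \<open>auto simp: K Uni_B simp del: Uni_iff\<close>)
      ultimately show ?thesis using x by auto
    next
      case False
      have "\<forall>b. b \<epsilon> K \<longrightarrow> b \<noteq> emp" using B_ne K by metis
      with False cntK have "\<not> fin K \<and> cnt K \<and> (\<forall>b. b \<epsilon> K \<longrightarrow> b \<noteq> emp)" by simp
      from \<open>cmc\<close>[unfolded cmc_def, THEN spec, THEN mp, OF this]
      obtain c Y where c: "isfun c K Y"
        and c': "\<And>b y. b \<epsilon> K \<Longrightarrow> pr b y \<epsilon> c \<Longrightarrow> y \<noteq> emp \<and> sub y b \<and> fin y"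
        by (elim exE conjE) blast
      have cB: "app c (B A) \<noteq> emp" "sub (app c (B A)) (B A)" "fin (app c (B A))" if "A \<epsilon> F" for A
        using c'[of "B A" "app c (B A)"] app_eq[OF c] K that by blast+
      \<comment> \<open>The multiple choice function \<open>c\<close> is a set of the model, so it
        may serve as a parameter and \<open>W\<close> is definable. Hence the sets
        \<open>W A\<close> form a countable family as an image of \<open>F\<close>.\<close>
      define W where "W A = Sep X (\<lambda>y. \<forall>C. C \<epsilon> app c (B A) \<longrightarrow> y \<epsilon> C)" for A
      have W: "y \<epsilon> W A \<longleftrightarrow> y \<epsilon> X \<and> (\<forall>C. C \<epsilon> app c (B A) \<longrightarrow> y \<epsilon> C)" for y A
        unfolding W_def by (rule Sep_iff) (intro dfns)
      have TW: "T (\<lambda>e. W (e 0))" unfolding W_def by (intro dfns T_comp1[OF TB])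
      have W_clopen: "clopen X \<tau> (W A)" if "A \<epsilon> F" for A
        unfolding W_def by (rule clopen_finite_inter) (use cB[OF that] B in blast)+
      have W_sub: "sub (W A) A" and xW: "x \<epsilon> W A" if "A \<epsilon> F" for A
        using cB[OF that] GX[OF x] unfolding W not_emp B by blast+
      define L where "L = Sep \<tau> (\<lambda>w. \<exists>A. A \<epsilon> F \<and> w = W A)"
      have L: "w \<epsilon> L \<longleftrightarrow> (\<exists>A. A \<epsilon> F \<and> w = W A)" for w
      proof -
        have "w \<epsilon> L \<longleftrightarrow> w \<epsilon> \<tau> \<and> (\<exists>A. A \<epsilon> F \<and> w = W A)"
          unfolding L_def by (rule Sep_iff) (intro dfns T_comp1[OF TW])
        then show ?thesis using W_clopen by (auto simp: clopen_def)
      qed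
      define H where "H = Sep X (\<lambda>y. \<forall>w. w \<epsilon> L \<longrightarrow> y \<epsilon> w)"
      have "y \<epsilon> H \<longleftrightarrow> y \<epsilon> X \<and> (\<forall>w. w \<epsilon> L \<longrightarrow> y \<epsilon> w)" for y
        unfolding H_def by (rule Sep_iff) (intro dfns)
      moreover have L_ne: "\<exists>w. w \<epsilon> L" using F(2) unfolding not_emp L by blast
      ultimately have H: "y \<epsilon> H \<longleftrightarrow> (\<forall>w. w \<epsilon> L \<longrightarrow> y \<epsilon> w)" for y
        unfolding L using W by blast
      have "cinter (clopen X \<tau>) H" unfolding cinter_def
      proof (intro exI conjI)
        show "cnt L" by (rule cnt_image[OF F(1) TW]) (use L in blast)
        show "L \<noteq> emp" using L_ne unfolding not_emp .
        show "\<forall>A. A \<epsilon> L \<longrightarrow> clopen X \<tau> A" using W_clopen unfolding L by blast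
      qed (use H in blast)
      then have "H \<epsilon> \<tau>" by (rule CO)
      moreover have "x \<epsilon> H" "sub H G" unfolding H L G using xW W_sub by blast+
      ultimately show ?thesis by blast
    qed
  qed
qed

end

subsection \<open>Translation of the formulas\<close>

context zf_model
begin

lemma set_eq_iff: "U = B \<longleftrightarrow> (\<forall>x. x \<epsilon> U \<longleftrightarrow> x \<epsilon> B)"
  by (auto intro: ext)

text \<open>Formulas introduce a set through its elements. Turning such a description into an
  equation lets the quantifier over the set be eliminated.\<close>

lemma Sep_eq:
  assumes "D (\<lambda>e. P (e 0))"
  shows "(\<forall>x. x \<epsilon> U \<longleftrightarrow> x \<epsilon> a \<and> P x) \<longleftrightarrow> U = Sep a P"
  unfolding set_eq_iff Sep_iff[OF assms] ..

text \<open>The side conditions here and in the following rules say that the variables are in scope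
  at depth \<open>n\<close>. Only then are their values preserved when the formula enters its own
  quantifiers.\<close>

lemma sat_fsub [simp]: "x < n \<Longrightarrow> y < n \<Longrightarrow>
    sat E (=) e ((x \<^bold>\<subseteq> y) n) \<longleftrightarrow> sub (lv e n x) (lv e n y)"
  by (simp add: fsub_def)

lemma sat_fempty [simp]: "x < n \<Longrightarrow> sat E (=) e (fempty x n) \<longleftrightarrow> lv e n x = emp"
  by (simp add: fempty_def set_eq_iff)

lemma sat_fupair [simp]: "p < n \<Longrightarrow> x < n \<Longrightarrow> y < n \<Longrightarrow>
    sat E (=) e (fupair p x y n) \<longleftrightarrow> lv e n p = up (lv e n x) (lv e n y)"
  by (simp add: fupair_def set_eq_iff)

lemma sat_fpair [simp]: "p < n \<Longrightarrow> x < n \<Longrightarrow> y < n \<Longrightarrow>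
    sat E (=) e (fpair p x y n) \<longleftrightarrow> lv e n p = pr (lv e n x) (lv e n y)"
  by (simp add: fpair_def pr_def set_eq_iff[of "lv e n p"])

lemma sat_frel [simp]: "f < n \<Longrightarrow> x < n \<Longrightarrow> y < n \<Longrightarrow>
    sat E (=) e (frel f x y n) \<longleftrightarrow> pr (lv e n x) (lv e n y) \<epsilon> lv e n f"
  by (simp add: frel_def)

lemma sat_fprod [simp]: "p < n \<Longrightarrow> x < n \<Longrightarrow> y < n \<Longrightarrow>
    sat E (=) e (fprod p x y n) \<longleftrightarrow> lv e n p = cross (lv e n x) (lv e n y)"
  by (simp add: fprod_def set_eq_iff[of "lv e n p"])

lemma sat_ffun [simp]: "f < n \<Longrightarrow> A < n \<Longrightarrow> B < n \<Longrightarrow>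
    sat E (=) e (ffun f A B n) \<longleftrightarrow> isfun (lv e n f) (lv e n A) (lv e n B)"
  by (simp add: ffun_def frelation_def isfun_def)

lemma sat_fbij [simp]: "f < n \<Longrightarrow> A < n \<Longrightarrow> B < n \<Longrightarrow>
    sat E (=) e (fbij f A B n) \<longleftrightarrow> bij (lv e n f) (lv e n A) (lv e n B)"
  by (simp add: fbij_def bij_def)

lemma sat_finductive [simp]: "w < n \<Longrightarrow> sat E (=) e (finductive w n) \<longleftrightarrow> indv (lv e n w)"
  by (simp add: finductive_def fsuc_def fsuc_iff indv_def)

lemma sat_fomega [simp]: "w < n \<Longrightarrow> sat E (=) e (fomega w n) \<longleftrightarrow> lv e n w = om"
proof -
  have "indv w \<and> (\<forall>v. indv v \<longrightarrow> sub w v) \<longleftrightarrow> w = om" for w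
    using om_unique[of w] om by blast
  then show "w < n \<Longrightarrow> ?thesis" by (simp add: fomega_def)
qed

lemma sat_ffinite [simp]: "A < n \<Longrightarrow> sat E (=) e (ffinite A n) \<longleftrightarrow> fin (lv e n A)"
  by (simp add: ffinite_def fin_def)

lemma sat_fcountable [simp]: "A < n \<Longrightarrow> sat E (=) e (fcountable A n) \<longleftrightarrow> cnt (lv e n A)"
  by (simp add: fcountable_def cnt_def)

lemma sat_CMC: "sat E (=) e (CMC n) \<longleftrightarrow> cmc"
  by (simp add: CMC_def fdenumerable_def cmc_def)

lemma sat_ftopology: "X < n \<Longrightarrow> t < n \<Longrightarrow>
    sat E (=) e (ftopology X t n) \<longleftrightarrow> istop (lv e n X) (lv e n t)"
proof -
  have "(\<forall>x. x \<epsilon> U \<longleftrightarrow> (\<exists>V. V \<epsilon> S \<and> x \<epsilon> V)) \<longleftrightarrow> U = Uni S" for U S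
    by (simp add: set_eq_iff)
  moreover have "(\<forall>x. x \<epsilon> W \<longleftrightarrow> x \<epsilon> U \<and> x \<epsilon> V) \<longleftrightarrow> W = Sep U (\<lambda>x. x \<epsilon> V)" for U V W
    by (rule Sep_eq) (intro dfns)
  ultimately show "X < n \<Longrightarrow> t < n \<Longrightarrow> ?thesis"
    by (simp add: ftopology_def istop_def imp_conjL)
qed

lemma compl_eq: "(\<forall>x. x \<epsilon> U \<longleftrightarrow> x \<epsilon> X \<and> \<not> x \<epsilon> A) \<longleftrightarrow> U = Sep X (\<lambda>x. \<not> x \<epsilon> A)"
  by (rule Sep_eq) (intro dfns)

lemma sat_fcompl [simp]: "X < n \<Longrightarrow> A < n \<Longrightarrow> B < n \<Longrightarrow>
    sat E (=) e (fcompl X A B n) \<longleftrightarrow> sub (lv e n B) (lv e n X) \<and>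
      lv e n A = Sep (lv e n X) (\<lambda>x. \<not> x \<epsilon> lv e n B)"
  by (simp add: fcompl_def compl_eq)

lemma sat_fclopen [simp]: "X < n \<Longrightarrow> t < n \<Longrightarrow> A < n \<Longrightarrow>
    sat E (=) e (fclopen X t A n) \<longleftrightarrow> clopen (lv e n X) (lv e n t) (lv e n A)"
  by (auto simp: fclopen_def clopen_def)

lemma sat_fP_space: "t < n \<Longrightarrow> sat E (=) e (fP_space t n) \<longleftrightarrow> P_space (lv e n t)"
  by (simp add: fP_space_def fG_delta_def fcountable_inter_def P_space_def cinter_def)

lemma sat_fCO_delta [simp]: "X < n \<Longrightarrow> t < n \<Longrightarrow> G < n \<Longrightarrow>
    sat E (=) e (fCO_delta X t G n) \<longleftrightarrow> cinter (clopen (lv e n X) (lv e n t)) (lv e n G)"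
  by (simp add: fCO_delta_def fcountable_inter_def cinter_def)

lemma sat_fzero_dimensional: "X < n \<Longrightarrow> t < n \<Longrightarrow>
    sat E (=) e (fzero_dimensional X t n) \<longleftrightarrow> base (lv e n t) (clopen (lv e n X) (lv e n t))"
  by (simp add: fzero_dimensional_def fbase_def base_def)

section \<open>Real numbers and real-valued functions inside a model\<close>

definition neutral :: "'a \<Rightarrow> 'a \<Rightarrow> 'a \<Rightarrow> bool" where
  "neutral f A c \<longleftrightarrow> c \<epsilon> A \<and> (\<forall>x. x \<epsilon> A \<longrightarrow> pr (pr c x) x \<epsilon> f)"

definition ropen :: "'a \<Rightarrow> 'a \<Rightarrow> 'a \<Rightarrow> bool" where
  "ropen R l V \<longleftrightarrow> sub V R \<and> (\<forall>x. x \<epsilon> V \<longrightarrow>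
    (\<exists>a b. pr a x \<epsilon> l \<and> pr x b \<epsilon> l \<and> (\<forall>y. pr a y \<epsilon> l \<and> pr y b \<epsilon> l \<longrightarrow> y \<epsilon> V)))"

definition cont :: "'a \<Rightarrow> 'a \<Rightarrow> 'a \<Rightarrow> ('a \<Rightarrow> bool) \<Rightarrow> 'a \<Rightarrow> bool" where
  "cont X \<tau> R P f \<longleftrightarrow> isfun f X R \<and>
    (\<forall>V. P V \<longrightarrow> Sep X (\<lambda>x. \<exists>y. y \<epsilon> V \<and> pr x y \<epsilon> f) \<epsilon> \<tau>)"

definition zero_set :: "'a \<Rightarrow> 'a \<Rightarrow> 'a \<Rightarrow> 'a \<Rightarrow> 'a \<Rightarrow> 'a \<Rightarrow> bool" where
  "zero_set X \<tau> R a l Z \<longleftrightarrow> (\<exists>f. cont X \<tau> R (ropen R l) f \<and>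
    (\<forall>x. x \<epsilon> Z \<longleftrightarrow> x \<epsilon> X \<and> (\<exists>c. neutral a R c \<and> pr x c \<epsilon> f)))"

definition absdiff :: "'a \<Rightarrow> 'a \<Rightarrow> 'a \<Rightarrow> 'a \<Rightarrow> 'a \<Rightarrow> 'a \<Rightarrow> bool" where
  "absdiff R a l x y d \<longleftrightarrow> (\<exists>w c. w \<epsilon> R \<and> d \<epsilon> R \<and> pr (pr w y) x \<epsilon> a \<and> neutral a R c \<and>
    ((pr c w \<epsilon> l \<or> c = w) \<and> d = w \<or> pr w c \<epsilon> l \<and> pr (pr w d) c \<epsilon> a))"

definition inU :: "'a \<Rightarrow> 'a \<Rightarrow> 'a \<Rightarrow> 'a \<Rightarrow> 'a \<Rightarrow> 'a \<Rightarrow> bool" where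
  "inU X \<tau> R a l f \<longleftrightarrow> cont X \<tau> R (ropen R l) f \<and>
    (\<forall>\<delta> c. neutral a R c \<and> pr c \<delta> \<epsilon> l \<longrightarrow>
      (\<exists>A. cnt A \<and> (\<forall>B. B \<epsilon> A \<longrightarrow> clopen X \<tau> B) \<and> (\<forall>x. x \<epsilon> X \<longrightarrow> (\<exists>B. B \<epsilon> A \<and> x \<epsilon> B)) \<and>
        (\<forall>B. B \<epsilon> A \<longrightarrow> (\<forall>x y u v d. x \<epsilon> B \<and> y \<epsilon> B \<and> pr x u \<epsilon> f \<and> pr y v \<epsilon> f \<and>
          absdiff R a l u v d \<longrightarrow> pr d \<delta> \<epsilon> l \<or> d = \<delta>))))"

lemma sat_fop [simp]: "f < n \<Longrightarrow> x < n \<Longrightarrow> y < n \<Longrightarrow> z < n \<Longrightarrow>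
    sat E (=) e (fop f x y z n) \<longleftrightarrow> pr (pr (lv e n x) (lv e n y)) (lv e n z) \<epsilon> lv e n f"
  by (simp add: fop_def)

lemma sat_fneutral [simp]: "f < n \<Longrightarrow> A < n \<Longrightarrow> c < n \<Longrightarrow>
    sat E (=) e (fneutral f A c n) \<longleftrightarrow> neutral (lv e n f) (lv e n A) (lv e n c)"
  by (simp add: fneutral_def neutral_def)

lemma sat_fle [simp]: "lessn \<R> < n \<Longrightarrow> x < n \<Longrightarrow> y < n \<Longrightarrow> sat E (=) e (fle \<R> x y n) \<longleftrightarrow>
    pr (lv e n x) (lv e n y) \<epsilon> lv e n (lessn \<R>) \<or> lv e n x = lv e n y"
  by (simp add: fle_def)

lemma sat_fopen [simp]: "lessn \<R> < n \<Longrightarrow> car \<R> < n \<Longrightarrow> V < n \<Longrightarrow>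
    sat E (=) e (fopen \<R> V n) \<longleftrightarrow> ropen (lv e n (car \<R>)) (lv e n (lessn \<R>)) (lv e n V)"
  by (simp add: fopen_def ropen_def)

lemma cont_eq:
  "(\<forall>V U. P V \<and> (\<forall>x. x \<epsilon> U \<longleftrightarrow> x \<epsilon> X \<and> (\<exists>y. y \<epsilon> V \<and> pr x y \<epsilon> f)) \<longrightarrow> U \<epsilon> \<tau>) \<longleftrightarrow>
    (\<forall>V. P V \<longrightarrow> Sep X (\<lambda>x. \<exists>y. y \<epsilon> V \<and> pr x y \<epsilon> f) \<epsilon> \<tau>)"
proof -
  have "(\<forall>x. x \<epsilon> U \<longleftrightarrow> x \<epsilon> X \<and> (\<exists>y. y \<epsilon> V \<and> pr x y \<epsilon> f)) \<longleftrightarrow>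
      U = Sep X (\<lambda>x. \<exists>y. y \<epsilon> V \<and> pr x y \<epsilon> f)" for U V
    by (rule Sep_eq) (intro dfns)
  then show ?thesis by auto
qed

lemma sat_fC [simp]: "X < n \<Longrightarrow> t < n \<Longrightarrow> f < n \<Longrightarrow> car \<R> < n \<Longrightarrow> lessn \<R> < n \<Longrightarrow>
    sat E (=) e (fC X t \<R> f n) \<longleftrightarrow>
      cont (lv e n X) (lv e n t) (lv e n (car \<R>)) (ropen (lv e n (car \<R>)) (lv e n (lessn \<R>))) (lv e n f)"
  by (simp add: fC_def fcontinuous_def cont_def cont_eq)

lemma sat_fC_disc [simp]: "X < n \<Longrightarrow> t < n \<Longrightarrow> f < n \<Longrightarrow> car \<R> < n \<Longrightarrow> lessn \<R> < n \<Longrightarrow>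
    sat E (=) e (fC_disc X t \<R> f n) \<longleftrightarrow>
      cont (lv e n X) (lv e n t) (lv e n (car \<R>)) (\<lambda>V. sub V (lv e n (car \<R>))) (lv e n f)"
  by (simp add: fC_disc_def fcontinuous_def fopen_disc_def cont_def cont_eq)

lemma sat_fzero_set [simp]:
  "X < n \<Longrightarrow> t < n \<Longrightarrow> Z < n \<Longrightarrow> car \<R> < n \<Longrightarrow> addn \<R> < n \<Longrightarrow> lessn \<R> < n \<Longrightarrow>
    sat E (=) e (fzero_set X t \<R> Z n) \<longleftrightarrow> zero_set (lv e n X) (lv e n t)
      (lv e n (car \<R>)) (lv e n (addn \<R>)) (lv e n (lessn \<R>)) (lv e n Z)"
  by (simp add: fzero_set_def zero_set_def)

lemma sat_fcompletely_regular:
  "X < n \<Longrightarrow> t < n \<Longrightarrow> car \<R> < n \<Longrightarrow> addn \<R> < n \<Longrightarrow> lessn \<R> < n \<Longrightarrow>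
    sat E (=) e (fcompletely_regular X t \<R> n) \<longleftrightarrow> base (lv e n t) (\<lambda>B. \<exists>Z. zero_set (lv e n X)
      (lv e n t) (lv e n (car \<R>)) (lv e n (addn \<R>)) (lv e n (lessn \<R>)) Z \<and>
      sub Z (lv e n X) \<and> B = Sep (lv e n X) (\<lambda>x. \<not> x \<epsilon> Z))"
  by (simp add: fcompletely_regular_def fbase_def base_def)

lemma sat_fabsdiff [simp]:
  "car \<R> < n \<Longrightarrow> addn \<R> < n \<Longrightarrow> lessn \<R> < n \<Longrightarrow> x < n \<Longrightarrow> y < n \<Longrightarrow> d < n \<Longrightarrow>
    sat E (=) e (fabsdiff \<R> x y d n) \<longleftrightarrow> absdiff (lv e n (car \<R>)) (lv e n (addn \<R>))
      (lv e n (lessn \<R>)) (lv e n x) (lv e n y) (lv e n d)"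
  by (simp add: fabsdiff_def absdiff_def)

lemma sat_fU [simp]:
  "X < n \<Longrightarrow> t < n \<Longrightarrow> f < n \<Longrightarrow> car \<R> < n \<Longrightarrow> addn \<R> < n \<Longrightarrow> lessn \<R> < n \<Longrightarrow>
    sat E (=) e (fU X t \<R> f n) \<longleftrightarrow> inU (lv e n X) (lv e n t)
      (lv e n (car \<R>)) (lv e n (addn \<R>)) (lv e n (lessn \<R>)) (lv e n f)"
  by (simp add: fU_def inU_def)

definition op :: "'a \<Rightarrow> 'a \<Rightarrow> 'a \<Rightarrow> 'a" where
  "op f x y = app f (pr x y)"

lemma T_op: "T f \<Longrightarrow> T s \<Longrightarrow> T t \<Longrightarrow> T (\<lambda>e. op (f e) (s e) (t e))"
  unfolding op_def by (intro dfns)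

lemma op_eq: "isfun f (cross A A) A \<Longrightarrow> pr (pr x y) z \<epsilon> f \<longleftrightarrow> x \<epsilon> A \<and> y \<epsilon> A \<and> op f x y = z"
  by (auto simp: app_eq op_def)

lemma op_in: "isfun f (cross A A) A \<Longrightarrow> x \<epsilon> A \<Longrightarrow> y \<epsilon> A \<Longrightarrow> op f x y \<epsilon> A"
  unfolding op_def by (rule app_in) auto

lemma neutral_iff:
  "isfun f (cross A A) A \<Longrightarrow> neutral f A c \<longleftrightarrow> c \<epsilon> A \<and> (\<forall>x. x \<epsilon> A \<longrightarrow> op f c x = x)"
  unfolding neutral_def by (auto simp: op_eq)

end

text \<open>Consequences of \<open>fcomplete_ordered_field\<close>, with the graphs of the
  operations replaced by HOL functions. Completeness is internal: suprema are available only for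
  subsets that are sets of the model.\<close>

locale reals = zf_model +
  fixes R a m l :: 'a
  assumes a_fun: "isfun a (cross R R) R" and m_fun: "isfun m (cross R R) R"
    and add_assoc: "x \<epsilon> R \<Longrightarrow> y \<epsilon> R \<Longrightarrow> z \<epsilon> R \<Longrightarrow> op a (op a x y) z = op a x (op a y z)"
    and add_comm: "x \<epsilon> R \<Longrightarrow> y \<epsilon> R \<Longrightarrow> op a x y = op a y x"
    and mult_comm: "x \<epsilon> R \<Longrightarrow> y \<epsilon> R \<Longrightarrow> op m x y = op m y x"
    and ex_zero: "\<exists>c. neutral a R c" and ex_one: "\<exists>c. neutral m R c"
    and distrib: "x \<epsilon> R \<Longrightarrow> y \<epsilon> R \<Longrightarrow> z \<epsilon> R \<Longrightarrow> op m x (op a y z) = op a (op m x y) (op m x z)"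
    and ex_neg: "x \<epsilon> R \<Longrightarrow> \<exists>y. y \<epsilon> R \<and> neutral a R (op a x y)"
    and ex_inverse: "x \<epsilon> R \<Longrightarrow> \<not> neutral a R x \<Longrightarrow> \<exists>y. y \<epsilon> R \<and> neutral m R (op m x y)"
    and zero_neq_one: "neutral a R c \<Longrightarrow> \<not> neutral m R c"
    and less_R: "pr x y \<epsilon> l \<Longrightarrow> x \<epsilon> R \<and> y \<epsilon> R"
    and less_irrefl: "\<not> pr x x \<epsilon> l"
    and less_trans: "pr x y \<epsilon> l \<Longrightarrow> pr y z \<epsilon> l \<Longrightarrow> pr x z \<epsilon> l"
    and less_total: "x \<epsilon> R \<Longrightarrow> y \<epsilon> R \<Longrightarrow> pr x y \<epsilon> l \<or> x = y \<or> pr y x \<epsilon> l"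
    and add_less: "pr x y \<epsilon> l \<Longrightarrow> z \<epsilon> R \<Longrightarrow> pr (op a x z) (op a y z) \<epsilon> l"
    and complete: "sub S R \<Longrightarrow> S \<noteq> emp \<Longrightarrow> b \<epsilon> R \<Longrightarrow> (\<And>x. x \<epsilon> S \<Longrightarrow> pr x b \<epsilon> l \<or> x = b) \<Longrightarrow>
      \<exists>s. s \<epsilon> R \<and> (\<forall>x. x \<epsilon> S \<longrightarrow> pr x s \<epsilon> l \<or> x = s) \<and>
        (\<forall>b. b \<epsilon> R \<and> (\<forall>x. x \<epsilon> S \<longrightarrow> pr x b \<epsilon> l \<or> x = b) \<longrightarrow> pr s b \<epsilon> l \<or> s = b)"

lemma (in zf_model) reals_if_sat:
  assumes n: "R < n" "a < n" "m < n" "l < n"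
    and sat: "sat E (=) e (fcomplete_ordered_field (Real_Vars R a m l) n)"
  shows "reals E (lv e n R) (lv e n a) (lv e n m) (lv e n l)"
proof -
  have field: "sat E (=) e (ffield (Real_Vars R a m l) n)"
    using sat by (simp add: fcomplete_ordered_field_def fordered_field_def)
  have mon: "sat E (=) e (fcomm_monoid a R n)" "sat E (=) e (fcomm_monoid m R n)"
    using field by (simp_all add: ffield_def)
  have a: "isfun (lv e n a) (cross (lv e n R) (lv e n R)) (lv e n R)"
    and m: "isfun (lv e n m) (cross (lv e n R) (lv e n R)) (lv e n R)"
    using mon n by (simp_all add: fcomm_monoid_def fbinop_def)
  note op = op_eq[OF a] op_eq[OF m] op_in[OF a] op_in[OF m]
  have ord: "sat E (=) e (fordered_field (Real_Vars R a m l) n)"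
    using sat by (simp add: fcomplete_ordered_field_def)
  have rel: "\<forall>p. p \<epsilon> lv e n l \<longrightarrow> (\<exists>x y. x \<epsilon> lv e n R \<and> y \<epsilon> lv e n R \<and> p = pr x y)"
    and irrefl: "\<forall>x. x \<epsilon> lv e n R \<longrightarrow> \<not> pr x x \<epsilon> lv e n l"
    and trans: "\<forall>x y z. pr x y \<epsilon> lv e n l \<and> pr y z \<epsilon> lv e n l \<longrightarrow> pr x z \<epsilon> lv e n l"
    and total: "\<forall>x y. x \<epsilon> lv e n R \<and> y \<epsilon> lv e n R \<longrightarrow>
      pr x y \<epsilon> lv e n l \<or> x = y \<or> pr y x \<epsilon> lv e n l"
    and add: "\<forall>x y z s t. z \<epsilon> lv e n R \<and> pr x y \<epsilon> lv e n l \<and>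
      pr (pr x z) s \<epsilon> lv e n a \<and> pr (pr y z) t \<epsilon> lv e n a \<longrightarrow> pr s t \<epsilon> lv e n l"
    using ord by (simp_all (no_asm_use) add: fordered_field_def frelation_def less_SucI n) blast+
  have sup: "\<forall>S. sub S (lv e n R) \<and> S \<noteq> emp \<and>
        (\<exists>b. b \<epsilon> lv e n R \<and> (\<forall>x. x \<epsilon> S \<longrightarrow> pr x b \<epsilon> lv e n l \<or> x = b)) \<longrightarrow>
      (\<exists>s. (s \<epsilon> lv e n R \<and> (\<forall>x. x \<epsilon> S \<longrightarrow> pr x s \<epsilon> lv e n l \<or> x = s)) \<and>
        (\<forall>b. b \<epsilon> lv e n R \<and> (\<forall>x. x \<epsilon> S \<longrightarrow> pr x b \<epsilon> lv e n l \<or> x = b) \<longrightarrow>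
          pr s b \<epsilon> lv e n l \<or> s = b))"
    using sat by (simp (no_asm_use) add: fcomplete_ordered_field_def fupper_bound_def less_SucI n) blast
  show ?thesis
  \<comment> \<open>The cases are numbered in the order of the assumptions of \<open>reals\<close>;
    1 and 2 are closed at the end.\<close>
  proof (unfold_locales, goal_cases)
    case (3 x y z)
    from mon(1) n have "\<forall>x y z. x \<epsilon> lv e n R \<and> y \<epsilon> lv e n R \<and> z \<epsilon> lv e n R \<longrightarrow>
        op (lv e n a) (op (lv e n a) x y) z = op (lv e n a) x (op (lv e n a) y z)"
      by (simp add: fcomm_monoid_def op) (metis op(3))
    with 3 show ?case by blast
  next
    case (4 x y)
    from mon(1) n have "\<forall>x y. x \<epsilon> lv e n R \<and> y \<epsilon> lv e n R \<longrightarrow>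
        op (lv e n a) y x = op (lv e n a) x y"
      by (simp add: fcomm_monoid_def op)
    with 4 show ?case by metis
  next
    case (5 x y)
    from mon(2) n have "\<forall>x y. x \<epsilon> lv e n R \<and> y \<epsilon> lv e n R \<longrightarrow>
        op (lv e n m) y x = op (lv e n m) x y"
      by (simp add: fcomm_monoid_def op)
    with 5 show ?case by metis
  next
    case 6
    then show ?case using mon(1) n by (simp add: fcomm_monoid_def)
  next
    case 7
    then show ?case using mon(2) n by (simp add: fcomm_monoid_def)
  next
    case (8 x y z)
    from field n have "\<forall>x y z. x \<epsilon> lv e n R \<and> y \<epsilon> lv e n R \<and> z \<epsilon> lv e n R \<longrightarrow>
        op (lv e n a) (op (lv e n m) x y) (op (lv e n m) x z) = op (lv e n m) x (op (lv e n a) y z)"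
      by (simp add: ffield_def op)
    with 8 show ?case by metis
  next
    case (9 x)
    then show ?case using field n by (simp add: ffield_def op) blast
  next
    case (10 x)
    then show ?case using field n by (simp add: ffield_def op) blast
  next
    case (11 c)
    then show ?case using field n by (simp add: ffield_def)
  next
    case (12 x y)
    from rel[rule_format, OF this] show ?case by auto
  next
    case (13 x)
    \<comment> \<open>The formula asserts irreflexivity on the carrier; elsewhere \<open>rel\<close>
      excludes the pair.\<close>
    show ?case using irrefl rel by fastforce
  next
    case (14 x y z)
    then show ?case using trans by blast
  next
    case (15 x y)
    then show ?case using total by blast
  next
    case (16 x y z)
    from rel[rule_format, OF 16(1)] have "x \<epsilon> lv e n R" "y \<epsilon> lv e n R" by auto
    with 16 show ?case using add by (simp add: op)
  next
    case (17 S b)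
    then show ?case using sup[rule_format, of S] by blast
  qed (use a m in auto)
qed

subsection \<open>The real numbers\<close>

context reals
begin

abbreviation add (infixl \<open>\<oplus>\<close> 65) where "x \<oplus> y \<equiv> op a x y"
abbreviation less (infix \<open>\<prec>\<close> 50) where "x \<prec> y \<equiv> pr x y \<epsilon> l"
abbreviation le (infix \<open>\<preceq>\<close> 50) where "x \<preceq> y \<equiv> x \<prec> y \<or> x = y"

definition zero (\<open>\<zero>\<close>) where "\<zero> = the1 (neutral a R)"
definition neg (\<open>\<ominus> _\<close> [81] 80) where "\<ominus> x = the1 (\<lambda>y. y \<epsilon> R \<and> x \<oplus> y = \<zero>)"
text \<open>Phrased with addition, so that \<open>T_add\<close> settles its definability;
  multiplication enters in the proof that a solution exists.\<close>

definition half where "half x = the1 (\<lambda>y. y \<epsilon> R \<and> y \<oplus> y = x)"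

lemma add_in [simp]: "x \<epsilon> R \<Longrightarrow> y \<epsilon> R \<Longrightarrow> x \<oplus> y \<epsilon> R"
  by (rule op_in[OF a_fun])

lemma neutral_zero: "neutral a R c \<longleftrightarrow> c = \<zero>"
proof -
  obtain z where z: "neutral a R z" using ex_zero ..
  have "c = z" if "neutral a R c" for c
    using that z add_comm unfolding neutral_iff[OF a_fun] by metis
  moreover from z this have "\<zero> = z" unfolding zero_def by (rule the1_equality)
  ultimately show ?thesis using z by blast
qed

lemma zero_in [simp]: "\<zero> \<epsilon> R"
  using neutral_zero neutral_iff[OF a_fun] by blast

lemma add_zero_left [simp]: "x \<epsilon> R \<Longrightarrow> \<zero> \<oplus> x = x"
  using neutral_zero neutral_iff[OF a_fun] by blast

lemma add_zero_right [simp]: "x \<epsilon> R \<Longrightarrow> x \<oplus> \<zero> = x"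
  using add_comm[of x \<zero>] by simp

lemma neg:
  assumes x: "x \<epsilon> R" shows neg_in [simp]: "\<ominus> x \<epsilon> R" and add_neg: "x \<oplus> \<ominus> x = \<zero>"
proof -
  obtain y where y: "y \<epsilon> R" "x \<oplus> y = \<zero>" using ex_neg[OF x] neutral_zero by blast
  have unique: "z = y" if z: "z \<epsilon> R" "x \<oplus> z = \<zero>" for z
  proof -
    have "y \<oplus> (x \<oplus> z) = (y \<oplus> x) \<oplus> z" using add_assoc y(1) x z(1) by simp
    then show ?thesis using z y x add_comm[of x y] by simp
  qed
  have "\<ominus> x = y" unfolding neg_def by (rule the1_equality) (use y unique in blast)+
  with y show "\<ominus> x \<epsilon> R" "x \<oplus> \<ominus> x = \<zero>" by auto
qed

lemma add_left_neg: "x \<epsilon> R \<Longrightarrow> \<ominus> x \<oplus> x = \<zero>"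
  using add_comm[of "\<ominus> x" x] by (simp add: add_neg)

lemma add_neg_cancel: "x \<epsilon> R \<Longrightarrow> y \<epsilon> R \<Longrightarrow> x \<oplus> y \<oplus> \<ominus> y = x"
  by (simp add: add_assoc add_neg)

lemma neg_add_cancel: "x \<epsilon> R \<Longrightarrow> y \<epsilon> R \<Longrightarrow> x \<oplus> \<ominus> y \<oplus> y = x"
  by (simp add: add_assoc add_left_neg)

lemma add_right_cancel: "x \<epsilon> R \<Longrightarrow> y \<epsilon> R \<Longrightarrow> z \<epsilon> R \<Longrightarrow> x \<oplus> z = y \<oplus> z \<Longrightarrow> x = y"
  using add_neg_cancel by metis

lemma neg_neg [simp]: "x \<epsilon> R \<Longrightarrow> \<ominus> (\<ominus> x) = x"
  by (rule add_right_cancel[of _ _ "\<ominus> x"]) (simp_all add: add_left_neg add_neg)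

lemma neg_zero [simp]: "\<ominus> \<zero> = \<zero>"
  using add_neg[of \<zero>] by simp

lemma less_in: "x \<prec> y \<Longrightarrow> x \<epsilon> R" "x \<prec> y \<Longrightarrow> y \<epsilon> R"
  using less_R by blast+

lemma less_asym: "x \<prec> y \<Longrightarrow> \<not> y \<prec> x"
  using less_trans less_irrefl by blast

lemma le_less_trans: "x \<preceq> y \<Longrightarrow> y \<prec> z \<Longrightarrow> x \<prec> z"
  using less_trans by blast

lemma less_le_trans: "x \<prec> y \<Longrightarrow> y \<preceq> z \<Longrightarrow> x \<prec> z"
  using less_trans by blast

lemma le_trans: "x \<preceq> y \<Longrightarrow> y \<preceq> z \<Longrightarrow> x \<preceq> z"
  using less_trans by blast

lemma not_less: "x \<epsilon> R \<Longrightarrow> y \<epsilon> R \<Longrightarrow> \<not> x \<prec> y \<longleftrightarrow> y \<preceq> x"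
  using less_total less_asym less_irrefl by blast

lemma add_le: "x \<preceq> y \<Longrightarrow> z \<epsilon> R \<Longrightarrow> x \<oplus> z \<preceq> y \<oplus> z"
  using add_less by blast

lemma add_less_left: "x \<prec> y \<Longrightarrow> z \<epsilon> R \<Longrightarrow> z \<oplus> x \<prec> z \<oplus> y"
  using add_less[of x y z] less_in[of x y] add_comm by simp

lemma add_less_add: "x \<prec> y \<Longrightarrow> u \<prec> v \<Longrightarrow> x \<oplus> u \<prec> y \<oplus> v"
  using add_less[of x y u] add_less_left[of u v y] less_in less_trans by blast

lemma add_le_add: "x \<preceq> y \<Longrightarrow> u \<preceq> v \<Longrightarrow> x \<epsilon> R \<Longrightarrow> v \<epsilon> R \<Longrightarrow> x \<oplus> u \<preceq> y \<oplus> v"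
  using add_less[of x y u] add_less[of x y v] add_less_left[of u v x] add_less_add[of x y u v] less_in
  by blast

lemma neg_less: "x \<prec> y \<Longrightarrow> \<ominus> y \<prec> \<ominus> x"
proof -
  assume xy: "x \<prec> y"
  then have in_R: "x \<epsilon> R" "y \<epsilon> R" using less_in by blast+
  have "x \<oplus> (\<ominus> x \<oplus> \<ominus> y) \<prec> y \<oplus> (\<ominus> x \<oplus> \<ominus> y)" using add_less[OF xy] in_R by simp
  moreover have "x \<oplus> (\<ominus> x \<oplus> \<ominus> y) = \<ominus> y"
    using in_R add_assoc[of x "\<ominus> x" "\<ominus> y"] by (simp add: add_neg)
  moreover have "y \<oplus> (\<ominus> x \<oplus> \<ominus> y) = \<ominus> x"
    using in_R add_assoc[of y "\<ominus> y" "\<ominus> x"] add_comm[of "\<ominus> x" "\<ominus> y"] by (simp add: add_neg)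
  ultimately show ?thesis by simp
qed

lemma neg_le: "x \<preceq> y \<Longrightarrow> \<ominus> y \<preceq> \<ominus> x"
  using neg_less by blast

lemma neg_add: "x \<epsilon> R \<Longrightarrow> y \<epsilon> R \<Longrightarrow> \<ominus> (x \<oplus> y) \<oplus> y = \<ominus> x"
proof (rule add_right_cancel[of _ _ x])
  assume in_R: "x \<epsilon> R" "y \<epsilon> R"
  then show "\<ominus> (x \<oplus> y) \<oplus> y \<oplus> x = \<ominus> x \<oplus> x"
    using add_assoc[of "\<ominus> (x \<oplus> y)" y x] add_comm[of x y] by (simp add: add_left_neg)
qed simp_all

lemma T_add: "T s \<Longrightarrow> T t \<Longrightarrow> T (\<lambda>e. s e \<oplus> t e)"
  by (intro T_op dfns)

lemma T_neg: "T s \<Longrightarrow> T (\<lambda>e. \<ominus> s e)"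
  by (rule T_subst1) (unfold neg_def, intro dfns T_add)

lemma T_half: "T (\<lambda>e. half (e 0))"
  unfolding half_def by (intro dfns T_add)

lemma sum_self_unique: "x \<epsilon> R \<Longrightarrow> y \<epsilon> R \<Longrightarrow> x \<oplus> x = y \<oplus> y \<Longrightarrow> x = y"
  using add_less_add less_irrefl less_total by metis

text \<open>If \<open>t\<close> is the inverse of 1 + 1, then \<open>t \<oplus> t\<close> is 1 and
  distributivity makes \<open>op m x t\<close> a half of \<open>x\<close>. That 1 + 1 is not 0 comes
  from the order: both summands have the same sign.\<close>

lemma half:
  assumes x: "x \<epsilon> R" shows half_in: "half x \<epsilon> R" and half_add: "half x \<oplus> half x = x"
proof -
  obtain i where i: "neutral m R i" using ex_one ..
  then have iR: "i \<epsilon> R" and mult_i: "\<And>y. y \<epsilon> R \<Longrightarrow> op m i y = y"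
    unfolding neutral_iff[OF m_fun] by blast+
  have "i \<noteq> \<zero>" using zero_neq_one i neutral_zero by blast
  have "i \<oplus> i \<noteq> \<zero>"
    using add_less_add[of i \<zero> i \<zero>] add_less_add[of \<zero> i \<zero> i] less_total[OF iR zero_in] \<open>i \<noteq> \<zero>\<close>
      less_irrefl[of \<zero>] by auto
  then obtain t where t: "t \<epsilon> R" "neutral m R (op m (i \<oplus> i) t)"
    using ex_inverse[of "i \<oplus> i"] iR neutral_zero by auto
  have mult_in: "op m u v \<epsilon> R" if "u \<epsilon> R" "v \<epsilon> R" for u v
    using that by (rule op_in[OF m_fun])
  have "t \<oplus> t = op m t (i \<oplus> i)" using distrib[of t i i] t iR mult_comm[of t i] mult_i by simp
  then have "neutral m R (t \<oplus> t)" using t iR mult_comm[of t "i \<oplus> i"] by simp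
  then have "op m x (t \<oplus> t) = x"
    using t(1) x mult_comm[of x "t \<oplus> t"] unfolding neutral_iff[OF m_fun] by simp
  then have y: "op m x t \<epsilon> R" "op m x t \<oplus> op m x t = x"
    using distrib[of x t t] x t(1) mult_in by simp_all
  then have "half x = op m x t"
    unfolding half_def by (intro the1_equality) (auto intro: sum_self_unique)
  with y show "half x \<epsilon> R" "half x \<oplus> half x = x" by auto
qed

lemma half_pos: "\<zero> \<prec> x \<Longrightarrow> \<zero> \<prec> half x"
  using half[of x] less_in[of \<zero> x] less_total[of "half x" \<zero>] add_less_add[of "half x" \<zero> "half x" \<zero>]
    less_irrefl less_asym by fastforce

lemma half_less: "\<zero> \<prec> x \<Longrightarrow> half x \<prec> x"
  using add_less[of \<zero> "half x" "half x"] half_pos[of x] half[of x] less_in[of \<zero> x] by simp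

section \<open>Null sequences and grids of real numbers\<close>

lemma ex_pos: "\<exists>p. \<zero> \<prec> p"
proof -
  obtain i where i: "neutral m R i" using ex_one ..
  then have "i \<epsilon> R" "i \<noteq> \<zero>" using zero_neq_one neutral_zero unfolding neutral_def by blast+
  then show ?thesis using less_total[of i \<zero>] neg_less[of i \<zero>] by auto
qed

text \<open>Repeated halving of a positive number. If the sequence stayed above some
  \<open>d\<close>, its lower bounds would have a positive supremum \<open>s\<close>; but each value
  is twice the next one, so \<open>s \<oplus> s\<close> would be a lower bound as well.\<close>

lemma null_sequence:
  obtains h where "isfun h om R" "\<And>n. n \<epsilon> om \<Longrightarrow> \<zero> \<prec> app h n"
    "\<And>n m. n \<epsilon> om \<Longrightarrow> m \<epsilon> n \<Longrightarrow> app h n \<prec> app h m"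
    "\<And>d. \<zero> \<prec> d \<Longrightarrow> \<exists>n. n \<epsilon> om \<and> app h n \<prec> d"
proof -
  obtain p where p: "\<zero> \<prec> p" using ex_pos ..
  then have "p \<epsilon> R" using less_in by blast
  obtain h where h: "isfun h om R" "app h emp = p" "\<And>n. n \<epsilon> om \<Longrightarrow> app h (sc n) = half (app h n)"
    using recursion[OF \<open>p \<epsilon> R\<close> _ T_half] half_in by blast
  have pos: "\<zero> \<prec> app h n" if "n \<epsilon> om" for n
    using that
  proof (induction rule: om_induct)
    case dfn show ?case by (intro dfns)
  qed (use h p half_pos in auto)
  have dec: "\<forall>m. m \<epsilon> n \<longrightarrow> app h n \<prec> app h m" if "n \<epsilon> om" for n
    using that
  proof (induction rule: om_induct)
    case dfn show ?case by (intro dfns)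
  next
    case (sc n)
    have "app h (sc n) \<prec> app h n" using h(3) half_less pos sc.hyps by simp
    with sc.IH show ?case using less_trans by auto
  qed simp
  have small: "\<exists>n. n \<epsilon> om \<and> app h n \<prec> d" if d: "\<zero> \<prec> d" for d
  proof (rule ccontr)
    assume neg: "\<not> (\<exists>n. n \<epsilon> om \<and> app h n \<prec> d)"
    have hR: "app h n \<epsilon> R" if "n \<epsilon> om" for n using app_in[OF h(1) that] .
    define S where "S = Sep R (\<lambda>x. \<forall>n. n \<epsilon> om \<longrightarrow> x \<preceq> app h n)"
    have S: "x \<epsilon> S \<longleftrightarrow> x \<epsilon> R \<and> (\<forall>n. n \<epsilon> om \<longrightarrow> x \<preceq> app h n)" for x
      unfolding S_def by (rule Sep_iff) (intro dfns)
    have dS: "d \<epsilon> S" using neg less_in[OF d] not_less hR unfolding S by blast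
    have "\<exists>s. s \<epsilon> R \<and> (\<forall>x. x \<epsilon> S \<longrightarrow> x \<preceq> s) \<and> (\<forall>b. b \<epsilon> R \<and> (\<forall>x. x \<epsilon> S \<longrightarrow> x \<preceq> b) \<longrightarrow> s \<preceq> b)"
      by (rule complete[of _ p]) (use dS S \<open>p \<epsilon> R\<close> h(2) emp_om in \<open>unfold not_emp, blast+\<close>)
    then obtain s where s: "s \<epsilon> R" "\<And>x. x \<epsilon> S \<Longrightarrow> x \<preceq> s"
      "\<And>b. b \<epsilon> R \<Longrightarrow> \<forall>x. x \<epsilon> S \<longrightarrow> x \<preceq> b \<Longrightarrow> s \<preceq> b" by blast
    have s_le: "s \<preceq> app h n" if "n \<epsilon> om" for n
      by (rule s(3)[OF hR[OF that]]) (use S that in blast)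
    have "s \<oplus> s \<preceq> app h n" if n: "n \<epsilon> om" for n
      using add_le_add[OF s_le[OF sc_om[OF n]] s_le[OF sc_om[OF n]]] s(1) hR[OF sc_om[OF n]]
        h(3)[OF n] half_add[OF hR[OF n]] by simp
    then have "s \<oplus> s \<epsilon> S" using s(1) by (simp add: S)
    then have "s \<oplus> s \<preceq> s" by (rule s(2))
    moreover have "\<zero> \<prec> s" using less_le_trans[OF d s(2)[OF dS]] .
    then have "s \<prec> s \<oplus> s" using add_less[of \<zero> s s] s(1) by simp
    ultimately show False using less_asym less_irrefl by metis
  qed
  show thesis using h(1) pos dec[rule_format] small by (rule that)
qed

text \<open>Supplies the countably many intervals of length \<open>e\<close> for the clopen covers
  in the definition of U. The integer multiples of \<open>e\<close> are enumerated by iterating a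
  single map, which avoids an embedding of the integers into the field.\<close>

lemma grid:
  assumes e: "\<zero> \<prec> e"
  obtains g where "isfun g om R"
    "\<And>r. r \<epsilon> R \<Longrightarrow> \<exists>n. n \<epsilon> om \<and> app g n \<preceq> r \<and> r \<preceq> app g n \<oplus> e"
proof -
  have eR: "e \<epsilon> R" using less_in[OF e] by blast
  \<comment> \<open>The orbit of 0 under this map is 0, e, -e, 2e, -2e, ...\<close>
  define s where "s x = (if \<zero> \<prec> x then \<ominus> x else e \<oplus> \<ominus> x)" for x
  have s_in: "s x \<epsilon> R" if "x \<epsilon> R" for x using that eR by (simp add: s_def)
  have Ts: "T (\<lambda>e. s (e 0))" unfolding s_def by (intro T_if T_add T_neg dfns)
  obtain g where g: "isfun g om R" "app g emp = \<zero>" "\<And>n. n \<epsilon> om \<Longrightarrow> app g (sc n) = s (app g n)"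
    using recursion[OF zero_in s_in Ts] by blast
  define H where "H r \<longleftrightarrow> (\<exists>n. n \<epsilon> om \<and> app g n = r)" for r
  have HR: "H r \<Longrightarrow> r \<epsilon> R" for r using app_in[OF g(1)] unfolding H_def by blast
  have H0: "H \<zero>" unfolding H_def using g(2) emp_om by blast
  have Hs: "H (s r)" if "H r" for r using that g(3) sc_om unfolding H_def by metis
  have Hneg: "H (\<ominus> r)" if "H r" "\<zero> \<prec> r" for r
    using Hs[OF that(1)] that(2) by (simp add: s_def)
  have Hadd: "H (r \<oplus> e)" if r: "H r" "\<zero> \<preceq> r" for r
  proof -
    have "H (\<ominus> r)" using r(2) Hneg[OF r(1)] H0 by auto
    moreover have "\<not> \<zero> \<prec> \<ominus> r" using neg_le[OF r(2)] less_asym less_irrefl by auto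
    ultimately have "H (e \<oplus> \<ominus> (\<ominus> r))" using Hs[of "\<ominus> r"] by (simp add: s_def)
    then show ?thesis using HR[OF r(1)] eR add_comm by simp
  qed
  have pos_add: "\<zero> \<prec> r \<oplus> e" if "\<zero> \<preceq> r" for r
    using that add_less_add[OF _ e, of \<zero> r] e eR by auto
  \<comment> \<open>If \<open>r\<close> lay in no interval, the grid points between 0 and
    \<open>r\<close> would be closed under adding \<open>e\<close>; subtracting \<open>e\<close>
    from their supremum would then leave an upper bound.\<close>
  have nonneg: "\<exists>q. H q \<and> \<zero> \<preceq> q \<and> q \<preceq> r \<and> r \<preceq> q \<oplus> e" if r: "r \<epsilon> R" "\<zero> \<preceq> r" for r
  proof (rule ccontr)
    assume no: "\<not> ?thesis"
    define S where "S = Sep R (\<lambda>q. (\<exists>n. n \<epsilon> om \<and> app g n = q) \<and> \<zero> \<preceq> q \<and> q \<preceq> r)"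
    have "q \<epsilon> S \<longleftrightarrow> q \<epsilon> R \<and> (\<exists>n. n \<epsilon> om \<and> app g n = q) \<and> \<zero> \<preceq> q \<and> q \<preceq> r" for q
      unfolding S_def by (rule Sep_iff) (intro dfns)
    then have S: "q \<epsilon> S \<longleftrightarrow> H q \<and> \<zero> \<preceq> q \<and> q \<preceq> r" for q
      using HR unfolding H_def by blast
    have S0: "\<zero> \<epsilon> S" using H0 r unfolding S by blast
    have "\<exists>u. u \<epsilon> R \<and> (\<forall>x. x \<epsilon> S \<longrightarrow> x \<preceq> u) \<and> (\<forall>b. b \<epsilon> R \<and> (\<forall>x. x \<epsilon> S \<longrightarrow> x \<preceq> b) \<longrightarrow> u \<preceq> b)"
    proof (rule complete[of S r])
      show "sub S R" using S HR by blast
      show "S \<noteq> emp" unfolding not_emp using S0 by blast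
      show "x \<preceq> r" if "x \<epsilon> S" for x using that S by blast
    qed (rule r(1))
    then obtain u where u: "u \<epsilon> R" "\<And>x. x \<epsilon> S \<Longrightarrow> x \<preceq> u"
      "\<And>b. b \<epsilon> R \<Longrightarrow> \<forall>x. x \<epsilon> S \<longrightarrow> x \<preceq> b \<Longrightarrow> u \<preceq> b" by blast
    have "q \<preceq> u \<oplus> \<ominus> e" if q: "q \<epsilon> S" for q
    proof -
      have qR: "q \<epsilon> R" using q S HR by blast
      have "q \<oplus> e \<preceq> r" using no q not_less[of r "q \<oplus> e"] qR eR r(1) unfolding S by auto
      then have "q \<oplus> e \<epsilon> S" using q Hadd pos_add unfolding S by blast
      then have "q \<oplus> e \<oplus> \<ominus> e \<preceq> u \<oplus> \<ominus> e" using add_le[OF u(2)] eR by simp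
      then show ?thesis using add_neg_cancel[OF qR eR] by simp
    qed
    then have "u \<preceq> u \<oplus> \<ominus> e" using u(1,3) eR by simp
    then have "u \<oplus> e \<preceq> u" using add_le[of u "u \<oplus> \<ominus> e" e] neg_add_cancel[OF u(1) eR] eR by simp
    moreover have "u \<prec> u \<oplus> e" using add_less_left[OF e u(1)] u(1) by simp
    ultimately show False using less_asym less_irrefl by metis
  qed
  have "\<exists>q. H q \<and> q \<preceq> r \<and> r \<preceq> q \<oplus> e" if r: "r \<epsilon> R" for r
  proof (cases "r \<prec> \<zero>")
    case False
    then have "\<zero> \<preceq> r" using not_less[OF r zero_in] by blast
    from nonneg[OF r this] show ?thesis by blast
  next
    case True
    then have "\<zero> \<preceq> \<ominus> r" using neg_less[of r \<zero>] by simp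
    then obtain q where q: "H q" "\<zero> \<preceq> q" "q \<preceq> \<ominus> r" "\<ominus> r \<preceq> q \<oplus> e"
      using nonneg[of "\<ominus> r"] r by auto
    \<comment> \<open>The interval around \<open>\<ominus> r\<close> is reflected at 0, so its right
      end becomes the left end for \<open>r\<close>.\<close>
    have "H (\<ominus> (q \<oplus> e))" using Hneg Hadd pos_add q by blast
    moreover have "\<ominus> (q \<oplus> e) \<preceq> r" using neg_le[OF q(4)] r by simp
    moreover have "r \<preceq> \<ominus> (q \<oplus> e) \<oplus> e" using neg_le[OF q(3)] neg_add[OF HR[OF q(1)] eR] r by simp
    ultimately show ?thesis by blast
  qed
  then show thesis using that[OF g(1)] unfolding H_def by blast
qed

end

subsection \<open>Real-valued functions on a space\<close>

locale real_space = reals E R a m l + space E X \<tau>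
  for E :: "'a \<Rightarrow> 'a \<Rightarrow> bool" (infix \<open>\<epsilon>\<close> 50) and R a m l X \<tau>
begin

abbreviation inC where "inC \<equiv> cont X \<tau> R (ropen R l)"
abbreviation inD where "inD \<equiv> cont X \<tau> R (\<lambda>V. sub V R)"

lemma preimage_iff: "y \<epsilon> Sep X (\<lambda>x. app f x \<epsilon> V) \<longleftrightarrow> y \<epsilon> X \<and> app f y \<epsilon> V"
  by (rule Sep_iff) (intro dfns)

lemma cont_iff:
  "cont X \<tau> R P f \<longleftrightarrow> isfun f X R \<and> (\<forall>V. P V \<longrightarrow> Sep X (\<lambda>x. app f x \<epsilon> V) \<epsilon> \<tau>)"
proof -
  have "Sep X (\<lambda>x. \<exists>y. y \<epsilon> V \<and> pr x y \<epsilon> f) = Sep X (\<lambda>x. app f x \<epsilon> V)" if f: "isfun f X R" for V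
  proof (rule ext)
    fix z
    have "z \<epsilon> Sep X (\<lambda>x. \<exists>y. y \<epsilon> V \<and> pr x y \<epsilon> f) \<longleftrightarrow> z \<epsilon> X \<and> (\<exists>y. y \<epsilon> V \<and> pr z y \<epsilon> f)"
      by (rule Sep_iff) (intro dfns)
    then show "z \<epsilon> Sep X (\<lambda>x. \<exists>y. y \<epsilon> V \<and> pr x y \<epsilon> f) \<longleftrightarrow> z \<epsilon> Sep X (\<lambda>x. app f x \<epsilon> V)"
      unfolding preimage_iff app_eq[OF f] by blast
  qed
  then show ?thesis unfolding cont_def by auto
qed

lemma inD_preimage:
  assumes "inD f" and P: "D (\<lambda>e. P (e 0))"
  shows "Sep X (\<lambda>x. P (app f x)) \<epsilon> \<tau>"
proof -
  have f: "isfun f X R" and op: "\<And>V. sub V R \<Longrightarrow> Sep X (\<lambda>x. app f x \<epsilon> V) \<epsilon> \<tau>"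
    using assms(1) unfolding cont_iff by blast+
  have "Sep X (\<lambda>x. app f x \<epsilon> Sep R P) \<epsilon> \<tau>" by (rule op) (simp add: Sep_iff[OF P])
  moreover have "Sep X (\<lambda>x. app f x \<epsilon> Sep R P) = Sep X (\<lambda>x. P (app f x))"
  proof (rule ext)
    fix z
    have "z \<epsilon> Sep X (\<lambda>x. P (app f x)) \<longleftrightarrow> z \<epsilon> X \<and> P (app f z)"
      by (rule Sep_iff) (intro D_subst1[OF P] dfns)
    then show "z \<epsilon> Sep X (\<lambda>x. app f x \<epsilon> Sep R P) \<longleftrightarrow> z \<epsilon> Sep X (\<lambda>x. P (app f x))"
      using preimage_iff[of z f "Sep R P"] Sep_iff[OF P] app_in[OF f] by blast
  qed
  ultimately show ?thesis by simp
qed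

text \<open>The function is continuous for two reasons. Off \<open>G\<close> it is locally constant,
  since the points with a given first exit form an open set. At a point of \<open>G\<close> the
  values on the open set of points surviving the first \<open>n\<close> stages lie between 0 and
  \<open>app h n\<close>. Its zeros are exactly \<open>G\<close> because \<open>h\<close> is
  positive.\<close>

lemma zero_set_if_CO_delta:
  assumes "cinter (clopen X \<tau>) G"
  shows "zero_set X \<tau> R a l G"
proof -
  obtain F where F: "cnt F" "F \<noteq> emp" "\<And>A. A \<epsilon> F \<Longrightarrow> clopen X \<tau> A"
    and G: "\<And>x. x \<epsilon> G \<longleftrightarrow> (\<forall>A. A \<epsilon> F \<longrightarrow> x \<epsilon> A)" using assms unfolding cinter_def by blast
  have GX: "x \<epsilon> X" if "x \<epsilon> G" for x
    using that F(2,3) G unfolding not_emp clopen_def by blast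
  obtain S \<phi> where S: "sub S om" and "bij \<phi> F S" using F(1) unfolding cnt_def by blast
  then have \<phi>: "isfun \<phi> F S" and inj: "\<And>A B. A \<epsilon> F \<Longrightarrow> B \<epsilon> F \<Longrightarrow> app \<phi> A = app \<phi> B \<Longrightarrow> A = B"
    unfolding bij_iff by blast+
  obtain h where h: "isfun h om R" "\<And>n. n \<epsilon> om \<Longrightarrow> \<zero> \<prec> app h n"
    "\<And>n m. n \<epsilon> om \<Longrightarrow> m \<epsilon> n \<Longrightarrow> app h n \<prec> app h m"
    "\<And>d. \<zero> \<prec> d \<Longrightarrow> \<exists>n. n \<epsilon> om \<and> app h n \<prec> d"
    using null_sequence by blast
  \<comment> \<open>Passing stage \<open>k\<close> means lying in the member of \<open>F\<close>
    with number \<open>k\<close>. Numbers of no member impose no condition, so the stages can run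
    through all of \<open>om\<close>.\<close>
  define P where "P k y \<longleftrightarrow> (\<forall>A. A \<epsilon> F \<and> app \<phi> A = k \<longrightarrow> y \<epsilon> A)" for k y
  have DP: "T s \<Longrightarrow> T t \<Longrightarrow> D (\<lambda>e. P (s e) (t e))" for s t
    by (rule D_subst2) (unfold P_def, intro dfns)
  have P_sep: "y \<epsilon> Sep X (P k) \<longleftrightarrow> y \<epsilon> X \<and> P k y"
    and notP_sep: "y \<epsilon> Sep X (\<lambda>y. \<not> P k y) \<longleftrightarrow> y \<epsilon> X \<and> \<not> P k y" for y k
    by (rule Sep_iff, intro dfns DP)+
  have P_open: "Sep X (P k) \<epsilon> \<tau>" and notP_open: "Sep X (\<lambda>y. \<not> P k y) \<epsilon> \<tau>" for k
  proof -
    have "\<exists>V. V \<epsilon> \<tau> \<and> y \<epsilon> V \<and> sub V (Sep X (P k))" if y: "y \<epsilon> X" "P k y" for y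
    proof (cases "\<exists>A. A \<epsilon> F \<and> app \<phi> A = k")
      case True
      then obtain A where A: "A \<epsilon> F" "app \<phi> A = k" by blast
      with y F(3)[OF A(1)] inj show ?thesis
        by (intro exI[of _ A]) (auto simp: P_sep P_def clopen_def)
    next
      case False
      then show ?thesis using y X_open by (intro exI[of _ X]) (auto simp: P_sep P_def)
    qed
    then show "Sep X (P k) \<epsilon> \<tau>" by (intro openI) (auto simp: P_sep)
    have "\<exists>V. V \<epsilon> \<tau> \<and> y \<epsilon> V \<and> sub V (Sep X (\<lambda>y. \<not> P k y))" if y: "y \<epsilon> X" "\<not> P k y" for y
    proof -
      from y obtain A where A: "A \<epsilon> F" "app \<phi> A = k" "\<not> y \<epsilon> A" unfolding P_def by blast
      with y F(3)[OF A(1)] show ?thesis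
        unfolding notP_sep
        by (intro exI[of _ "Sep X (\<lambda>x. \<not> x \<epsilon> A)"]) (auto simp: compl_iff P_def clopen_def)
    qed
    then show "Sep X (\<lambda>y. \<not> P k y) \<epsilon> \<tau>" by (intro openI) (auto simp: notP_sep)
  qed
  have G_P: "y \<epsilon> G \<longleftrightarrow> (\<forall>k. k \<epsilon> om \<longrightarrow> P k y)" for y
    unfolding G P_def using app_in[OF \<phi>] S by blast
  define N where "N y = lst (\<lambda>k. \<not> P k y)" for y
  have N: "N y \<epsilon> om \<and> \<not> P (N y) y \<and> (\<forall>k. k \<epsilon> N y \<longrightarrow> P k y)" if "\<not> y \<epsilon> G" for y
  proof -
    have "D (\<lambda>e. \<not> P (e 0) y)" by (intro dfns DP)
    note lst[OF this]
    with that show ?thesis unfolding N_def G_P by blast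
  qed
  have N_eq: "N y = n" if "n \<epsilon> om" "\<not> P n y" "\<And>k. k \<epsilon> n \<Longrightarrow> P k y" for y n
    unfolding N_def by (rule lst_eq) (use that in auto)
  define f where "f y = (if y \<epsilon> G then \<zero> else app h (N y))" for y
  have Tf: "T (\<lambda>e. f (e 0))" unfolding f_def N_def lst_def by (intro T_if dfns DP)
  have fR: "f y \<epsilon> R" for y using N app_in[OF h(1)] unfolding f_def by auto
  define g where "g = Lam X R f"
  have g: "isfun g X R" "\<And>y. y \<epsilon> X \<Longrightarrow> app g y = f y"
    unfolding g_def using isfun_Lam[OF Tf, of X R] fR by blast+
  have "inC g" unfolding cont_iff
  proof (intro conjI allI impI openI g)
    fix V y assume V: "ropen R l V" and "y \<epsilon> Sep X (\<lambda>x. app g x \<epsilon> V)"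
    then have y: "y \<epsilon> X" "f y \<epsilon> V" unfolding preimage_iff using g(2) by auto
    show "\<exists>W. W \<epsilon> \<tau> \<and> y \<epsilon> W \<and> sub W (Sep X (\<lambda>x. app g x \<epsilon> V))"
    proof (cases "y \<epsilon> G")
      case False
      \<comment> \<open>On the set of points whose first exit is also at stage \<open>n\<close> the
        function has the constant value \<open>f y\<close>.\<close>
      define n where "n = N y"
      have n: "n \<epsilon> om" "\<not> P n y" "\<forall>k. k \<epsilon> n \<longrightarrow> P k y" using N[OF False] unfolding n_def by blast+
      let ?W = "Sep X (\<lambda>z. (\<forall>k. k \<epsilon> n \<longrightarrow> P k z) \<and> \<not> P n z)"
      have W: "z \<epsilon> ?W \<longleftrightarrow> z \<epsilon> X \<and> (\<forall>k. k \<epsilon> n \<longrightarrow> P k z) \<and> \<not> P n z" for z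
        by (rule Sep_iff) (intro dfns DP)
      have "?W \<epsilon> \<tau>"
      proof (rule open_Int)
        show "Sep X (\<lambda>z. \<forall>k. k \<epsilon> n \<longrightarrow> P k z) \<epsilon> \<tau>"
          by (rule nat_inter[OF _ P_open n(1)]) (intro DP dfns)
      qed (intro dfns DP notP_open)+
      moreover have "app g z \<epsilon> V" if z: "z \<epsilon> ?W" for z
      proof -
        have "N z = n" using z n(1) unfolding W by (intro N_eq) auto
        moreover have "\<not> z \<epsilon> G" using z n(1) unfolding W G_P by blast
        ultimately have "f z = f y" using False by (simp add: f_def n_def)
        with y(2) g(2) z show ?thesis unfolding W by simp
      qed
      ultimately show ?thesis
        using n y(1) by (intro exI[of _ ?W]) (simp add: W preimage_iff)
    next
      case True
      then have "\<zero> \<epsilon> V" using y(2) by (simp add: f_def)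
      then obtain b c where bc: "b \<prec> \<zero>" "\<zero> \<prec> c" "\<And>r. b \<prec> r \<Longrightarrow> r \<prec> c \<Longrightarrow> r \<epsilon> V"
        using V unfolding ropen_def by blast
      \<comment> \<open>A point passing all stages below this \<open>n\<close> leaves at
        \<open>n\<close> or later, or never; as \<open>h\<close> decreases, its value stays below
        \<open>c\<close>.\<close>
      obtain n where n: "n \<epsilon> om" "app h n \<prec> c" using h(4)[OF bc(2)] by blast
      let ?W = "Sep X (\<lambda>z. \<forall>k. k \<epsilon> n \<longrightarrow> P k z)"
      have W: "z \<epsilon> ?W \<longleftrightarrow> z \<epsilon> X \<and> (\<forall>k. k \<epsilon> n \<longrightarrow> P k z)" for z
        by (rule Sep_iff) (intro dfns DP)
      have "?W \<epsilon> \<tau>"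
        by (rule nat_inter[OF _ P_open n(1)]) (intro DP dfns)
      moreover have "app g z \<epsilon> V" if z: "z \<epsilon> ?W" for z
      proof (cases "z \<epsilon> G")
        case True
        then show ?thesis using z g(2) \<open>\<zero> \<epsilon> V\<close> unfolding W by (simp add: f_def)
      next
        case False
        then have "\<not> N z \<epsilon> n" using z N unfolding W by blast
        then have "app h (N z) \<preceq> app h n" using om_linear[OF n(1)] N[OF False] h(3) by blast
        then have "app h (N z) \<prec> c" using n(2) le_less_trans by blast
        moreover have "b \<prec> app h (N z)" using less_trans[OF bc(1) h(2)] N[OF False] by blast
        ultimately have "f z \<epsilon> V" using bc(3) False by (simp add: f_def)
        then show ?thesis using z g(2) unfolding W by simp
      qed
      moreover have "y \<epsilon> ?W" using y(1) True om_mem[OF n(1)] unfolding W G_P by blast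
      ultimately show ?thesis by (intro exI[of _ ?W]) (simp add: W preimage_iff)
    qed
  qed
  moreover have "x \<epsilon> G \<longleftrightarrow> x \<epsilon> X \<and> (\<exists>c. neutral a R c \<and> pr x c \<epsilon> g)" for x
  proof -
    have "f x \<noteq> \<zero>" if "\<not> x \<epsilon> G"
      using h(2)[of "N x"] N[OF that] less_irrefl[of \<zero>] that unfolding f_def by auto
    then have "f x = \<zero> \<longleftrightarrow> x \<epsilon> G" by (auto simp: f_def)
    then show ?thesis using GX g(2) unfolding neutral_zero app_eq[OF g(1)] by auto
  qed
  ultimately show ?thesis unfolding zero_set_def by blast
qed

lemma zero_set_open_if_disc:
  assumes "\<And>f. inC f \<Longrightarrow> inD f" "zero_set X \<tau> R a l Z"
  shows "Z \<epsilon> \<tau>"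
proof -
  obtain f where f: "inC f" and Z: "\<And>x. x \<epsilon> Z \<longleftrightarrow> x \<epsilon> X \<and> (\<exists>c. neutral a R c \<and> pr x c \<epsilon> f)"
    using assms(2) unfolding zero_set_def by blast
  have "isfun f X R" using f unfolding cont_iff by blast
  have "x \<epsilon> Sep X (\<lambda>x. app f x = \<zero>) \<longleftrightarrow> x \<epsilon> X \<and> app f x = \<zero>" for x
    by (rule Sep_iff) (intro dfns)
  then have "Sep X (\<lambda>x. app f x = \<zero>) = Z"
    by (intro ext) (auto simp: Z neutral_zero app_eq[OF \<open>isfun f X R\<close>])
  moreover have "Sep X (\<lambda>x. app f x = \<zero>) \<epsilon> \<tau>"
    by (rule inD_preimage[OF assms(1)[OF f]]) (intro dfns)
  ultimately show ?thesis by simp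
qed

text \<open>A basic open set is the complement of a zero-set. As the zero-set is open too, the basic
  set is clopen, and the space is zero-dimensional.\<close>

theorem P_space_if_zero_sets_open:
  assumes cmc
    and base: "base \<tau> (\<lambda>B. \<exists>Z. zero_set X \<tau> R a l Z \<and> sub Z X \<and> B = Sep X (\<lambda>x. \<not> x \<epsilon> Z))"
    and Z: "\<And>Z. zero_set X \<tau> R a l Z \<Longrightarrow> Z \<epsilon> \<tau>"
  shows "P_space \<tau>"
proof (rule P_space_if_CO_delta_open[OF \<open>cmc\<close>])
  show "G \<epsilon> \<tau>" if "cinter (clopen X \<tau>) G" for G
    using that zero_set_if_CO_delta Z by blast
  have clopen: "clopen X \<tau> (Sep X (\<lambda>x. \<not> x \<epsilon> Z))"
    if "zero_set X \<tau> R a l Z" "Sep X (\<lambda>x. \<not> x \<epsilon> Z) \<epsilon> \<tau>" for Z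
  proof -
    have "Sep X (\<lambda>x. \<not> x \<epsilon> Sep X (\<lambda>x. \<not> x \<epsilon> Z)) = Z"
      by (rule ext, subst compl_iff, subst compl_iff) (use open_sub[OF Z[OF that(1)]] in blast)
    then show ?thesis using that(2) Z[OF that(1)] unfolding clopen_def compl_iff by simp
  qed
  show "base \<tau> (clopen X \<tau>)" unfolding base_def
  proof (intro conjI allI impI)
    show "B \<epsilon> \<tau>" if "clopen X \<tau> B" for B using that by (simp add: clopen_def)
    fix U x assume "U \<epsilon> \<tau> \<and> x \<epsilon> U"
    from base[unfolded base_def, THEN conjunct2, rule_format, OF this]
    obtain B where B_ex: "\<exists>Z. zero_set X \<tau> R a l Z \<and> sub Z X \<and> B = Sep X (\<lambda>x. \<not> x \<epsilon> Z)"
      and B: "x \<epsilon> B" "sub B U" by (elim exE[where Q = thesis] conjE) (intro that exI conjI)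
    from base[unfolded base_def, THEN conjunct1, rule_format, OF B_ex] B_ex clopen
    have "clopen X \<tau> B" by auto
    with B show "\<exists>B. clopen X \<tau> B \<and> x \<epsilon> B \<and> sub B U" by blast
  qed
qed

lemma inD_imp_inC: "inD f \<Longrightarrow> inC f"
  unfolding cont_iff ropen_def by blast

text \<open>The preimage of an arbitrary set of reals is a union of fibres. Each fibre is the
  intersection of the preimages of the open intervals about its value whose radii are the terms of a
  null sequence.\<close>

lemma P_space_imp_inD:
  assumes P: "P_space \<tau>" and f: "inC f"
  shows "inD f"
proof -
  have fun_f: "isfun f X R" and f_open: "\<And>V. ropen R l V \<Longrightarrow> Sep X (\<lambda>x. app f x \<epsilon> V) \<epsilon> \<tau>"
    using f unfolding cont_iff by blast+
  obtain h where h: "isfun h om R" "\<And>n. n \<epsilon> om \<Longrightarrow> \<zero> \<prec> app h n"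
    "\<And>d. \<zero> \<prec> d \<Longrightarrow> \<exists>n. n \<epsilon> om \<and> app h n \<prec> d"
    by (rule null_sequence) (rule that)
  have hR: "app h n \<epsilon> R" if "n \<epsilon> om" for n using app_in[OF h(1) that] .
  \<comment> \<open>Two distinct reals are separated by some term of the null sequence; this puts a
    value other than \<open>r\<close> outside one of the intervals.\<close>
  have gap: "\<exists>n. n \<epsilon> om \<and> s \<oplus> app h n \<prec> r" if "s \<prec> r" for s r
  proof -
    have sr: "s \<epsilon> R" "r \<epsilon> R" using less_in[OF that] .
    then have "\<zero> \<prec> r \<oplus> \<ominus> s" using add_less[OF that, of "\<ominus> s"] by (simp add: add_neg)
    then obtain n where n: "n \<epsilon> om" "app h n \<prec> r \<oplus> \<ominus> s" using h(3) by blast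
    then have "app h n \<oplus> s \<prec> r" using add_less[OF n(2) sr(1)] sr by (simp add: neg_add_cancel)
    then show ?thesis using n(1) add_comm[OF hR[OF n(1)] sr(1)] by auto
  qed
  have fibre: "Sep X (\<lambda>z. app f z = r) \<epsilon> \<tau>" if r: "r \<epsilon> R" for r
  proof -
    define I where "I n = Sep R (\<lambda>s. r \<oplus> \<ominus> app h n \<prec> s \<and> s \<prec> r \<oplus> app h n)" for n
    have I: "s \<epsilon> I n \<longleftrightarrow> r \<oplus> \<ominus> app h n \<prec> s \<and> s \<prec> r \<oplus> app h n" for s n
    proof -
      have "s \<epsilon> I n \<longleftrightarrow> s \<epsilon> R \<and> r \<oplus> \<ominus> app h n \<prec> s \<and> s \<prec> r \<oplus> app h n"
        unfolding I_def by (rule Sep_iff) (intro dfns)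
      then show ?thesis using less_in by blast
    qed
    have "ropen R l (I n)" for n unfolding ropen_def I using less_in by blast
    then have W_open: "Sep X (\<lambda>z. app f z \<epsilon> I n) \<epsilon> \<tau>" for n by (rule f_open)
    have TW: "T (\<lambda>e. Sep X (\<lambda>z. app f z \<epsilon> I (e 0)))"
      unfolding I_def by (intro dfns T_add T_neg)
    define F where "F = Sep \<tau> (\<lambda>U. \<exists>n. n \<epsilon> om \<and> U = Sep X (\<lambda>z. app f z \<epsilon> I n))"
    have F: "U \<epsilon> F \<longleftrightarrow> (\<exists>n. n \<epsilon> om \<and> U = Sep X (\<lambda>z. app f z \<epsilon> I n))" for U
    proof -
      have "U \<epsilon> F \<longleftrightarrow> U \<epsilon> \<tau> \<and> (\<exists>n. n \<epsilon> om \<and> U = Sep X (\<lambda>z. app f z \<epsilon> I n))"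
        unfolding F_def by (rule Sep_iff) (intro dfns T_comp1[OF TW])
      then show ?thesis using W_open by blast
    qed
    have fib: "z \<epsilon> Sep X (\<lambda>z. app f z = r) \<longleftrightarrow> z \<epsilon> X \<and> app f z = r" for z
      by (rule Sep_iff) (intro dfns)
    have "cinter (\<lambda>U. U \<epsilon> \<tau>) (Sep X (\<lambda>z. app f z = r))" unfolding cinter_def
    proof (intro exI conjI allI)
      show "cnt F" by (rule cnt_image_om[OF TW]) (use F in blast)
      show "F \<noteq> emp" unfolding not_emp F using emp_om by blast
      show "A \<epsilon> F \<longrightarrow> A \<epsilon> \<tau>" for A unfolding F using W_open by blast
      fix z
      have "r \<epsilon> I n" if "n \<epsilon> om" for n
        using add_less_left[OF h(2)[OF that] r] add_less_left[OF neg_less[OF h(2)[OF that]] r] r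
        by (simp add: I)
      moreover have "app f z = r" if z: "z \<epsilon> X" "\<And>n. n \<epsilon> om \<Longrightarrow> app f z \<epsilon> I n"
      proof (rule ccontr)
        assume "app f z \<noteq> r"
        then consider "app f z \<prec> r" | "r \<prec> app f z"
          using less_total[OF app_in[OF fun_f z(1)] r] by blast
        then show False
        proof cases
          case 1
          then obtain n where n: "n \<epsilon> om" "app f z \<oplus> app h n \<prec> r" using gap by blast
          have "app f z \<prec> r \<oplus> \<ominus> app h n"
            using add_less[OF n(2), of "\<ominus> app h n"] add_neg_cancel[OF app_in[OF fun_f z(1)] hR[OF n(1)]]
              hR[OF n(1)] by simp
          with z(2)[OF n(1)] show False unfolding I using less_asym by blast
        next
          case 2
          then obtain n where n: "n \<epsilon> om" "r \<oplus> app h n \<prec> app f z" using gap by blast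
          with z(2)[OF n(1)] show False unfolding I using less_asym by blast
        qed
      qed
      ultimately show "z \<epsilon> Sep X (\<lambda>z. app f z = r) \<longleftrightarrow> (\<forall>A. A \<epsilon> F \<longrightarrow> z \<epsilon> A)"
        unfolding fib F using preimage_iff emp_om by metis
    qed
    then show ?thesis using P unfolding P_space_def by blast
  qed
  have fib: "z \<epsilon> Sep X (\<lambda>z. app f z = r) \<longleftrightarrow> z \<epsilon> X \<and> app f z = r" for z r
    by (rule Sep_iff) (intro dfns)
  show ?thesis unfolding cont_iff
  proof (intro conjI allI impI fun_f openI)
    fix V y assume V: "sub V R" and y: "y \<epsilon> Sep X (\<lambda>x. app f x \<epsilon> V)"
    then show "\<exists>W. W \<epsilon> \<tau> \<and> y \<epsilon> W \<and> sub W (Sep X (\<lambda>x. app f x \<epsilon> V))"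
      unfolding preimage_iff
      by (intro exI[of _ "Sep X (\<lambda>z. app f z = app f y)"]) (auto simp: fib intro: fibre)
  qed
qed

section \<open>Countable clopen covers and the characterization of P-spaces\<close>

lemma le_cancel: "x \<oplus> z \<preceq> y \<oplus> z \<Longrightarrow> x \<epsilon> R \<Longrightarrow> y \<epsilon> R \<Longrightarrow> z \<epsilon> R \<Longrightarrow> x \<preceq> y"
  using add_le[of "x \<oplus> z" "y \<oplus> z" "\<ominus> z"] add_neg_cancel[of x z] add_neg_cancel[of y z] by simp

text \<open>Preimages of complementary sets of reals are both open here, so the closed grid
  intervals of length \<open>\<delta>\<close> have clopen preimages, and these cover the
  space.\<close>

lemma inD_imp_inU:
  assumes f: "inD f" shows "inU X \<tau> R a l f"
  unfolding inU_def
proof (intro conjI allI impI)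
  show "inC f" using f by (rule inD_imp_inC)
  have fun_f: "isfun f X R" using f unfolding cont_iff by blast
  fix \<delta> c assume "neutral a R c \<and> c \<prec> \<delta>"
  then have \<delta>: "\<zero> \<prec> \<delta>" unfolding neutral_zero by blast
  then have \<delta>R: "\<delta> \<epsilon> R" using less_in by blast
  obtain g where g: "isfun g om R"
    "\<And>r. r \<epsilon> R \<Longrightarrow> \<exists>n. n \<epsilon> om \<and> app g n \<preceq> r \<and> r \<preceq> app g n \<oplus> \<delta>"
    using grid[OF \<delta>] by blast
  define Q where "Q n r \<longleftrightarrow> app g n \<preceq> r \<and> r \<preceq> app g n \<oplus> \<delta>" for n r
  have DQ: "T s \<Longrightarrow> T t \<Longrightarrow> D (\<lambda>e. Q (s e) (t e))" for s t
    by (rule D_subst2) (unfold Q_def, intro dfns T_add)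
  define C where "C n = Sep X (\<lambda>z. Q n (app f z))" for n
  have C: "z \<epsilon> C n \<longleftrightarrow> z \<epsilon> X \<and> Q n (app f z)" for z n
    unfolding C_def by (rule Sep_iff) (intro dfns DQ)
  have TC: "T (\<lambda>e. C (e 0))" unfolding C_def by (intro dfns DQ)
  have C_clopen: "clopen X \<tau> (C n)" for n
  proof -
    have "C n \<epsilon> \<tau>" unfolding C_def by (rule inD_preimage[OF f]) (intro dfns DQ)
    moreover have "Sep X (\<lambda>z. \<not> Q n (app f z)) \<epsilon> \<tau>"
      by (rule inD_preimage[OF f]) (intro dfns DQ)
    moreover have "Sep X (\<lambda>z. \<not> Q n (app f z)) = Sep X (\<lambda>z. \<not> z \<epsilon> C n)"
    proof (rule ext)
      fix z
      have "z \<epsilon> Sep X (\<lambda>z. \<not> Q n (app f z)) \<longleftrightarrow> z \<epsilon> X \<and> \<not> Q n (app f z)"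
        by (rule Sep_iff) (intro dfns DQ)
      then show "z \<epsilon> Sep X (\<lambda>z. \<not> Q n (app f z)) \<longleftrightarrow> z \<epsilon> Sep X (\<lambda>z. \<not> z \<epsilon> C n)"
        unfolding compl_iff using C by blast
    qed
    ultimately show ?thesis unfolding clopen_def using C by metis
  qed
  define \<A> where "\<A> = Sep \<tau> (\<lambda>U. \<exists>n. n \<epsilon> om \<and> U = C n)"
  have \<A>: "U \<epsilon> \<A> \<longleftrightarrow> (\<exists>n. n \<epsilon> om \<and> U = C n)" for U
  proof -
    have "U \<epsilon> \<A> \<longleftrightarrow> U \<epsilon> \<tau> \<and> (\<exists>n. n \<epsilon> om \<and> U = C n)"
      unfolding \<A>_def by (rule Sep_iff) (intro dfns T_comp1[OF TC])
    then show ?thesis using C_clopen unfolding clopen_def by blast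
  qed
  \<comment> \<open>Here \<open>w\<close> is the difference of \<open>u\<close> and
    \<open>v\<close>. The bound is one-sided and is applied in both orders below, since the absolute
    value is \<open>w\<close> or its negative.\<close>
  have diff_le: "w \<preceq> \<delta>"
    if n: "n \<epsilon> om" and w: "w \<epsilon> R" "w \<oplus> v = u" and uv: "u \<epsilon> R" "v \<epsilon> R" "Q n u" "Q n v" for n u v w
  proof -
    have "u \<preceq> app g n \<oplus> \<delta>" "app g n \<oplus> \<delta> \<preceq> v \<oplus> \<delta>"
      using uv add_le[of "app g n" v \<delta>] \<delta>R unfolding Q_def by blast+
    then have "w \<oplus> v \<preceq> \<delta> \<oplus> v" using le_trans w(2) add_comm[OF uv(2) \<delta>R] by metis
    then show ?thesis using le_cancel w(1) uv(2) \<delta>R by blast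
  qed
  show "\<exists>A. cnt A \<and> (\<forall>B. B \<epsilon> A \<longrightarrow> clopen X \<tau> B) \<and> (\<forall>x. x \<epsilon> X \<longrightarrow> (\<exists>B. B \<epsilon> A \<and> x \<epsilon> B)) \<and>
    (\<forall>B. B \<epsilon> A \<longrightarrow> (\<forall>x y u v d. x \<epsilon> B \<and> y \<epsilon> B \<and> pr x u \<epsilon> f \<and> pr y v \<epsilon> f \<and>
      absdiff R a l u v d \<longrightarrow> d \<preceq> \<delta>))"
  proof (rule exI[of _ \<A>], intro conjI allI impI)
    show "cnt \<A>" by (rule cnt_image_om[OF TC]) (use \<A> in blast)
    show "clopen X \<tau> B" if "B \<epsilon> \<A>" for B using that C_clopen unfolding \<A> by blast
    show "\<exists>B. B \<epsilon> \<A> \<and> x \<epsilon> B" if "x \<epsilon> X" for x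
      using g(2)[OF app_in[OF fun_f that]] that \<A> C unfolding Q_def by blast
    fix B x y u v d
    assume "B \<epsilon> \<A>" and *: "x \<epsilon> B \<and> y \<epsilon> B \<and> pr x u \<epsilon> f \<and> pr y v \<epsilon> f \<and> absdiff R a l u v d"
    then obtain n where n: "n \<epsilon> om" "B = C n" unfolding \<A> by blast
    have uv: "u \<epsilon> R" "v \<epsilon> R" "Q n u" "Q n v"
      using * app_in[OF fun_f] unfolding n(2) C app_eq[OF fun_f] by blast+
    obtain w where w: "w \<epsilon> R" "d \<epsilon> R" "w \<oplus> v = u" and d: "d = w \<or> w \<oplus> d = \<zero>"
      using * unfolding absdiff_def neutral_zero op_eq[OF a_fun] by blast
    from d show "d \<preceq> \<delta>"
    proof
      assume "d = w"
      with diff_le[OF n(1) w(1,3) uv] show ?thesis by simp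
    next
      assume "w \<oplus> d = \<zero>"
      then have "d \<oplus> u = v" using add_assoc[OF w(2,1) uv(2)] add_comm[OF w(1,2)] w(3) uv by simp
      from diff_le[OF n(1) w(2) this uv(2,1,4,3)] show ?thesis .
    qed
  qed
qed

text \<open>Membership in U includes continuity and follows from continuity into the discrete reals,
  so all three classes coincide as soon as \<open>inC\<close> implies \<open>inD\<close>.
  Conversely, the equality makes zero-sets open, and \<open>CO\<^sub>\<delta>\<close>-sets are
  zero-sets.\<close>

theorem P_space_iff:
  assumes cmc and base: "base \<tau> (clopen X \<tau>)"
  shows "P_space \<tau> \<longleftrightarrow> (\<forall>f. inU X \<tau> R a l f \<longleftrightarrow> inD f) \<and> (\<forall>f. inD f \<longleftrightarrow> inC f)"
proof
  assume "P_space \<tau>"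
  then have *: "inD f \<longleftrightarrow> inC f" for f using P_space_imp_inD inD_imp_inC by blast
  moreover have "inU X \<tau> R a l f \<longleftrightarrow> inD f" for f
    using * inD_imp_inU unfolding inU_def by blast
  ultimately show "(\<forall>f. inU X \<tau> R a l f \<longleftrightarrow> inD f) \<and> (\<forall>f. inD f \<longleftrightarrow> inC f)" by blast
next
  assume "(\<forall>f. inU X \<tau> R a l f \<longleftrightarrow> inD f) \<and> (\<forall>f. inD f \<longleftrightarrow> inC f)"
  then have "Z \<epsilon> \<tau>" if "zero_set X \<tau> R a l Z" for Z using that zero_set_open_if_disc by blast
  then show "P_space \<tau>"
    using P_space_if_CO_delta_open[OF \<open>cmc\<close> base] zero_set_if_CO_delta by blast
qed

end

subsection \<open>Transfer to derivability\<close>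

text \<open>Completeness is stated for sentences, so the axioms and the goal must be shown to be
  closed. The lemmas follow the definitions bottom up, each serving as a rewrite rule for the
  next.\<close>

lemma bounded_connectives [simp]:
  "x < n \<Longrightarrow> y < n \<Longrightarrow> bounded n ((x \<^bold>\<in> y) n)"
  "x < n \<Longrightarrow> y < n \<Longrightarrow> bounded n ((x \<^bold>= y) n)"
  "bounded n ((p \<^bold>\<longrightarrow> q) n) \<longleftrightarrow> bounded n (p n) \<and> bounded n (q n)"
  "bounded n ((\<^bold>\<not> p) n) \<longleftrightarrow> bounded n (p n)"
  "bounded n ((p \<^bold>\<and> q) n) \<longleftrightarrow> bounded n (p n) \<and> bounded n (q n)"
  "bounded n ((p \<^bold>\<or> q) n) \<longleftrightarrow> bounded n (p n) \<and> bounded n (q n)"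
  "bounded n ((p \<^bold>\<longleftrightarrow> q) n) \<longleftrightarrow> bounded n (p n) \<and> bounded n (q n)"
  "bounded n ((\<^bold>\<forall>x. F x) n) \<longleftrightarrow> bounded (Suc n) (F n (Suc n))"
  "bounded n ((\<^bold>\<exists>x. F x) n) \<longleftrightarrow> bounded (Suc n) (F n (Suc n))"
  by (auto simp: mem_def eql_def imp_def neg_def dis_def con_def iff_def all_def exi_def)

lemma bounded_inst:
  assumes "bounded (length xs + k) p" "k \<le> n" and xs: "\<And>x. x \<in> set xs \<Longrightarrow> x < n"
  shows "bounded n (inst p xs n)"
  unfolding inst_def
proof (rule bounded_ren[OF assms(1)])
  fix i assume "i < length xs + k"
  then show "n - Suc (if i < length xs then xs ! i else i - length xs) < n"
    using \<open>k \<le> n\<close> xs[OF nth_mem, of i] by (cases "i < length xs") auto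
qed

lemma bounded_All_funpow: "bounded n ((All ^^ k) p) \<longleftrightarrow> bounded (n + k) p"
  by (induction k arbitrary: n) auto

lemma bounded_basic [simp]:
  "x < n \<Longrightarrow> y < n \<Longrightarrow> bounded n ((x \<^bold>\<subseteq> y) n)"
  "x < n \<Longrightarrow> bounded n (fempty x n)"
  "p < n \<Longrightarrow> x < n \<Longrightarrow> y < n \<Longrightarrow> bounded n (fupair p x y n)"
  "x < n \<Longrightarrow> y < n \<Longrightarrow> bounded n (fsuc x y n)"
  by (simp_all add: fsub_def fempty_def fupair_def fsuc_def)

lemma bounded_pair [simp]:
  "p < n \<Longrightarrow> x < n \<Longrightarrow> y < n \<Longrightarrow> bounded n (fpair p x y n)"
  "w < n \<Longrightarrow> bounded n (finductive w n)"
  by (simp_all add: fpair_def finductive_def)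

lemma bounded_frel [simp]:
  "f < n \<Longrightarrow> x < n \<Longrightarrow> y < n \<Longrightarrow> bounded n (frel f x y n)"
  "f < n \<Longrightarrow> x < n \<Longrightarrow> y < n \<Longrightarrow> bounded n (frelation f x y n)"
  "f < n \<Longrightarrow> x < n \<Longrightarrow> y < n \<Longrightarrow> bounded n (fprod f x y n)"
  "w < n \<Longrightarrow> bounded n (fomega w n)"
  by (simp_all add: frel_def frelation_def fprod_def fomega_def)

lemma bounded_ffun [simp]:
  "f < n \<Longrightarrow> x < n \<Longrightarrow> y < n \<Longrightarrow> bounded n (ffun f x y n)"
  "f < n \<Longrightarrow> x < n \<Longrightarrow> y < n \<Longrightarrow> z < n \<Longrightarrow> bounded n (fop f x y z n)"
  by (simp_all add: ffun_def fop_def)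

lemma bounded_fbij [simp]:
  "f < n \<Longrightarrow> x < n \<Longrightarrow> y < n \<Longrightarrow> bounded n (fbij f x y n)"
  "f < n \<Longrightarrow> x < n \<Longrightarrow> y < n \<Longrightarrow> bounded n (fneutral f x y n)"
  "f < n \<Longrightarrow> x < n \<Longrightarrow> bounded n (fbinop f x n)"
  by (simp_all add: fbij_def fneutral_def fbinop_def)

lemma bounded_ffinite [simp]:
  "x < n \<Longrightarrow> bounded n (ffinite x n)"
  "x < n \<Longrightarrow> bounded n (fcountable x n)"
  "f < n \<Longrightarrow> x < n \<Longrightarrow> bounded n (fcomm_monoid f x n)"
  by (simp_all add: ffinite_def fcountable_def fcomm_monoid_def)

lemma bounded_reals [simp]:
  assumes "car \<R> < n" "addn \<R> < n" "muln \<R> < n" "lessn \<R> < n"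
  shows "bounded n (fcomplete_ordered_field \<R> n)"
  using assms
  by (simp add: fcomplete_ordered_field_def fordered_field_def ffield_def fupper_bound_def fle_def)

lemma bounded_topology [simp]:
  "x < n \<Longrightarrow> y < n \<Longrightarrow> bounded n (ftopology x y n)"
  "x < n \<Longrightarrow> y < n \<Longrightarrow> z < n \<Longrightarrow> bounded n (fcompl x y z n)"
  by (simp_all add: ftopology_def fcompl_def)

lemma bounded_clopen [simp]:
  "x < n \<Longrightarrow> y < n \<Longrightarrow> z < n \<Longrightarrow> bounded n (fclopen x y z n)"
  "y < n \<Longrightarrow> bounded n (fP_space y n)"
  by (simp_all add: fclopen_def fP_space_def fG_delta_def fcountable_inter_def)

lemma bounded_CO_delta [simp]:
  "x < n \<Longrightarrow> y < n \<Longrightarrow> z < n \<Longrightarrow> bounded n (fCO_delta x y z n)"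
  "x < n \<Longrightarrow> y < n \<Longrightarrow> bounded n (fzero_dimensional x y n)"
  by (simp_all add: fCO_delta_def fcountable_inter_def fzero_dimensional_def fbase_def)

lemma bounded_fC [simp]:
  assumes "car \<R> < n" "addn \<R> < n" "lessn \<R> < n" "x < n" "y < n" "f < n"
  shows "bounded n (fC x y \<R> f n)" "bounded n (fC_disc x y \<R> f n)"
  using assms by (simp_all add: fC_def fC_disc_def fcontinuous_def fopen_def fopen_disc_def)

lemma bounded_fU [simp]:
  assumes "car \<R> < n" "addn \<R> < n" "lessn \<R> < n" "x < n" "y < n" "f < n"
  shows "bounded n (fU x y \<R> f n)" "bounded n (fzero_set x y \<R> f n)"
  using assms by (simp_all add: fU_def fzero_set_def fabsdiff_def fle_def)

lemma ZF_bounded: "s \<in> ZF \<Longrightarrow> bounded 0 s"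
proof (induction rule: ZF.induct)
  case (Separation k p)
  then have "bounded (Suc (Suc (Suc k))) (inst p [Suc (Suc k)] (Suc (Suc (Suc k))))"
    by (intro bounded_inst[where k = k]) auto
  then show ?case by (simp add: bounded_All_funpow)
next
  case (Replacement k p)
  then have "bounded n (inst p [x, y] n)" if "k \<le> n" "x < n" "y < n" for x y n
    using that by (intro bounded_inst[where k = k]) auto
  then show ?case by (simp add: bounded_All_funpow)
qed simp_all

text \<open>The singleton map is injective but misses the empty set.\<close>

lemma infinite_model:
  fixes E Q :: "'a \<Rightarrow> 'a \<Rightarrow> bool"
  assumes Q: "equivp Q" and cong: "\<And>a b c d. Q a b \<Longrightarrow> Q c d \<Longrightarrow> E a c \<Longrightarrow> E b d"
    and ZF: "\<And>s e. s \<in> ZF \<Longrightarrow> sat E Q e s"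
  shows "infinite (range Q)"
proof
  assume fin: "finite (range Q)"
  have "\<exists>p. \<forall>z. E z p \<longleftrightarrow> Q z x \<or> Q z y" for x y
    using ZF[OF ZF.Pairing] by (simp add: fupair_def)
  from this[of x x for x] obtain s where s: "\<And>x z. E z (s x) \<longleftrightarrow> Q z x" by metis
  have "\<exists>e. \<forall>z. \<not> E z e"
    using ZF[OF ZF.Infinity, of undefined] by (auto simp: finductive_def fempty_def)
  then obtain e where e: "\<And>z. \<not> E z e" by blast
  have QQ: "Q x y \<longleftrightarrow> Q x = Q y" for x y using Q by (simp add: equivp_def)
  \<comment> \<open>The singleton map on classes of \<open>Q\<close>, computed at a representative.
    Were there finitely many classes, injectivity would make it onto, and the empty set would be a
    singleton.\<close>
  define S where "S c = Q (s (inv Q c))" for c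
  have rep: "Q (inv Q (Q x)) = Q x" for x by (simp add: f_inv_into_f)
  have s_inj: "Q x = Q y" if "Q (s x) = Q (s y)" for x y
    using cong[of x x "s x" "s y"] s QQ that by metis
  have "inj_on S (range Q)"
    by (auto simp: inj_on_def S_def dest!: s_inj simp: rep)
  moreover have "S ` range Q \<subseteq> range Q" by (auto simp: S_def)
  ultimately have "S ` range Q = range Q" using fin by (simp add: endo_inj_surj)
  then obtain c where "Q e = S c" by (metis image_iff rangeI)
  then have "Q (s (inv Q c)) e" using QQ S_def by metis
  then show False using cong[of "inv Q c" "inv Q c" "s (inv Q c)" e] s QQ e by metis
qed

context zf_model
begin

text \<open>Passes from the quantifier over four set variables to an arbitrary instance of the
  locale \<open>reals\<close>, where the theorems about real-valued functions live.\<close>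

lemma sat_for_reals:
  assumes "\<And>R a m l. reals E R a m l \<Longrightarrow>
    sat E (=) (case_nat l (case_nat m (case_nat a (case_nat R e))))
      (F (Real_Vars n (Suc n) (Suc (Suc n)) (Suc (Suc (Suc n)))) (Suc (Suc (Suc (Suc n)))))"
  shows "sat E (=) e ((\<^bold>\<forall>\<^sub>R \<R>. F \<R>) n)"
  unfolding for_reals_def sat_connectives
proof (intro allI impI)
  fix R a m l
  let ?e = "case_nat l (case_nat m (case_nat a (case_nat R e)))"
  let ?n = "Suc (Suc (Suc (Suc n)))"
  assume "sat E (=) ?e (fcomplete_ordered_field (Real_Vars n (Suc n) (Suc (Suc n)) (Suc (Suc (Suc n)))) ?n)"
  from reals_if_sat[OF _ _ _ _ this] have "reals E R a m l" by simp
  then show "sat E (=) ?e (F (Real_Vars n (Suc n) (Suc (Suc n)) (Suc (Suc (Suc n)))) ?n)"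
    by (rule assms)
qed

end

theorem theorem4p12:
  shows "ZF \<turnstile> (CMC \<^bold>\<longrightarrow> (\<^bold>\<forall>X. \<^bold>\<forall>T. ftopology X T \<^bold>\<longrightarrow>
      (\<^bold>\<forall>\<^sub>R \<R>. fcompletely_regular X T \<R> \<^bold>\<and> (\<^bold>\<forall>Z. fzero_set X T \<R> Z \<^bold>\<longrightarrow> Z \<^bold>\<in> T)
          \<^bold>\<longrightarrow> fP_space T) \<^bold>\<and>
      (fzero_dimensional X T \<^bold>\<and> (\<^bold>\<forall>G. fCO_delta X T G \<^bold>\<longrightarrow> G \<^bold>\<in> T)
          \<^bold>\<longrightarrow> fP_space T) \<^bold>\<and>
      (\<^bold>\<forall>\<^sub>R \<R>. fcompletely_regular X T \<R> \<^bold>\<and> fsame (fC_disc X T \<R>) (fC X T \<R>)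
          \<^bold>\<longrightarrow> fP_space T) \<^bold>\<and>
      (\<^bold>\<forall>\<^sub>R \<R>. fzero_dimensional X T \<^bold>\<longrightarrow>
          (fP_space T \<^bold>\<longleftrightarrow>
             fsame (fU X T \<R>) (fC_disc X T \<R>) \<^bold>\<and> fsame (fC_disc X T \<R>) (fC X T \<R>))))) 0"
    (is "_ \<turnstile> ?p 0")
proof (rule completeness)
  show "bounded 0 s" if "s \<in> ZF" for s using that by (rule ZF_bounded)
  show "bounded 0 (?p 0)"
    by (simp add: CMC_def fdenumerable_def for_reals_def fcompletely_regular_def fbase_def fsame_def)
  show "infinite (range Q)" if "equivp Q" "\<And>a b c d. Q a b \<Longrightarrow> Q c d \<Longrightarrow> E a c \<Longrightarrow> E b d"
    "\<And>s e. s \<in> ZF \<Longrightarrow> sat E Q e s" for E Q :: "nat \<Rightarrow> nat \<Rightarrow> bool"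
    using that by (rule infinite_model)
  fix E :: "nat \<Rightarrow> nat \<Rightarrow> bool" and e
  assume "\<And>s e. s \<in> ZF \<Longrightarrow> sat E (=) e s"
  then interpret zf_model E by unfold_locales
  show "sat E (=) e (?p 0)"
    unfolding sat_connectives(3,8) sat_CMC
  proof (intro impI allI)
    fix X \<tau>
    assume cmc
    \<comment> \<open>At depth 2 the levels 0 and 1 denote \<open>X\<close> and
      \<open>\<tau>\<close>; this is why the formulas below mention \<open>0\<close> and
      \<open>Suc 0\<close>.\<close>
    let ?e = "case_nat \<tau> (case_nat X e)"
    assume "sat E (=) ?e (ftopology 0 (Suc 0) (Suc (Suc 0)))"
    then have "istop X \<tau>" by (simp add: sat_ftopology)
    then interpret space E X \<tau> by unfold_locales
    note sat = sat_fcompletely_regular sat_fP_space sat_fzero_dimensional fsame_def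
    have rs: "real_space E R a m l X \<tau>" if "reals E R a m l" for R a m l
      using that space_axioms by (rule real_space.intro)
    show "sat E (=) ?e (((\<^bold>\<forall>\<^sub>R \<R>. fcompletely_regular 0 (Suc 0) \<R> \<^bold>\<and>
          (\<^bold>\<forall>Z. fzero_set 0 (Suc 0) \<R> Z \<^bold>\<longrightarrow> Z \<^bold>\<in> Suc 0) \<^bold>\<longrightarrow> fP_space (Suc 0)) \<^bold>\<and>
        (fzero_dimensional 0 (Suc 0) \<^bold>\<and> (\<^bold>\<forall>G. fCO_delta 0 (Suc 0) G \<^bold>\<longrightarrow> G \<^bold>\<in> Suc 0)
          \<^bold>\<longrightarrow> fP_space (Suc 0)) \<^bold>\<and>
        (\<^bold>\<forall>\<^sub>R \<R>. fcompletely_regular 0 (Suc 0) \<R> \<^bold>\<and>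
          fsame (fC_disc 0 (Suc 0) \<R>) (fC 0 (Suc 0) \<R>) \<^bold>\<longrightarrow> fP_space (Suc 0)) \<^bold>\<and>
        (\<^bold>\<forall>\<^sub>R \<R>. fzero_dimensional 0 (Suc 0) \<^bold>\<longrightarrow> (fP_space (Suc 0) \<^bold>\<longleftrightarrow>
          fsame (fU 0 (Suc 0) \<R>) (fC_disc 0 (Suc 0) \<R>) \<^bold>\<and>
          fsame (fC_disc 0 (Suc 0) \<R>) (fC 0 (Suc 0) \<R>)))) (Suc (Suc 0)))"
      unfolding sat_connectives(5)
    proof (intro conjI sat_for_reals, goal_cases)
      case (1 R a m l)
      with real_space.P_space_if_zero_sets_open[OF rs \<open>cmc\<close>] show ?case by (simp add: sat)
    next
      case 2
      with P_space_if_CO_delta_open[OF \<open>cmc\<close>] show ?case by (simp add: sat)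
    next
      case (3 R a m l)
      with real_space.P_space_if_zero_sets_open[OF rs \<open>cmc\<close>] real_space.zero_set_open_if_disc[OF rs]
      show ?case by (simp add: sat)
    next
      case (4 R a m l)
      with real_space.P_space_iff[OF rs \<open>cmc\<close>] show ?case by (simp add: sat)
    qed
  qed
qed

end
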